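(* Let $l\ge2$. There exists exactly one nontrivial joint determinant $D_l$ from the set of $l$-tuples of commuting invertible matrices over $\mathbb{R}$ into $\mathbb{R}^\times$ which is continuous when restricted to the set of $l$-tuples of commuting matrices in $GL_n(\mathbb{R})$, for each $n\ge 1$, with the usual topology. Moreover, this $D_l$ satisfies $D_l(-1,-1,\dots,-1)=-1$ (where $-1$ denotes the $1\times1$ matrix) and the image of $D_l$ is equal to $\{\pm1\}$.
   Context: For a field $k$, a joint determinant into an abelian group $G$ (here $k=\mathbb{R}$ and $G=\mathbb{R}^\times$, written multiplicatively) is a map $D$ from the set of $l$-tuples of (pairwise) commuting matrices in $GL_n(k)$, for all $n\ge1$, into $G$ such that: (i) (Multilinearity) for commuting $A_1,\dots,A_l,B\in GL_n(k)$ and each $i$, $D(A_1,\dots,A_iB,\dots,A_l)=D(A_1,\dots,A_i,\dots,A_l)\cdot D(A_1,\dots,B,\dots,A_l)$ (with $B$ in the $i$-th position); (ii) (Block diagonal matrices) for commuting $A_1,\dots,A_l\in GL_m(k)$ and commuting $B_1,\dots,B_l\in GL_n(k)$, $D(A_1\oplus B_1,\dots,A_l\oplus B_l)=D(A_1,\dots,A_l)\cdot D(B_1,\dots,B_l)$, where $A\oplus B$ is the block diagonal matrix with blocks $A,B$; (iii) (Similar matrices) $D(SA_1S^{-1},\dots,SA_lS^{-1})=D(A_1,\dots,A_l)$ for commuting $A_1,\dots,A_l\in GL_n(k)$ and any $S\in GL_n(k)$; (iv) (Polynomial homotopy) $D(A_1(0),\dots,A_l(0))=D(A_1(1),\dots,A_l(1))$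 for commuting $A_1(t),\dots,A_l(t)\in GL_n(k[t])$. It is nontrivial if it is not identically equal to the identity element of $G$. *)

theory Defs
  imports
    "HOL-Analysis.Function_Topology"
    "HOL-Computational_Algebra.Polynomial"
    "Jordan_Normal_Form.Matrix"
begin

(* Also used for k[t]: invertible_mat asks for an inverse over the same coefficient ring. *)
definition GL_mat :: "nat \<Rightarrow> 'a::semiring_1 mat set" where
  "GL_mat n = {A \<in> carrier_mat n n. invertible_mat A}"

definition commuting_tuples :: "nat \<Rightarrow> nat \<Rightarrow> 'a::semiring_1 mat list set" where
  "commuting_tuples l n =
     {As. length As = l \<and> set As \<subseteq> GL_mat n \<and> (\<forall>A\<in>set As. \<forall>B\<in>set As. A * B = B * A)}"

definition all_commuting_tuples :: "nat \<Rightarrow> 'a::semiring_1 mat list set" where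
  "all_commuting_tuples l = (\<Union>n\<in>{1..}. commuting_tuples l n)"

definition direct_sum_mat :: "'a::zero mat \<Rightarrow> 'a mat \<Rightarrow> 'a mat" where
  "direct_sum_mat A B =
     four_block_mat A (0\<^sub>m (dim_row A) (dim_col B)) (0\<^sub>m (dim_row B) (dim_col A)) B"

(* The range is the multiplicative group of nonzero reals.  A map on the commuting tuples is
   encoded extensionally, so that equality of joint determinants is equality on their domain. *)
definition joint_determinant :: "nat \<Rightarrow> (real mat list \<Rightarrow> real) \<Rightarrow> bool" where
  "joint_determinant l D \<longleftrightarrow>
     D \<in> all_commuting_tuples l \<rightarrow>\<^sub>E - {0} \<and>
     (\<forall>n\<ge>1. \<forall>As B. \<forall>i<l. B # As \<in> commuting_tuples (Suc l) n \<longrightarrow>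
        D (As[i := As ! i * B]) = D As * D (As[i := B])) \<and>
     (\<forall>m\<ge>1. \<forall>n\<ge>1. \<forall>As\<in>commuting_tuples l m. \<forall>Bs\<in>commuting_tuples l n.
        D (map2 direct_sum_mat As Bs) = D As * D Bs) \<and>
     (\<forall>n\<ge>1. \<forall>As\<in>commuting_tuples l n. \<forall>S\<in>carrier_mat n n. \<forall>T\<in>carrier_mat n n.
        S * T = 1\<^sub>m n \<and> T * S = 1\<^sub>m n \<longrightarrow>
        D (map (\<lambda>A. S * A * T) As) = D As) \<and>
     (\<forall>n\<ge>1. \<forall>As\<in>commuting_tuples l n.
        D (map (map_mat (\<lambda>p. poly p 0)) As) = D (map (map_mat (\<lambda>p. poly p 1)) As))"

definition nontrivial_on_tuples :: "nat \<Rightarrow> (real mat list \<Rightarrow> real) \<Rightarrow> bool" where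
  "nontrivial_on_tuples l D \<longleftrightarrow> (\<exists>As\<in>all_commuting_tuples l. D As \<noteq> 1)"

(* The matrix type carries no topology.  The map to the l*n*n matrix entries is injective on
   the commuting tuples, so pulling back along it gives the subspace topology of R^(l*n*n). *)
definition commuting_tuples_topology :: "nat \<Rightarrow> nat \<Rightarrow> real mat list topology" where
  "commuting_tuples_topology l n =
     pullback_topology (commuting_tuples l n)
       (\<lambda>As. \<lambda>(i, r, c)\<in>{..<l} \<times> {..<n} \<times> {..<n}. (As ! i) $$ (r, c))
       (product_topology (\<lambda>_. euclideanreal) ({..<l} \<times> {..<n} \<times> {..<n}))"

definition continuous_on_tuples :: "nat \<Rightarrow> (real mat list \<Rightarrow> real) \<Rightarrow> bool" where
  "continuous_on_tuples l D \<longleftrightarrow>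
     (\<forall>n\<ge>1. continuous_map (commuting_tuples_topology l n) (top_of_set (- {0})) D)"

lemma topspace_commuting_tuples_topology:
  "topspace (commuting_tuples_topology l n) = commuting_tuples l n"
  by (auto simp: commuting_tuples_topology_def topspace_pullback_topology)

lemma inj_on_entries:
  "inj_on (\<lambda>As. \<lambda>(i, r, c)\<in>{..<l} \<times> {..<n} \<times> {..<n}. (As ! i) $$ (r, c))
     (commuting_tuples l n :: real mat list set)"
proof (rule inj_onI)
  fix As Bs :: "real mat list"
  assume A: "As \<in> commuting_tuples l n" and B: "Bs \<in> commuting_tuples l n"
    and eq: "(\<lambda>(i, r, c)\<in>{..<l} \<times> {..<n} \<times> {..<n}. (As ! i) $$ (r, c)) =
             (\<lambda>(i, r, c)\<in>{..<l} \<times> {..<n} \<times> {..<n}. (Bs ! i) $$ (r, c))"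
  have len: "length As = l" "length Bs = l"
    using A B by (auto simp: commuting_tuples_def)
  have car: "As ! i \<in> carrier_mat n n" "Bs ! i \<in> carrier_mat n n" if "i < l" for i
  proof -
    have "As ! i \<in> set As" "Bs ! i \<in> set Bs"
      using that len by simp_all
    thus "As ! i \<in> carrier_mat n n" "Bs ! i \<in> carrier_mat n n"
      using A B by (auto simp: commuting_tuples_def GL_mat_def)
  qed
  show "As = Bs"
  proof (rule nth_equalityI)
    fix i assume "i < length As"
    hence i: "i < l" using len by simp
    show "As ! i = Bs ! i"
    proof (rule eq_matI)
      fix r c assume "r < dim_row (Bs ! i)" "c < dim_col (Bs ! i)"
      hence "r < n" "c < n" using car(2)[OF i] by auto
      thus "As ! i $$ (r, c) = Bs ! i $$ (r, c)"
        using fun_cong[OF eq, of "(i, r, c)"] i by simp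
    qed (use car[OF i] in auto)
  qed (use len in simp)
qed

end

theory Submission
  imports
    "HOL-Analysis.Topology_Euclidean_Space"
    "HOL-Computational_Algebra.Fundamental_Theorem_Algebra"
    "Jordan_Normal_Form.Char_Poly"
    Defs
begin

text \<open>
  The determinant is the sign \<open>(-1)\<^sup>d\<close>, where \<open>d\<close> is the number, with multiplicity, of
  joint eigenvalues \<open>(\<lambda>\<^sub>1, \<dots>, \<lambda>\<^sub>l)\<close> of the tuple all of whose entries are negative real numbers.

  Existence rests on one observation: the joint eigenvalues of a real tuple are permuted by
  complex conjugation, so a product over them of conjugation-invariant signs depends only on the real
  ones (\<open>joint_spectrum_prod_eq_1\<close>). Multilinearity thereby reduces to the real joint
  eigenvalues, where the map sending \<open>l\<close> nonzero reals to \<open>-1\<close> or \<open>1\<close> according to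
  whether they are all negative is multiplicative in each argument. Continuity follows because the
  joint eigenvalues move continuously and the negative orthant may be replaced by a thin
  conjugation-invariant neighbourhood of it without changing the sign
  (\<open>negative_parity_limit\<close>). Homotopy invariance is continuity along a path, the values being
  discrete. The joint spectrum is characterised by
  \<open>det (y - \<Sum>i. x\<^sub>i A\<^sub>i) = (\<Prod>\<lambda>. y - \<Sum>i. x\<^sub>i \<lambda>\<^sub>i)\<close>,
  an identity that determines it as a multiset and passes to limits.

  For uniqueness, every commuting real tuple is built from \<open>1 \<times> 1\<close> tuples and from
  \<open>2 \<times> 2\<close> tuples of complex multiplications by similarity and block triangular
  extension (\<open>commuting_tuple_induct\<close>). Scaling the off-diagonal block to zero is a polynomial homotopy,
  so a joint determinant is determined by its values on tuples of nonzero reals and of nonzero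
  complex numbers. On complex tuples continuity alone kills the unit circle, and the rest are direct
  sums of two copies of a positive real tuple. On positive reals the companion matrix of
  \<open>X\<^sup>2 - s X + 1\<close>, placed in two slots, stays invertible while \<open>s\<close> moves
  polynomially; comparing \<open>s = x + 1/x\<close> with \<open>s = x\<^sup>2 + 1/x\<^sup>2\<close> gives
  \<open>q\<^sup>2 = q\<^sup>8\<close> for \<open>q = D(x, x, \<dots>)\<close>, hence \<open>q = 1\<close>, and continuity upgrades this to
  \<open>D(x, y, \<dots>) = 1\<close>. What remains are signs: a positive entry is a square and absorbs a
  sign elsewhere, so only \<open>D(-1, \<dots>, -1)\<close> is free, and its square is 1.
\<close>

section \<open>Invertible matrices and commuting tuples\<close>

lemma GL_mat_iff:
  fixes A :: "'a::semiring_1 mat"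
  shows "A \<in> GL_mat n \<longleftrightarrow>
    A \<in> carrier_mat n n \<and> (\<exists>B\<in>carrier_mat n n. A * B = 1\<^sub>m n \<and> B * A = 1\<^sub>m n)"
proof
  assume "A \<in> GL_mat n"
  then obtain B where A: "A \<in> carrier_mat n n" and B: "A * B = 1\<^sub>m n" "B * A = 1\<^sub>m (dim_row B)"
    by (auto simp: GL_mat_def invertible_mat_def inverts_mat_def)
  have "dim_col (A * B) = n" "dim_col (B * A) = dim_row B" by (simp_all add: B)
  hence "B \<in> carrier_mat n n" using A by auto
  thus "A \<in> carrier_mat n n \<and> (\<exists>B\<in>carrier_mat n n. A * B = 1\<^sub>m n \<and> B * A = 1\<^sub>m n)"
    using A B by (intro conjI bexI[of _ B]) auto
qed (auto simp: GL_mat_def invertible_mat_def inverts_mat_def)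

lemma GL_mat_carrier: "A \<in> GL_mat n \<Longrightarrow> A \<in> carrier_mat n n"
  by (simp add: GL_mat_def)

lemma GL_mat_iff_det:
  fixes A :: "'a::field mat"
  shows "A \<in> GL_mat n \<longleftrightarrow> A \<in> carrier_mat n n \<and> det A \<noteq> 0"
proof
  assume "A \<in> GL_mat n"
  then obtain B where A: "A \<in> carrier_mat n n" and B: "B \<in> carrier_mat n n" "A * B = 1\<^sub>m n"
    by (auto simp: GL_mat_iff)
  have "det A * det B = 1" by (metis A B det_mult det_one)
  thus "A \<in> carrier_mat n n \<and> det A \<noteq> 0" using A by auto
next
  assume "A \<in> carrier_mat n n \<and> det A \<noteq> 0"
  thus "A \<in> GL_mat n"
    using det_non_zero_imp_unit[of A n, of undefined]
    by (auto simp: GL_mat_iff Units_def ring_mat_def)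
qed

lemma commuting_tuplesD:
  assumes "As \<in> commuting_tuples l n"
  shows "length As = l" "\<And>A. A \<in> set As \<Longrightarrow> A \<in> GL_mat n"
    "\<And>A. A \<in> set As \<Longrightarrow> A \<in> carrier_mat n n"
    "\<And>A B. A \<in> set As \<Longrightarrow> B \<in> set As \<Longrightarrow> A * B = B * A"
  using assms by (auto simp: commuting_tuples_def dest: GL_mat_carrier)

lemma commuting_tuples_nthD:
  assumes "As \<in> commuting_tuples l n" "i < l"
  shows "As ! i \<in> carrier_mat n n"
  using assms by (auto simp: commuting_tuples_def dest!: nth_mem GL_mat_carrier)

section \<open>Joint eigenvectors\<close>

text \<open>Evaluation of a polynomial at a matrix, applied to a vector: \<open>p(B) v\<close>, by Horner's scheme.\<close>

definition poly_act :: "'a::comm_ring_1 mat \<Rightarrow> 'a vec \<Rightarrow> 'a poly \<Rightarrow> 'a vec" where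
  "poly_act B v p = fold_coeffs (\<lambda>a w. a \<cdot>\<^sub>v v + B *\<^sub>v w) p (0\<^sub>v (dim_vec v))"

context
  fixes B :: "'a::field mat" and v :: "'a vec" and n :: nat
  assumes B: "B \<in> carrier_mat n n" and v: "v \<in> carrier_vec n"
begin

lemma poly_act_0: "poly_act B v 0 = 0\<^sub>v n"
  using v by (simp add: poly_act_def)

lemma poly_act_pCons: "poly_act B v (pCons a p) = a \<cdot>\<^sub>v v + B *\<^sub>v poly_act B v p"
proof (cases "p = 0 \<and> a = 0")
  case True
  thus ?thesis using B v by (auto simp: poly_act_def)
next
  case False
  thus ?thesis by (cases "p = 0") (auto simp: poly_act_def)
qed

lemma poly_act_closed: "poly_act B v p \<in> carrier_vec n"
proof (induction p)
  case (pCons a p)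
  thus ?case using B v by (auto simp: poly_act_pCons intro!: add_carrier_vec mult_mat_vec_carrier)
qed (simp add: poly_act_0)

lemma poly_act_add: "poly_act B v (p + q) = poly_act B v p + poly_act B v q"
proof (induction p q rule: poly_induct2)
  case 0
  show ?case by (simp add: poly_act_0)
next
  case (pCons a p b q)
  have "poly_act B v (pCons a p + pCons b q) =
      (a + b) \<cdot>\<^sub>v v + (B *\<^sub>v poly_act B v p + B *\<^sub>v poly_act B v q)"
    using mult_add_distrib_mat_vec[OF B poly_act_closed poly_act_closed, of p q]
    by (simp add: poly_act_pCons pCons)
  also have "\<dots> = poly_act B v (pCons a p) + poly_act B v (pCons b q)"
    using v B by (intro eq_vecI) (auto simp: poly_act_pCons algebra_simps)
  finally show ?case .
qed

lemma poly_act_smult: "poly_act B v (Polynomial.smult c p) = c \<cdot>\<^sub>v poly_act B v p"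
proof (induction p)
  case 0
  show ?case by (auto simp: poly_act_0)
next
  case (pCons a p)
  have "poly_act B v (Polynomial.smult c (pCons a p)) = (c * a) \<cdot>\<^sub>v v + c \<cdot>\<^sub>v (B *\<^sub>v poly_act B v p)"
    using mult_mat_vec[OF B poly_act_closed, of c p] by (simp add: poly_act_pCons pCons)
  also have "\<dots> = c \<cdot>\<^sub>v poly_act B v (pCons a p)"
    using v B by (intro eq_vecI) (auto simp: poly_act_pCons algebra_simps)
  finally show ?case .
qed

lemma poly_act_sum: "finite K \<Longrightarrow> r < n \<Longrightarrow>
    poly_act B v (\<Sum>k\<in>K. f k) $ r = (\<Sum>k\<in>K. poly_act B v (f k) $ r)"
proof (induction K rule: finite_induct)
  case (insert k K)
  have "dim_vec (poly_act B v p) = n" for p using poly_act_closed by auto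
  with insert show ?case by (simp add: poly_act_add)
qed (simp add: poly_act_0)

end

text \<open>The \<open>n + 1\<close> vectors \<open>v, B v, \<dots>, B\<^sup>n v\<close> in an \<open>n\<close>-dimensional space are linearly dependent.
  The dependency is a kernel vector of the square matrix whose columns they are, padded by a zero row.\<close>

lemma ex_annihilating_poly:
  fixes B :: "'a::field mat"
  assumes B: "B \<in> carrier_mat n n" and v: "v \<in> carrier_vec n"
  shows "\<exists>p. p \<noteq> 0 \<and> poly_act B v p = 0\<^sub>v n"
proof -
  define M where "M = mat (Suc n) (Suc n)
     (\<lambda>(r, k). if r < n then poly_act B v (monom 1 k) $ r else 0)"
  have M: "M \<in> carrier_mat (Suc n) (Suc n)" by (simp add: M_def)
  have "transpose_mat M *\<^sub>v unit_vec (Suc n) n = 0\<^sub>v (Suc n)"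
    by (intro eq_vecI) (auto simp: M_def)
  hence "det (transpose_mat M) = 0"
    using det_0_iff_vec_prod_zero_field[of "transpose_mat M" "Suc n"] M
    by (metis lessI transpose_carrier_mat unit_vec_carrier unit_vec_nonzero)
  hence "det M = 0" using det_transpose[OF M] by simp
  then obtain c where c: "c \<in> carrier_vec (Suc n)" "c \<noteq> 0\<^sub>v (Suc n)" "M *\<^sub>v c = 0\<^sub>v (Suc n)"
    using det_0_iff_vec_prod_zero_field[OF M] by blast
  define p where "p = (\<Sum>k<Suc n. monom (c $ k) k)"
  have coeff: "coeff p k = c $ k" if "k < Suc n" for k
    using that by (simp add: p_def coeff_sum coeff_monom)
  have "p \<noteq> 0"
  proof
    assume "p = 0"
    hence "c $ k = 0" if "k < Suc n" for k using coeff[OF that] by simp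
    hence "c = 0\<^sub>v (Suc n)" using c(1) by (intro eq_vecI) auto
    thus False using c(2) by simp
  qed
  moreover have "poly_act B v p = 0\<^sub>v n"
  proof (rule eq_vecI)
    fix r assume "r < dim_vec (0\<^sub>v n :: 'a vec)"
    hence r: "r < n" by simp
    have "poly_act B v p $ r = (\<Sum>k<Suc n. poly_act B v (monom (c $ k) k) $ r)"
      unfolding p_def by (rule poly_act_sum[OF B v _ r]) simp
    also have "\<dots> = (\<Sum>k<Suc n. c $ k * poly_act B v (monom 1 k) $ r)"
    proof (rule sum.cong)
      fix k
      have "poly_act B v (monom (c $ k) k) = c $ k \<cdot>\<^sub>v poly_act B v (monom 1 k)"
        by (metis poly_act_smult[OF B v] smult_monom mult.right_neutral)
      thus "poly_act B v (monom (c $ k) k) $ r = c $ k * poly_act B v (monom 1 k) $ r"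
        using r poly_act_closed[OF B v, of "monom 1 k"] by simp
    qed simp
    also have "\<dots> = (M *\<^sub>v c) $ r"
      using r c(1) by (simp add: M_def scalar_prod_def mult.commute atLeast0LessThan)
    also have "\<dots> = 0" using c(3) r by simp
    finally show "poly_act B v p $ r = 0\<^sub>v n $ r" using r by simp
  qed (use poly_act_closed[OF B v, of p] in simp)
  ultimately show ?thesis by blast
qed

text \<open>If \<open>p(B) v = 0\<close>, split off a linear factor \<open>p = (X - \<mu>) q\<close>: either \<open>q(B) v\<close> is an
  eigenvector, or \<open>q\<close> is an annihilating polynomial of smaller degree. Every vector that
  occurs is a polynomial in \<open>B\<close> applied to \<open>v\<close>, so it stays in the invariant set.\<close>

lemma ex_eigenvector_in_invariant_subspace:
  fixes B :: "complex mat"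
  assumes B: "B \<in> carrier_mat n n" and E: "E \<subseteq> carrier_vec n"
    and add: "\<And>v w. v \<in> E \<Longrightarrow> w \<in> E \<Longrightarrow> v + w \<in> E"
    and smult: "\<And>c v. v \<in> E \<Longrightarrow> c \<cdot>\<^sub>v v \<in> E"
    and inv: "\<And>v. v \<in> E \<Longrightarrow> B *\<^sub>v v \<in> E"
    and v: "v \<in> E" "v \<noteq> 0\<^sub>v n"
  shows "\<exists>w\<in>E. w \<noteq> 0\<^sub>v n \<and> (\<exists>\<mu>. B *\<^sub>v w = \<mu> \<cdot>\<^sub>v w)"
proof -
  have vc: "v \<in> carrier_vec n" using v E by blast
  note act = poly_act_0[OF B vc] poly_act_pCons[OF B vc]
  have actE: "poly_act B v p \<in> E" for p
  proof (induction p)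
    case 0
    have "0 \<cdot>\<^sub>v v \<in> E" by (rule smult[OF v(1)])
    moreover have "0 \<cdot>\<^sub>v v = 0\<^sub>v n" using vc by (intro eq_vecI) auto
    ultimately show ?case by (simp add: act)
  qed (auto simp: act intro!: add smult inv v(1))
  have "\<exists>w\<in>E. w \<noteq> 0\<^sub>v n \<and> (\<exists>\<mu>. B *\<^sub>v w = \<mu> \<cdot>\<^sub>v w)"
    if "p \<noteq> 0" "poly_act B v p = 0\<^sub>v n" for p
    using that
  proof (induction "degree p" arbitrary: p rule: less_induct)
    case less
    show ?case
    proof (cases "degree p = 0")
      case True
      then obtain a where a: "p = [:a:]" by (metis degree_eq_zeroE)
      have B0: "B *\<^sub>v 0\<^sub>v n = 0\<^sub>v n" using B by (intro eq_vecI) auto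
      have "a \<cdot>\<^sub>v v = 0\<^sub>v n" using less(3) vc B0 by (simp add: a act)
      hence "v = 0\<^sub>v n"
        using less(2) vc by (auto simp: a Matrix.vec_eq_iff)
      thus ?thesis using v by simp
    next
      case False
      hence "\<not> constant (poly p)" by (simp add: constant_degree)
      then obtain \<mu> where "poly p \<mu> = 0" using fundamental_theorem_of_algebra by blast
      then obtain q where q: "p = [:-\<mu>, 1:] * q" by (meson dvdE poly_eq_0_iff_dvd)
      have q0: "q \<noteq> 0" using less(2) q by auto
      have "degree p = Suc (degree q)" by (simp add: q q0 degree_mult_eq del: mult_pCons_left)
      show ?thesis
      proof (cases "poly_act B v q = 0\<^sub>v n")
        case True
        thus ?thesis using less(1)[of q] q0 \<open>degree p = _\<close> by simp
      next
        case False
        let ?w = "poly_act B v q"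
        have w: "?w \<in> carrier_vec n" by (rule poly_act_closed[OF B vc])
        have "p = Polynomial.smult (-\<mu>) q + pCons 0 q" by (simp add: q)
        hence "0\<^sub>v n = poly_act B v (Polynomial.smult (-\<mu>) q + pCons 0 q)" using less(3) by argo
        also have "\<dots> = (-\<mu>) \<cdot>\<^sub>v ?w + B *\<^sub>v ?w"
          using B vc w by (auto simp only: poly_act_add[OF B vc] poly_act_smult[OF B vc] act) auto
        finally have "B *\<^sub>v ?w = \<mu> \<cdot>\<^sub>v ?w"
          using B w by (auto simp: Matrix.vec_eq_iff)
        thus ?thesis using actE False by blast
      qed
    qed
  qed
  thus ?thesis using ex_annihilating_poly[OF B vc] by blast
qed

text \<open>A joint eigenspace of all but one of the matrices is invariant under the last one, which
  commutes with them, and so contains an eigenvector of it.\<close>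

lemma ex_common_eigenvector:
  fixes As :: "complex mat list"
  assumes "set As \<subseteq> carrier_mat n n" "\<And>A B. A \<in> set As \<Longrightarrow> B \<in> set As \<Longrightarrow> A * B = B * A" "n \<ge> 1"
  shows "\<exists>v\<in>carrier_vec n. v \<noteq> 0\<^sub>v n \<and> (\<forall>A\<in>set As. \<exists>\<mu>. A *\<^sub>v v = \<mu> \<cdot>\<^sub>v v)"
  using assms
proof (induction As)
  case Nil
  thus ?case by (auto intro!: bexI[of _ "unit_vec n 0"])
next
  case (Cons A As)
  then obtain v \<mu> where v: "v \<in> carrier_vec n" "v \<noteq> 0\<^sub>v n"
    and \<mu>: "\<And>B. B \<in> set As \<Longrightarrow> B *\<^sub>v v = \<mu> B \<cdot>\<^sub>v v" by (auto, metis)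
  define E where "E = {w \<in> carrier_vec n. \<forall>B\<in>set As. B *\<^sub>v w = \<mu> B \<cdot>\<^sub>v w}"
  have A: "A \<in> carrier_mat n n" and As: "\<And>B. B \<in> set As \<Longrightarrow> B \<in> carrier_mat n n"
    using Cons.prems by auto
  have "\<exists>w\<in>E. w \<noteq> 0\<^sub>v n \<and> (\<exists>\<mu>. A *\<^sub>v w = \<mu> \<cdot>\<^sub>v w)"
  proof (rule ex_eigenvector_in_invariant_subspace[OF A _ _ _ _ _ v(2)])
    fix w assume w: "w \<in> E"
    have "B *\<^sub>v (A *\<^sub>v w) = \<mu> B \<cdot>\<^sub>v (A *\<^sub>v w)" if B: "B \<in> set As" for B
    proof -
      have wc: "w \<in> carrier_vec n" using w by (simp add: E_def)
      have "B *\<^sub>v (A *\<^sub>v w) = (B * A) *\<^sub>v w"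
        using assoc_mult_mat_vec[OF As[OF B] A wc] by simp
      also have "B * A = A * B" using Cons.prems(2)[of A B] B by simp
      also have "(A * B) *\<^sub>v w = A *\<^sub>v (B *\<^sub>v w)"
        using assoc_mult_mat_vec[OF A As[OF B] wc] by simp
      also have "\<dots> = \<mu> B \<cdot>\<^sub>v (A *\<^sub>v w)"
        using w B mult_mat_vec[OF A wc] by (simp add: E_def)
      finally show ?thesis .
    qed
    thus "A *\<^sub>v w \<in> E" using w A by (auto simp: E_def)
  next
    fix v w assume "v \<in> E" "w \<in> E"
    thus "v + w \<in> E" using mult_add_distrib_mat_vec[OF As]
      by (auto simp: E_def smult_add_distrib_vec[symmetric])
  next
    fix c w assume "w \<in> E"
    thus "c \<cdot>\<^sub>v w \<in> E" using mult_mat_vec[OF As]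
      by (auto simp: E_def smult_smult_assoc mult.commute)
  qed (use v \<mu> in \<open>auto simp: E_def\<close>)
  thus ?case by (auto simp: E_def)
qed

section \<open>Block structure of commuting real tuples\<close>

text \<open>The matrix of multiplication by a complex number on the real vector space of complex numbers.\<close>

definition complex_block :: "complex \<Rightarrow> real mat" where
  "complex_block z =
     mat 2 2 (\<lambda>(r, c). if r = c then Re z else if r = 0 then - Im z else Im z)"

definition scalar_block :: "'a \<Rightarrow> 'a mat" where
  "scalar_block x = mat 1 1 (\<lambda>_. x)"

text \<open>The real and imaginary parts of a complex joint eigenvector span an invariant real subspace on
  which the matrices act as complex numbers; if all eigenvalues are real, the real part alone spans
  an invariant line. The rows in \<open>I\<close> certify that the spanning vectors, the columns of \<open>W\<close>,
  are linearly independent; this is the form in which they are extended to a basis below.\<close>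

lemma ex_invariant_block:
  fixes As :: "real mat list"
  assumes car: "set As \<subseteq> carrier_mat n n"
    and comm: "\<And>A B. A \<in> set As \<Longrightarrow> B \<in> set As \<Longrightarrow> A * B = B * A" and n: "n \<ge> 1"
  shows "\<exists>m W I Ms. W \<in> carrier_mat n m \<and> I \<subseteq> {..<n} \<and> card I = m \<and>
      (\<forall>u\<in>carrier_vec m. (\<forall>r\<in>I. (W *\<^sub>v u) $ r = 0) \<longrightarrow> u = 0\<^sub>v m) \<and>
      (\<forall>i<length As. As ! i * W = W * (Ms ! i)) \<and>
      ((m = 1 \<and> (\<exists>xs. length xs = length As \<and> Ms = map scalar_block xs)) \<or>
       (m = 2 \<and> (\<exists>zs. length zs = length As \<and> Ms = map complex_block zs)))"
proof -
  define Cs where "Cs = map (map_mat complex_of_real) As"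
  have "\<exists>v\<in>carrier_vec n. v \<noteq> 0\<^sub>v n \<and> (\<forall>A\<in>set Cs. \<exists>\<mu>. A *\<^sub>v v = \<mu> \<cdot>\<^sub>v v)"
  proof (rule ex_common_eigenvector)
    fix A B assume "A \<in> set Cs" "B \<in> set Cs"
    then obtain A' B' where A': "A' \<in> set As" "A = map_mat of_real A'"
      and B': "B' \<in> set As" "B = map_mat of_real B'" by (auto simp: Cs_def)
    have "A' \<in> carrier_mat n n" "B' \<in> carrier_mat n n" using A' B' car by auto
    thus "A * B = B * A"
      using comm[OF A'(1) B'(1)] by (simp add: A' B' of_real_hom.mat_hom_mult[symmetric])
  qed (use car n in \<open>auto simp: Cs_def\<close>)
  then obtain v0 where v0: "v0 \<in> carrier_vec n" "v0 \<noteq> 0\<^sub>v n"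
    and eig0: "\<And>A. A \<in> set As \<Longrightarrow> \<exists>\<mu>. map_mat complex_of_real A *\<^sub>v v0 = \<mu> \<cdot>\<^sub>v v0"
    by (auto simp: Cs_def)
  from v0 obtain p where p: "p < n" "v0 $ p \<noteq> 0" by (auto simp: Matrix.vec_eq_iff)
  \<comment> \<open>Scaled so that coordinate \<open>p\<close> is 1, the vector has real part 1 and imaginary part 0 there, so
    row \<open>p\<close> of the eigenvalue equation reads off the eigenvalue: were the imaginary part of the
    vector zero, every eigenvalue would be real.\<close>
  define v where "v c = v0 $ c / v0 $ p" for c
  have vp: "v p = 1" using p by (simp add: v_def)
  have "\<exists>\<mu>. \<forall>r<n. (\<Sum>c<n. of_real (A $$ (r, c)) * v c) = \<mu> * v r" if A: "A \<in> set As" for A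
  proof -
    obtain \<mu> where \<mu>: "map_mat complex_of_real A *\<^sub>v v0 = \<mu> \<cdot>\<^sub>v v0" using eig0[OF A] by blast
    have "(\<Sum>c<n. of_real (A $$ (r, c)) * v c) = \<mu> * v r" if r: "r < n" for r
    proof -
      have "A \<in> carrier_mat n n" using car A by auto
      hence "(\<Sum>c<n. of_real (A $$ (r, c)) * v0 $ c) = (map_mat complex_of_real A *\<^sub>v v0) $ r"
        using r v0(1) by (auto simp: scalar_prod_def atLeast0LessThan)
      also have "\<dots> = \<mu> * v0 $ r" using r v0(1) by (simp add: \<mu>)
      finally have "(\<Sum>c<n. of_real (A $$ (r, c)) * v0 $ c) / v0 $ p = \<mu> * v0 $ r / v0 $ p" by simp
      thus ?thesis by (simp add: v_def sum_divide_distrib)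
    qed
    thus ?thesis by blast
  qed
  then obtain \<mu> where \<mu>: "\<And>A r. A \<in> set As \<Longrightarrow> r < n \<Longrightarrow>
      (\<Sum>c<n. of_real (A $$ (r, c)) * v c) = \<mu> A * v r" by metis
  have re: "(\<Sum>c<n. A $$ (r, c) * Re (v c)) = Re (\<mu> A) * Re (v r) - Im (\<mu> A) * Im (v r)"
    and im: "(\<Sum>c<n. A $$ (r, c) * Im (v c)) = Re (\<mu> A) * Im (v r) + Im (\<mu> A) * Re (v r)"
    if "A \<in> set As" "r < n" for A r
    using arg_cong[OF \<mu>[OF that], of Re] arg_cong[OF \<mu>[OF that], of Im] by simp_all
  have nth: "As ! i \<in> set As" "As ! i \<in> carrier_mat n n" if "i < length As" for i
    using that car by (auto dest: nth_mem)
  show ?thesis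
  proof (cases "\<forall>A\<in>set As. Im (\<mu> A) = 0")
    case True
    define W where "W = mat n 1 (\<lambda>(r, c). Re (v r))"
    define Ms where "Ms = map scalar_block (map (\<lambda>A. Re (\<mu> A)) As)"
    have "As ! i * W = W * (Ms ! i)" if "i < length As" for i
      using nth[OF that] re[OF nth(1)[OF that]] True that
      by (intro eq_matI) (auto simp: W_def Ms_def scalar_block_def scalar_prod_def atLeast0LessThan)
    moreover have "u = 0\<^sub>v 1" if "u \<in> carrier_vec 1" "\<forall>r\<in>{p}. (W *\<^sub>v u) $ r = 0" for u
      using that p vp by (intro eq_vecI) (auto simp: W_def scalar_prod_def)
    ultimately show ?thesis
      using p by (intro exI[of _ 1] exI[of _ W] exI[of _ "{p}"] exI[of _ Ms])
        (auto simp: W_def Ms_def intro!: exI[of _ "map (\<lambda>A. Re (\<mu> A)) As"])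
  next
    case False
    then obtain A where A: "A \<in> set As" "Im (\<mu> A) \<noteq> 0" by blast
    have "\<exists>q<n. Im (v q) \<noteq> 0"
    proof (rule ccontr)
      assume "\<not> ?thesis"
      hence "(\<Sum>c<n. A $$ (p, c) * Im (v c)) = 0" by simp
      thus False using im[OF A(1) p(1)] A(2) vp by simp
    qed
    then obtain q where q: "q < n" "Im (v q) \<noteq> 0" by blast
    have pq: "p \<noteq> q" using q vp by auto
    define W where "W = mat n 2 (\<lambda>(r, c). if c = 0 then Re (v r) else Im (v r))"
    \<comment> \<open>In the basis real part, imaginary part, the eigenvalue acts through its conjugate.\<close>
    define Ms where "Ms = map complex_block (map (\<lambda>A. cnj (\<mu> A)) As)"
    have two: "{..<2::nat} = {0, 1}" by auto
    have "As ! i * W = W * (Ms ! i)" if "i < length As" for i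
      using nth[OF that] re[OF nth(1)[OF that]] im[OF nth(1)[OF that]] that
      by (intro eq_matI) (auto simp: W_def Ms_def complex_block_def scalar_prod_def
          atLeast0LessThan two less_2_cases_iff algebra_simps)
    moreover have "u = 0\<^sub>v 2" if u: "u \<in> carrier_vec 2" "\<forall>r\<in>{p, q}. (W *\<^sub>v u) $ r = 0" for u
    proof -
      have "Re (v r) * u $ 0 + Im (v r) * u $ 1 = 0" if "r \<in> {p, q}" for r
        using u that p q by (auto simp: W_def scalar_prod_def atLeast0LessThan two)
      from this[of p] this[of q] show ?thesis
        using vp q u(1) by (intro eq_vecI) (auto simp: less_2_cases_iff)
    qed
    ultimately show ?thesis
      using p q pq by (intro exI[of _ 2] exI[of _ W] exI[of _ "{p, q}"] exI[of _ Ms])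
        (auto simp: W_def Ms_def intro!: exI[of _ "map (\<lambda>A. cnj (\<mu> A)) As"])
  qed
qed

text \<open>The columns of \<open>W\<close> are independent already on the rows in \<open>I\<close>, so the unit vectors
  of the complementary rows complete them to a basis; \<open>\<sigma>\<close> lists those rows.\<close>

lemma ex_basis_extension:
  fixes W :: "'a::field mat"
  assumes W: "W \<in> carrier_mat n m" and I: "I \<subseteq> {..<n}" "card I = m"
    and inj: "\<And>u. u \<in> carrier_vec m \<Longrightarrow> (\<forall>r\<in>I. (W *\<^sub>v u) $ r = 0) \<Longrightarrow> u = 0\<^sub>v m"
  shows "\<exists>P\<in>GL_mat n. \<forall>r<n. \<forall>c<m. P $$ (r, c) = W $$ (r, c)"
proof -
  have fin: "finite I" using I(1) finite_subset by blast
  have mn: "m \<le> n" using I card_mono[of "{..<n}" I] by simp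
  have "card {m..<n} = card ({..<n} - I)" using I fin by (simp add: card_Diff_subset)
  then obtain \<sigma> where \<sigma>: "bij_betw \<sigma> {m..<n} ({..<n} - I)"
    using finite_same_card_bij[of "{m..<n}" "{..<n} - I"] by auto
  define P where "P = mat n n (\<lambda>(r, c). if c < m then W $$ (r, c) else if r = \<sigma> c then 1 else 0)"
  have P: "P \<in> carrier_mat n n" by (simp add: P_def)
  have "x = 0\<^sub>v n" if x: "x \<in> carrier_vec n" "P *\<^sub>v x = 0\<^sub>v n" for x
  proof -
    define u where "u = vec m (\<lambda>c. x $ c)"
    have split: "{..<n} = {..<m} \<union> {m..<n}" using mn by auto
    have row: "(W *\<^sub>v u) $ r + (\<Sum>c\<in>{m..<n}. if r = \<sigma> c then x $ c else 0) = 0" if r: "r < n" for r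
    proof -
      have "0 = (P *\<^sub>v x) $ r" using x(2) r by simp
      also have "\<dots> = (\<Sum>c<n. (if c < m then W $$ (r, c) else if r = \<sigma> c then 1 else 0) * x $ c)"
        using r x(1) P by (simp add: scalar_prod_def P_def atLeast0LessThan)
      also have "\<dots> = (\<Sum>c<m. W $$ (r, c) * x $ c) + (\<Sum>c\<in>{m..<n}. if r = \<sigma> c then x $ c else 0)"
        unfolding split by (subst sum.union_disjoint) (auto intro!: sum.cong)
      also have "(\<Sum>c<m. W $$ (r, c) * x $ c) = (W *\<^sub>v u) $ r"
        using r W by (simp add: scalar_prod_def u_def atLeast0LessThan)
      finally show ?thesis by simp
    qed
    have "u = 0\<^sub>v m"
    proof (rule inj)
      show "\<forall>r\<in>I. (W *\<^sub>v u) $ r = 0"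
      proof
        fix r assume r: "r \<in> I"
        have "(\<Sum>c\<in>{m..<n}. if r = \<sigma> c then x $ c else 0) = 0"
          using r \<sigma> by (intro sum.neutral) (auto dest: bij_betwE)
        thus "(W *\<^sub>v u) $ r = 0" using row[of r] r I by auto
      qed
    qed (simp add: u_def)
    hence low: "x $ c = 0" if "c < m" for c
      using that by (auto simp: u_def Matrix.vec_eq_iff)
    have "x $ c = 0" if c: "c \<in> {m..<n}" for c
    proof -
      have sc: "\<sigma> c < n" using \<sigma> c by (auto dest: bij_betwE)
      have "(W *\<^sub>v u) $ \<sigma> c = 0" using sc W \<open>u = 0\<^sub>v m\<close> by simp
      hence "(\<Sum>d\<in>{m..<n}. if \<sigma> c = \<sigma> d then x $ d else 0) = 0" using row[OF sc] by simp
      also have "(\<Sum>d\<in>{m..<n}. if \<sigma> c = \<sigma> d then x $ d else 0) =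
          (\<Sum>d\<in>{m..<n}. if d = c then x $ d else 0)"
        using \<sigma> c by (intro sum.cong) (auto simp: bij_betw_def inj_on_def)
      finally show ?thesis using c by simp
    qed
    with low x(1) show ?thesis by (intro eq_vecI) (auto, meson not_less)
  qed
  hence "det P \<noteq> 0" using det_0_iff_vec_prod_zero_field[OF P] by blast
  hence "P \<in> GL_mat n" using P by (simp add: GL_mat_iff_det)
  moreover have "\<forall>r<n. \<forall>c<m. P $$ (r, c) = W $$ (r, c)" using mn by (simp add: P_def)
  ultimately show ?thesis by blast
qed

definition block_extension :: "nat \<Rightarrow> 'a::zero mat list \<Rightarrow> 'a mat list \<Rightarrow> 'a mat list \<Rightarrow> 'a mat list" where
  "block_extension l Ms Rs Cs =
     map (\<lambda>i. four_block_mat (Ms ! i) (Rs ! i) (0\<^sub>m (dim_row (Cs ! i)) (dim_col (Ms ! i))) (Cs ! i)) [0..<l]"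

lemma four_block_mat_inject:
  assumes "A \<in> carrier_mat m m" "A' \<in> carrier_mat m m" "B \<in> carrier_mat m k" "B' \<in> carrier_mat m k"
    "D \<in> carrier_mat k k" "D' \<in> carrier_mat k k"
    and eq: "four_block_mat A B C D = four_block_mat A' B' C' D'"
  shows "A = A'" "B = B'" "D = D'"
proof -
  have e: "four_block_mat A B C D $$ (r, c) = four_block_mat A' B' C' D' $$ (r, c)" for r c
    using eq by simp
  show "A = A'"
  proof (rule eq_matI)
    fix r c assume "r < dim_row A'" "c < dim_col A'"
    thus "A $$ (r, c) = A' $$ (r, c)" using e[of r c] assms(1-6) by auto
  qed (use assms in auto)
  show "B = B'"
  proof (rule eq_matI)
    fix r c assume "r < dim_row B'" "c < dim_col B'"
    thus "B $$ (r, c) = B' $$ (r, c)" using e[of r "c + m"] assms(1-6) by auto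
  qed (use assms in auto)
  show "D = D'"
  proof (rule eq_matI)
    fix r c assume "r < dim_row D'" "c < dim_col D'"
    thus "D $$ (r, c) = D' $$ (r, c)" using e[of "r + m" "c + m"] assms(1-6) by auto
  qed (use assms in auto)
qed

lemma mult_block_upper_triangular:
  fixes M :: "'a::comm_semiring_1 mat"
  assumes "M \<in> carrier_mat m m" "R \<in> carrier_mat m k" "C \<in> carrier_mat k k"
    "M' \<in> carrier_mat m m" "R' \<in> carrier_mat m k" "C' \<in> carrier_mat k k"
  shows "four_block_mat M R (0\<^sub>m k m) C * four_block_mat M' R' (0\<^sub>m k m) C' =
    four_block_mat (M * M') (M * R' + R * C') (0\<^sub>m k m) (C * C')"
  using assms
  by (subst mult_four_block_mat[where ?nr1.0 = m and ?n1.0 = m and ?n2.0 = k and ?nr2.0 = k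
        and ?nc1.0 = m and ?nc2.0 = k]) (auto intro!: cong_four_block_mat)

lemma conjugate_mult:
  fixes S :: "'a::semiring_1 mat"
  assumes "S \<in> carrier_mat n n" "T \<in> carrier_mat n n" "A \<in> carrier_mat n n" "B \<in> carrier_mat n n"
    "T * S = 1\<^sub>m n"
  shows "S * A * T * (S * B * T) = S * (A * B) * T"
proof -
  have "S * A * T * (S * B * T) = S * A * ((T * S) * (B * T))"
    using assms(1-4) by (simp add: assoc_mult_mat[of _ n n _ n _ n])
  also have "\<dots> = S * (A * B) * T"
    unfolding assms(5) using assms(1-4) by (simp add: assoc_mult_mat[of _ n n _ n _ n])
  finally show ?thesis .
qed

lemma conjugate_cancel:
  fixes S :: "'a::semiring_1 mat"
  assumes "S \<in> carrier_mat n n" "T \<in> carrier_mat n n" "A \<in> carrier_mat n n" "T * S = 1\<^sub>m n"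
  shows "T * (S * A * T) * S = A"
proof -
  have "T * (S * A * T) * S = (T * S) * A * (T * S)"
    using assms(1-3) by (simp add: assoc_mult_mat[of _ n n _ n _ n])
  thus ?thesis using assms by simp
qed

lemma GL_mat_conjugate:
  fixes S :: "'a::semiring_1 mat"
  assumes S: "S \<in> carrier_mat n n" "T \<in> carrier_mat n n" "S * T = 1\<^sub>m n" "T * S = 1\<^sub>m n"
    and A: "A \<in> GL_mat n"
  shows "S * A * T \<in> GL_mat n"
proof -
  obtain B where B: "B \<in> carrier_mat n n" "A * B = 1\<^sub>m n" "B * A = 1\<^sub>m n" and Ac: "A \<in> carrier_mat n n"
    using A by (auto simp: GL_mat_iff)
  have "S * A * T * (S * B * T) = 1\<^sub>m n" "S * B * T * (S * A * T) = 1\<^sub>m n"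
    using S B Ac conjugate_mult[OF S(1,2) _ _ S(4)] by simp_all
  thus ?thesis using S B Ac by (auto simp: GL_mat_iff intro!: bexI[of _ "S * B * T"])
qed

lemma commuting_tuples_conjugate:
  fixes S :: "'a::semiring_1 mat"
  assumes S: "S \<in> carrier_mat n n" "T \<in> carrier_mat n n" "S * T = 1\<^sub>m n" "T * S = 1\<^sub>m n"
    and As: "As \<in> commuting_tuples l n"
  shows "map (\<lambda>A. S * A * T) As \<in> commuting_tuples l n"
  using commuting_tuplesD[OF As] S
  by (auto simp: commuting_tuples_def conjugate_mult intro!: GL_mat_conjugate)

lemma scalar_block_carrier [simp]: "scalar_block x \<in> carrier_mat 1 1" "scalar_block x \<in> carrier_mat (Suc 0) (Suc 0)"
  by (simp_all add: scalar_block_def)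

lemma complex_block_carrier [simp]: "complex_block z \<in> carrier_mat 2 2"
  by (simp add: complex_block_def)

lemma scalar_block_mult: "scalar_block x * scalar_block y = scalar_block (x * y :: 'a::comm_semiring_1)"
  by (intro eq_matI) (auto simp: scalar_block_def scalar_prod_def)

lemma complex_block_mult: "complex_block z * complex_block w = complex_block (z * w)"
proof -
  have two: "{0..<2::nat} = {0, 1}" by auto
  show ?thesis
    by (intro eq_matI) (auto simp: complex_block_def scalar_prod_def two less_2_cases_iff)
qed

lemma scalar_block_1: "scalar_block (1 :: 'a::semiring_1) = 1\<^sub>m 1"
  by (intro eq_matI) (auto simp: scalar_block_def)

lemma complex_block_1: "complex_block 1 = 1\<^sub>m 2"
  by (intro eq_matI) (auto simp: complex_block_def)

lemma complex_block_0: "complex_block 0 = 0\<^sub>m 2 2"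
  by (intro eq_matI) (auto simp: complex_block_def)

lemma zero_not_in_GL_mat: "n \<ge> 1 \<Longrightarrow> (0\<^sub>m n n :: 'a::semiring_1 mat) \<notin> GL_mat n"
proof
  assume n: "n \<ge> 1" and "(0\<^sub>m n n :: 'a mat) \<in> GL_mat n"
  then obtain B :: "'a mat" where "B \<in> carrier_mat n n" "0\<^sub>m n n * B = 1\<^sub>m n" by (auto simp: GL_mat_iff)
  hence "(0\<^sub>m n n :: 'a mat) $$ (0, 0) = 1\<^sub>m n $$ (0, 0)" using left_mult_zero_mat by metis
  thus False using n by simp
qed

lemma scalar_block_GL_iff: "scalar_block (x :: 'a::field) \<in> GL_mat 1 \<longleftrightarrow> x \<noteq> 0"
proof
  assume "x \<noteq> 0"
  thus "scalar_block x \<in> GL_mat 1"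
    using scalar_block_1[where 'a = 'a]
    by (auto simp: GL_mat_iff scalar_block_mult intro!: bexI[of _ "scalar_block (inverse x)"])
next
  have "scalar_block (0 :: 'a) = 0\<^sub>m 1 1" by (intro eq_matI) (auto simp: scalar_block_def)
  thus "scalar_block x \<in> GL_mat 1 \<Longrightarrow> x \<noteq> 0" using zero_not_in_GL_mat[of 1] by auto
qed

lemma complex_block_GL_iff: "complex_block z \<in> GL_mat 2 \<longleftrightarrow> z \<noteq> 0"
proof
  assume "z \<noteq> 0"
  thus "complex_block z \<in> GL_mat 2"
    by (auto simp: GL_mat_iff complex_block_mult complex_block_1[symmetric]
        intro!: bexI[of _ "complex_block (inverse z)"])
next
  show "complex_block z \<in> GL_mat 2 \<Longrightarrow> z \<noteq> 0"
    using zero_not_in_GL_mat[of 2, where 'a = real] by (auto simp: complex_block_0)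
qed

lemma scalar_tuple_iff:
  "map scalar_block xs \<in> commuting_tuples l 1 \<longleftrightarrow> length xs = l \<and> 0 \<notin> set (xs :: 'a::field list)"
  by (auto simp: commuting_tuples_def scalar_block_GL_iff[unfolded One_nat_def] scalar_block_mult mult.commute)

lemma complex_tuple_iff:
  "map complex_block zs \<in> commuting_tuples l 2 \<longleftrightarrow> length zs = l \<and> 0 \<notin> set zs"
  by (auto simp: commuting_tuples_def complex_block_GL_iff complex_block_mult mult.commute)

lemma nth_block_extension:
  "i < l \<Longrightarrow> block_extension l Ms Rs Cs ! i =
     four_block_mat (Ms ! i) (Rs ! i) (0\<^sub>m (dim_row (Cs ! i)) (dim_col (Ms ! i))) (Cs ! i)"
  by (simp add: block_extension_def)

lemma length_block_extension [simp]: "length (block_extension l Ms Rs Cs) = l"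
  by (simp add: block_extension_def)

lemma commuting_tuples_iff_nth:
  "As \<in> commuting_tuples l n \<longleftrightarrow> length As = l \<and> (\<forall>i<l. As ! i \<in> GL_mat n) \<and>
     (\<forall>i<l. \<forall>j<l. As ! i * As ! j = As ! j * As ! i)"
  unfolding commuting_tuples_def all_set_conv_all_nth subset_code(1) by auto

text \<open>Passing to a diagonal block of block triangular matrices is multiplicative, and the
  determinant is the product of those of the blocks; so commutation and invertibility descend.\<close>

lemma block_extension_blocks:
  fixes Ms Rs Cs :: "'a::field mat list"
  assumes X: "block_extension l Ms Rs Cs \<in> commuting_tuples l (m + k)"
    and M: "\<And>i. i < l \<Longrightarrow> Ms ! i \<in> carrier_mat m m" and R: "\<And>i. i < l \<Longrightarrow> Rs ! i \<in> carrier_mat m k"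
    and C: "\<And>i. i < l \<Longrightarrow> Cs ! i \<in> carrier_mat k k" and len: "length Ms = l" "length Cs = l"
  shows "Ms \<in> commuting_tuples l m" "Cs \<in> commuting_tuples l k"
proof -
  have nth: "block_extension l Ms Rs Cs ! i = four_block_mat (Ms ! i) (Rs ! i) (0\<^sub>m k m) (Cs ! i)"
    if "i < l" for i using that M[OF that] C[OF that] by (simp add: nth_block_extension)
  have "Ms ! i \<in> GL_mat m \<and> Cs ! i \<in> GL_mat k" if i: "i < l" for i
  proof -
    have "block_extension l Ms Rs Cs ! i \<in> GL_mat (m + k)" using X i by (simp add: commuting_tuples_iff_nth)
    hence "det (Ms ! i) * det (Cs ! i) \<noteq> 0"
      using nth[OF i] det_four_block_mat_lower_left_zero[OF M[OF i] R[OF i] refl C[OF i]]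
      by (simp add: GL_mat_iff_det)
    thus ?thesis using M[OF i] C[OF i] by (simp add: GL_mat_iff_det)
  qed
  moreover have "Ms ! i * Ms ! j = Ms ! j * Ms ! i \<and> Cs ! i * Cs ! j = Cs ! j * Cs ! i"
    if i: "i < l" and j: "j < l" for i j
  proof -
    have "four_block_mat (Ms ! i * Ms ! j) (Ms ! i * Rs ! j + Rs ! i * Cs ! j) (0\<^sub>m k m) (Cs ! i * Cs ! j) =
      four_block_mat (Ms ! j * Ms ! i) (Ms ! j * Rs ! i + Rs ! j * Cs ! i) (0\<^sub>m k m) (Cs ! j * Cs ! i)"
      using X i j by (simp add: commuting_tuples_iff_nth nth
          mult_block_upper_triangular[OF M[OF i] R[OF i] C[OF i] M[OF j] R[OF j] C[OF j], symmetric]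
          mult_block_upper_triangular[OF M[OF j] R[OF j] C[OF j] M[OF i] R[OF i] C[OF i], symmetric])
    from four_block_mat_inject[OF _ _ _ _ _ _ this, of m k] show ?thesis
      using M[OF i] R[OF i] C[OF i] M[OF j] R[OF j] C[OF j] by simp
  qed
  ultimately show "Ms \<in> commuting_tuples l m" "Cs \<in> commuting_tuples l k"
    using len by (simp_all add: commuting_tuples_iff_nth)
qed

text \<open>Over the reals a commuting family has an invariant subspace of dimension one or two on which it
  acts by real or by complex numbers. Completing a basis of it to a basis of the whole space makes the family block
  triangular, with a smaller commuting family in the second diagonal block.\<close>

theorem commuting_tuple_induct [consumes 2, case_names scalar complex similar extension]:
  fixes P :: "nat \<Rightarrow> real mat list \<Rightarrow> bool"
  assumes "As \<in> commuting_tuples l n" "n \<ge> 1"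
    and scalar: "\<And>xs. length xs = l \<Longrightarrow> 0 \<notin> set xs \<Longrightarrow> P 1 (map scalar_block xs)"
    and complex: "\<And>zs. length zs = l \<Longrightarrow> 0 \<notin> set zs \<Longrightarrow> P 2 (map complex_block zs)"
    and similar: "\<And>n As S T. n \<ge> 1 \<Longrightarrow> As \<in> commuting_tuples l n \<Longrightarrow> S \<in> carrier_mat n n \<Longrightarrow>
      T \<in> carrier_mat n n \<Longrightarrow> S * T = 1\<^sub>m n \<Longrightarrow> T * S = 1\<^sub>m n \<Longrightarrow> P n As \<Longrightarrow>
      P n (map (\<lambda>A. S * A * T) As)"
    and extension: "\<And>m k Ms Rs Cs. m \<ge> 1 \<Longrightarrow> k \<ge> 1 \<Longrightarrow> Ms \<in> commuting_tuples l m \<Longrightarrow>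
      Cs \<in> commuting_tuples l k \<Longrightarrow> length Rs = l \<Longrightarrow> (\<And>i. i < l \<Longrightarrow> Rs ! i \<in> carrier_mat m k) \<Longrightarrow>
      block_extension l Ms Rs Cs \<in> commuting_tuples l (m + k) \<Longrightarrow> P m Ms \<Longrightarrow> P k Cs \<Longrightarrow>
      P (m + k) (block_extension l Ms Rs Cs)"
  shows "P n As"
  using assms(1,2)
proof (induction n arbitrary: As rule: less_induct)
  case (less n)
  note As = commuting_tuplesD[OF less.prems(1)]
  obtain m W I Ms where W: "W \<in> carrier_mat n m" and I: "I \<subseteq> {..<n}" "card I = m"
    and inj: "\<And>u. u \<in> carrier_vec m \<Longrightarrow> (\<forall>r\<in>I. (W *\<^sub>v u) $ r = 0) \<Longrightarrow> u = 0\<^sub>v m"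
    and AW: "\<And>i. i < l \<Longrightarrow> As ! i * W = W * (Ms ! i)"
    and Ms: "(m = 1 \<and> (\<exists>xs. length xs = l \<and> Ms = map scalar_block xs)) \<or>
       (m = 2 \<and> (\<exists>zs. length zs = l \<and> Ms = map complex_block zs))"
  proof -
    have "set As \<subseteq> carrier_mat n n" using As(3) by blast
    from ex_invariant_block[OF this As(4) less.prems(2), unfolded As(1)] that
    show thesis by blast
  qed
  have mn: "1 \<le> m" "m \<le> n" using Ms I card_mono[of "{..<n}" I] by auto
  obtain S where "S \<in> GL_mat n" and SW: "\<And>r c. r < n \<Longrightarrow> c < m \<Longrightarrow> S $$ (r, c) = W $$ (r, c)"
    using ex_basis_extension[OF W I inj] by blast
  then obtain T where S: "S \<in> carrier_mat n n" and T: "T \<in> carrier_mat n n"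
    and ST: "S * T = 1\<^sub>m n" "T * S = 1\<^sub>m n" by (auto simp: GL_mat_iff)
  define k where "k = n - m"
  have n: "n = m + k" using mn by (simp add: k_def)
  have M: "Ms ! i \<in> carrier_mat m m" "length Ms = l" if "i < l" for i
    using Ms that by auto
  have lenM: "length Ms = l" using Ms by auto
  define Rs where "Rs = map (\<lambda>A. mat m k (\<lambda>(r, c). (T * A * S) $$ (r, c + m))) As"
  define Cs where "Cs = map (\<lambda>A. mat k k (\<lambda>(r, c). (T * A * S) $$ (r + m, c + m))) As"
  have As_nth: "As ! i \<in> carrier_mat n n" if "i < l" for i
    using commuting_tuples_nthD[OF less.prems(1) that] .
  \<comment> \<open>The first \<open>m\<close> columns of \<open>T A S\<close> are \<open>T A W = T W M\<close>, and \<open>T W\<close> consists of the first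
    \<open>m\<close> unit vectors.\<close>
  have block: "T * As ! i * S =
      four_block_mat (Ms ! i) (Rs ! i) (0\<^sub>m (dim_row (Cs ! i)) (dim_col (Ms ! i))) (Cs ! i)"
    if i: "i < l" for i
  proof (rule eq_matI)
    fix r c assume "r < dim_row (four_block_mat (Ms ! i) (Rs ! i)
        (0\<^sub>m (dim_row (Cs ! i)) (dim_col (Ms ! i))) (Cs ! i))"
      "c < dim_col (four_block_mat (Ms ! i) (Rs ! i)
        (0\<^sub>m (dim_row (Cs ! i)) (dim_col (Ms ! i))) (Cs ! i))"
    hence r: "r < n" and c: "c < n" using i M(1)[OF i] As(1) by (auto simp: Rs_def Cs_def n)
    show "(T * As ! i * S) $$ (r, c) = four_block_mat (Ms ! i) (Rs ! i)
        (0\<^sub>m (dim_row (Cs ! i)) (dim_col (Ms ! i))) (Cs ! i) $$ (r, c)"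
    proof (cases "c < m")
      case True
      have colS: "col S c = col W c"
        using S W True c by (intro eq_vecI) (auto simp: SW)
      have TW: "(T * W) $$ (r, d) = (if r = d then 1 else 0)" if d: "d < m" for d
      proof -
        have "col S d = col W d" using S W d mn by (intro eq_vecI) (auto simp: SW)
        hence "(T * W) $$ (r, d) = (T * S) $$ (r, d)" using r d mn T W S by simp
        thus ?thesis using ST(2) r d mn by simp
      qed
      have "T * As ! i * S = T * (As ! i * S)" using T S As_nth[OF i] by (simp add: assoc_mult_mat)
      hence "(T * As ! i * S) $$ (r, c) = row T r \<bullet> col (As ! i * S) c"
        using r c T S As_nth[OF i] by simp
      also have "col (As ! i * S) c = col (As ! i * W) c"
        using S W True c As_nth[OF i] colS by (intro eq_vecI) auto
      also have "row T r \<bullet> col (As ! i * W) c = (T * (W * (Ms ! i))) $$ (r, c)"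
        using r True T W M(1)[OF i] by (simp add: AW[OF i])
      also have "\<dots> = (T * W * Ms ! i) $$ (r, c)"
        using T W M(1)[OF i] by (simp add: assoc_mult_mat)
      also have "\<dots> = (\<Sum>d<m. (if r = d then 1 else 0) * Ms ! i $$ (d, c))"
        using r True T W M(1)[OF i] TW
        by (subst index_mult_mat) (auto simp: scalar_prod_def atLeast0LessThan intro!: sum.cong)
      also have "\<dots> = (\<Sum>d<m. if d = r then Ms ! i $$ (d, c) else 0)"
        by (intro sum.cong) auto
      also have "\<dots> = (if r < m then Ms ! i $$ (r, c) else 0)" by simp
      finally show ?thesis
        using True r c M(1)[OF i] i As(1) by (auto simp: n Cs_def)
    next
      case False
      thus ?thesis using r c M(1)[OF i] i As(1) by (auto simp: n Rs_def Cs_def)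
    qed
  qed (use T S As_nth[OF i] M(1)[OF i] i As(1) in \<open>auto simp: n Cs_def\<close>)
  have X: "map (\<lambda>A. T * A * S) As = block_extension l Ms Rs Cs"
    using As(1) block by (intro nth_equalityI) (auto simp: nth_block_extension)
  have Xct: "block_extension l Ms Rs Cs \<in> commuting_tuples l (m + k)"
    using commuting_tuples_conjugate[OF T S ST(2,1) less.prems(1)] by (simp add: X n)
  have Rc: "Rs ! i \<in> carrier_mat m k" and Cc: "Cs ! i \<in> carrier_mat k k" if "i < l" for i
    using that As(1) by (auto simp: Rs_def Cs_def)
  have lens: "length Rs = l" "length Cs = l" using As(1) by (simp_all add: Rs_def Cs_def)
  note blocks = block_extension_blocks[OF Xct M(1) Rc Cc lenM lens(2)]
  have PM: "P m Ms"
    using Ms blocks(1) scalar complex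
    by (auto simp: scalar_tuple_iff[unfolded One_nat_def] complex_tuple_iff)
  have "P (m + k) (block_extension l Ms Rs Cs)"
  proof (cases "k = 0")
    case True
    have "block_extension l Ms Rs Cs = Ms"
    proof (rule nth_equalityI)
      fix i assume "i < length (block_extension l Ms Rs Cs)"
      hence i: "i < l" by simp
      show "block_extension l Ms Rs Cs ! i = Ms ! i"
        using M(1)[OF i] Rc[OF i] Cc[OF i] True
        by (intro eq_matI) (auto simp: nth_block_extension[OF i])
    qed (simp add: lenM)
    thus ?thesis using PM True by simp
  next
    case False
    have "P k Cs" using less.IH[OF _ blocks(2)] False mn n by auto
    thus ?thesis using extension[OF mn(1) _ blocks lens(1) Rc Xct PM] False by simp
  qed
  from similar[OF _ _ S T ST this[folded n]] have "P n (map (\<lambda>A. S * A * T) (block_extension l Ms Rs Cs))"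
    using Xct less.prems(2) by (simp add: n)
  also have "map (\<lambda>A. S * A * T) (block_extension l Ms Rs Cs) = As"
    unfolding X[symmetric] using As conjugate_cancel[OF T S _ ST(1)] by (auto intro!: map_idI)
  finally show ?case .
qed

section \<open>The joint spectrum\<close>

definition pencil :: "nat \<Rightarrow> (nat \<Rightarrow> real) \<Rightarrow> real \<Rightarrow> real mat list \<Rightarrow> real mat" where
  "pencil n x y As = mat n n (\<lambda>(r, c). (if r = c then y else 0) - (\<Sum>i<length As. x i * (As ! i) $$ (r, c)))"

text \<open>The list of joint eigenvalues with multiplicity, encoded by the linear factors of the
  determinant of the pencil. The parameters are real, so that only real matrices occur.\<close>

definition joint_spectrum :: "nat \<Rightarrow> real mat list \<Rightarrow> complex list list \<Rightarrow> bool" where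
  "joint_spectrum n As L \<longleftrightarrow> length L = n \<and> (\<forall>\<nu>\<in>set L. length \<nu> = length As) \<and>
     (\<forall>x y. complex_of_real (det (pencil n x y As)) =
        (\<Prod>\<nu>\<leftarrow>L. of_real y - (\<Sum>i<length As. of_real (x i) * \<nu> ! i)))"

lemma pencil_carrier [simp]: "pencil n x y As \<in> carrier_mat n n"
  by (simp add: pencil_def)

lemma joint_spectrumD:
  assumes "joint_spectrum n As L"
  shows "length L = n" "\<And>\<nu>. \<nu> \<in> set L \<Longrightarrow> length \<nu> = length As"
    "\<And>x y. complex_of_real (det (pencil n x y As)) =
        (\<Prod>\<nu>\<leftarrow>L. of_real y - (\<Sum>i<length As. of_real (x i) * \<nu> ! i))"
  using assms by (auto simp: joint_spectrum_def)

lemma joint_spectrum_scalar: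
  "joint_spectrum 1 (map scalar_block xs) [map of_real xs]"
proof -
  have "det (pencil 1 x y (map scalar_block xs)) = y - (\<Sum>i<length xs. x i * xs ! i)" for x y
    by (subst det_single) (auto simp: pencil_def scalar_block_def)
  thus ?thesis by (simp add: joint_spectrum_def)
qed

lemma det_complex_block: "complex_of_real (det (complex_block w)) = w * cnj w"
proof -
  have two: "{..<2::nat} = {0, 1}" by auto
  have single: "det A = A $$ (0, 0)" if "dim_row A = 1" "dim_col A = 1" for A :: "real mat"
    using that by (intro det_single) auto
  have "det (complex_block w) = (Re w)\<^sup>2 + (Im w)\<^sup>2"
    by (subst laplace_expansion_column[OF complex_block_carrier, of 0])
      (simp_all add: two cofactor_def single mat_delete_def complex_block_def power2_eq_square)
  thus ?thesis by (simp add: complex_mult_cnj)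
qed

lemma joint_spectrum_complex:
  "joint_spectrum 2 (map complex_block zs) [zs, map cnj zs]"
proof -
  have "pencil 2 x y (map complex_block zs) =
      complex_block (of_real y - (\<Sum>i<length zs. of_real (x i) * zs ! i))" for x y
    by (intro eq_matI) (auto simp: pencil_def complex_block_def sum_negf)
  hence "complex_of_real (det (pencil 2 x y (map complex_block zs))) =
      (of_real y - (\<Sum>i<length zs. of_real (x i) * zs ! i)) *
      (of_real y - (\<Sum>i<length zs. of_real (x i) * cnj (zs ! i)))" for x y
    by (simp add: det_complex_block)
  thus ?thesis by (simp add: joint_spectrum_def)
qed

lemma pencil_conjugate:
  assumes S: "S \<in> carrier_mat n n" and T: "T \<in> carrier_mat n n" and ST: "S * T = 1\<^sub>m n"
    and As: "set As \<subseteq> carrier_mat n n"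
  shows "pencil n x y (map (\<lambda>A. S * A * T) As) = S * pencil n x y As * T"
  using As
proof (induction As rule: rev_induct)
  case Nil
  have "pencil n x y [] = y \<cdot>\<^sub>m 1\<^sub>m n" by (intro eq_matI) (auto simp: pencil_def)
  thus ?case using S T ST by (simp add: mult_smult_distrib[of _ n n _ n] mult_smult_assoc_mat[of _ n n _ n])
next
  case (snoc A As)
  have A: "A \<in> carrier_mat n n" using snoc by simp
  have step: "pencil n x y (Bs @ [B]) = pencil n x y Bs - x (length Bs) \<cdot>\<^sub>m B"
    if "B \<in> carrier_mat n n" for Bs B
    using that by (intro eq_matI) (auto simp: pencil_def nth_append intro!: sum.cong)
  have "pencil n x y (map (\<lambda>A. S * A * T) (As @ [A])) =
      S * pencil n x y As * T - x (length As) \<cdot>\<^sub>m (S * A * T)"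
    using snoc step[of "S * A * T" "map (\<lambda>A. S * A * T) As"] S T A
    by (simp add: mult_carrier_mat[of _ n n _ n])
  also have "\<dots> = S * (pencil n x y As - x (length As) \<cdot>\<^sub>m A) * T"
    using S T A by (simp add: mult_minus_distrib_mat[of _ n n _ n] minus_mult_distrib_mat[of _ n n _ _ n]
        mult_smult_distrib[of _ n n _ n] mult_smult_assoc_mat[of _ n n _ n])
  also have "\<dots> = S * pencil n x y (As @ [A]) * T" using step[OF A] by simp
  finally show ?case .
qed

lemma joint_spectrum_conjugate:
  assumes S: "S \<in> carrier_mat n n" "T \<in> carrier_mat n n" "S * T = 1\<^sub>m n"
    and As: "set As \<subseteq> carrier_mat n n" "joint_spectrum n As L"
  shows "joint_spectrum n (map (\<lambda>A. S * A * T) As) L"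
proof -
  have "det S * det T = 1" using det_mult[OF S(1,2)] S(3) by simp
  hence "det (S * M * T) = det M" if "M \<in> carrier_mat n n" for M
    using that S by (simp add: det_mult[of _ n])
  thus ?thesis using As(2) pencil_conjugate[OF S As(1)] by (simp add: joint_spectrum_def)
qed

lemma joint_spectrum_extension:
  assumes Ms: "\<And>i. i < l \<Longrightarrow> Ms ! i \<in> carrier_mat m m" "length Ms = l" "joint_spectrum m Ms L"
    and Rs: "\<And>i. i < l \<Longrightarrow> Rs ! i \<in> carrier_mat m k"
    and Cs: "\<And>i. i < l \<Longrightarrow> Cs ! i \<in> carrier_mat k k" "length Cs = l" "joint_spectrum k Cs L'"
  shows "joint_spectrum (m + k) (block_extension l Ms Rs Cs) (L @ L')"
proof -
  have "det (pencil (m + k) x y (block_extension l Ms Rs Cs)) = det (pencil m x y Ms) * det (pencil k x y Cs)"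
    for x y
  proof -
    define R where "R = mat m k (\<lambda>(r, c). - (\<Sum>i<l. x i * (Rs ! i) $$ (r, c)))"
    have dims: "dim_row (Ms ! i) = m" "dim_col (Ms ! i) = m" "dim_row (Rs ! i) = m" "dim_col (Rs ! i) = k"
       "dim_row (Cs ! i) = k" "dim_col (Cs ! i) = k" if "i < l" for i
      using Ms(1)[OF that] Rs[OF that] Cs(1)[OF that] by auto
    have "pencil (m + k) x y (block_extension l Ms Rs Cs) =
        four_block_mat (pencil m x y Ms) R (0\<^sub>m k m) (pencil k x y Cs)"
      by (intro eq_matI) (auto simp: pencil_def R_def nth_block_extension dims Ms(2) Cs(2) intro!: sum.cong)
    thus ?thesis
      using det_four_block_mat_lower_left_zero[of "pencil m x y Ms" m R k] by (simp add: R_def)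
  qed
  thus ?thesis using Ms(2,3) Cs(2,3) by (auto simp: joint_spectrum_def)
qed

lemma proots_linear_factors: "proots (\<Prod>a\<leftarrow>as. [:- a, 1:]) = mset (as :: 'a::idom list)"
proof (induction as)
  case (Cons a as)
  have "(\<Prod>a\<leftarrow>as. [:- a, 1:]) \<noteq> 0" by (auto simp: prod_list_zero_iff)
  thus ?case by (simp add: proots_mult Cons del: mult_pCons_left)
qed simp

text \<open>Specialising \<open>x = (1, s, s\<^sup>2, \<dots>)\<close> for a suitable real \<open>s\<close> separates the finitely many tuples
  involved, and then both lists are recovered from the roots of one and the same polynomial in \<open>y\<close>.\<close>

lemma mset_eq_of_linear_form_products:
  fixes L M :: "complex list list"
  assumes L: "\<And>\<nu>. \<nu> \<in> set L \<Longrightarrow> length \<nu> = l" and M: "\<And>\<nu>. \<nu> \<in> set M \<Longrightarrow> length \<nu> = l"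
    and eq: "\<And>(x :: nat \<Rightarrow> real) (y :: real). (\<Prod>\<nu>\<leftarrow>L. of_real y - (\<Sum>i<l. of_real (x i) * \<nu> ! i)) =
      (\<Prod>\<nu>\<leftarrow>M. of_real y - (\<Sum>i<l. of_real (x i) * \<nu> ! i))"
  shows "mset L = mset M"
proof -
  define S where "S = set L \<union> set M"
  have len: "length \<nu> = l" if "\<nu> \<in> S" for \<nu> using that L M by (auto simp: S_def)
  define \<phi> where "\<phi> s \<nu> = (\<Sum>i<l. complex_of_real (s ^ i) * \<nu> ! i)" for s and \<nu> :: "complex list"
  \<comment> \<open>Two different tuples are separated by the moment curve except at finitely many parameters.\<close>
  have "finite {s. \<phi> s \<nu> = \<phi> s \<mu>}" if sep: "\<nu> \<in> S" "\<mu> \<in> S" "\<nu> \<noteq> \<mu>" for \<nu> \<mu>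
  proof -
    define p where "p = (\<Sum>i<l. monom (\<nu> ! i - \<mu> ! i) i)"
    obtain j where j: "j < l" "\<nu> ! j \<noteq> \<mu> ! j"
      using sep(3) len[OF sep(1)] len[OF sep(2)] nth_equalityI[of \<nu> \<mu>] by metis
    have "coeff p j = \<nu> ! j - \<mu> ! j" using j by (simp add: p_def coeff_sum coeff_monom)
    hence "p \<noteq> 0" using j by auto
    hence "finite {z. poly p z = 0}" by (rule poly_roots_finite)
    hence "finite (complex_of_real -` {z. poly p z = 0})"
      by (rule finite_vimageI) (simp add: inj_def)
    moreover have "poly p (of_real s) = \<phi> s \<nu> - \<phi> s \<mu>" for s
      by (simp add: p_def \<phi>_def poly_sum poly_monom sum_subtractf algebra_simps)
    ultimately show ?thesis by (simp add: vimage_def)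
  qed
  hence "finite (\<Union>\<nu>\<in>S. \<Union>\<mu>\<in>S - {\<nu>}. {s. \<phi> s \<nu> = \<phi> s \<mu>})"
    by (intro finite_UN_I) (auto simp: S_def)
  then obtain s where s: "s \<notin> (\<Union>\<nu>\<in>S. \<Union>\<mu>\<in>S - {\<nu>}. {s. \<phi> s \<nu> = \<phi> s \<mu>})"
    using ex_new_if_finite[OF infinite_UNIV_char_0] by blast
  hence inj: "inj_on (\<phi> s) S" by (auto simp: inj_on_def)
  define q where "q L = (\<Prod>a\<leftarrow>map (\<phi> s) L. [:- a, 1:])" for L
  have poly_q: "poly (q L) (of_real y) = (\<Prod>\<nu>\<leftarrow>L. of_real y - (\<Sum>i<l. of_real (s ^ i) * \<nu> ! i))" for L y
    by (induction L) (simp_all add: q_def \<phi>_def left_diff_distrib)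
  have "q L - q M = 0"
  proof (rule ccontr)
    assume "q L - q M \<noteq> 0"
    hence "finite {z. poly (q L - q M) z = 0}" by (rule poly_roots_finite)
    moreover have "range complex_of_real \<subseteq> {z. poly (q L - q M) z = 0}"
      using eq[of _ "\<lambda>i. s ^ i"] by (auto simp: poly_q)
    ultimately have "finite (range complex_of_real)" by (rule rev_finite_subset)
    thus False using finite_imageD[of complex_of_real UNIV] by (simp add: inj_def infinite_UNIV_char_0)
  qed
  hence "proots (q L) = proots (q M)" by simp
  hence eq_img: "image_mset (\<phi> s) (mset L) = image_mset (\<phi> s) (mset M)"
    by (simp only: q_def proots_linear_factors mset_map)
  show ?thesis
    using image_mset_eq_image_mset_plusD[of "\<phi> s" "mset L" "mset M" "{#}"] eq_img inj
    by (auto simp: S_def)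
qed

lemma joint_spectrum_unique:
  assumes "joint_spectrum n As L" "joint_spectrum n As M"
  shows "mset L = mset M"
  using assms by (intro mset_eq_of_linear_form_products[of L "length As" M])
    (auto simp: joint_spectrum_def)

text \<open>The determinant of the real pencil is real, so conjugating the list gives another joint spectrum,
  and joint spectra are unique.\<close>

lemma joint_spectrum_cnj:
  assumes "joint_spectrum n As L"
  shows "mset (map (map cnj) L) = mset L"
proof (rule joint_spectrum_unique[OF _ assms])
  have "complex_of_real (det (pencil n x y As)) =
      (\<Prod>\<nu>\<leftarrow>map (map cnj) L. of_real y - (\<Sum>i<length As. of_real (x i) * \<nu> ! i))" for x y
  proof -
    have "complex_of_real (det (pencil n x y As)) =
        cnj (\<Prod>\<nu>\<leftarrow>L. of_real y - (\<Sum>i<length As. of_real (x i) * \<nu> ! i))"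
      using assms unfolding joint_spectrum_def by (metis complex_cnj_complex_of_real)
    also have "\<dots> = (\<Prod>\<nu>\<leftarrow>L. of_real y - (\<Sum>i<length As. of_real (x i) * cnj (\<nu> ! i)))"
      by (induction L) simp_all
    also have "\<dots> = (\<Prod>\<nu>\<leftarrow>map (map cnj) L. of_real y - (\<Sum>i<length As. of_real (x i) * \<nu> ! i))"
      using assms by (auto simp: joint_spectrum_def intro!: arg_cong[of _ _ prod_list] sum.cong)
    finally show ?thesis .
  qed
  thus "joint_spectrum n As (map (map cnj) L)" using assms by (auto simp: joint_spectrum_def)
qed

text \<open>A linear combination of the selected matrices is a linear combination of all of them: the
  coefficients of repeated indices add up.\<close>

lemma joint_spectrum_select:
  assumes L: "joint_spectrum n As L" and ks: "set ks \<subseteq> {..<length As}"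
  shows "joint_spectrum n (map ((!) As) ks) (map (\<lambda>\<nu>. map ((!) \<nu>) ks) L)"
proof -
  have sum_select: "(\<Sum>j<length ks. of_real (x j) * g (ks ! j)) =
      (\<Sum>i<length As. of_real (\<Sum>j | j < length ks \<and> ks ! j = i. x j) * g i)"
    for x :: "nat \<Rightarrow> real" and g :: "nat \<Rightarrow> 'b::{real_algebra_1, comm_ring_1}"
  proof -
    have "(\<Sum>j<length ks. of_real (x j) * g (ks ! j)) =
        (\<Sum>i<length As. \<Sum>j | j \<in> {..<length ks} \<and> ks ! j = i. of_real (x j) * g (ks ! j))"
      using ks by (intro sum.group[symmetric]) (auto simp: subset_iff)
    also have "\<dots> = (\<Sum>i<length As. of_real (\<Sum>j | j < length ks \<and> ks ! j = i. x j) * g i)"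
      by (auto simp: sum_distrib_right intro!: sum.cong)
    finally show ?thesis .
  qed
  have "complex_of_real (det (pencil n x y (map ((!) As) ks))) =
      (\<Prod>\<nu>\<leftarrow>L. of_real y - (\<Sum>j<length ks. of_real (x j) * \<nu> ! (ks ! j)))" for x y
  proof -
    define x' where "x' i = (\<Sum>j | j < length ks \<and> ks ! j = i. x j)" for i
    have "pencil n x y (map ((!) As) ks) = pencil n x' y As"
      using sum_select[of x "\<lambda>i. (As ! i) $$ (_, _)"]
      by (intro eq_matI) (auto simp: pencil_def x'_def)
    thus ?thesis using joint_spectrumD(3)[OF L, of x' y] by (simp add: sum_select x'_def)
  qed
  thus ?thesis using joint_spectrumD(1,2)[OF L] by (auto simp: joint_spectrum_def o_def)
qed

lemma joint_spectrum_nonzero: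
  assumes L: "joint_spectrum n As L" and As: "As \<in> commuting_tuples l n" and \<nu>: "\<nu> \<in> set L" and i: "i < l"
  shows "\<nu> ! i \<noteq> 0"
proof
  assume 0: "\<nu> ! i = 0"
  \<comment> \<open>With these parameters and \<open>y = 0\<close> the pencil is \<open>A\<^sub>i\<close> itself.\<close>
  define x where "x = (\<lambda>k. if k = i then -1 else 0 :: real)"
  have len: "length As = l" using As by (rule commuting_tuplesD)
  have xsum: "(\<Sum>k<l. of_real (x k) * g k) = - g i" for g :: "nat \<Rightarrow> 'b::{real_algebra_1, comm_ring_1}"
  proof -
    have "(\<Sum>k<l. of_real (x k) * g k) = (\<Sum>k<l. if k = i then - g k else 0)"
      by (intro sum.cong) (auto simp: x_def)
    thus ?thesis using i by simp
  qed
  have "pencil n x 0 As = As ! i"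
    using commuting_tuples_nthD[OF As i] xsum[of "\<lambda>k. (As ! k) $$ (_, _)"]
    by (intro eq_matI) (auto simp: pencil_def len)
  moreover have "(\<Prod>\<nu>\<leftarrow>L. of_real 0 - (\<Sum>k<l. of_real (x k) * \<nu> ! k)) = 0"
    using \<nu> 0 by (force simp: prod_list_zero_iff xsum)
  ultimately have "det (As ! i) = 0" using joint_spectrumD(3)[OF L, of x 0]
    unfolding len by (metis of_real_eq_0_iff)
  moreover have "As ! i \<in> GL_mat n" using As i by (simp add: commuting_tuples_iff_nth)
  ultimately show False by (simp add: GL_mat_iff_det)
qed

lemma scalar_block_inject: "scalar_block x = scalar_block y \<longleftrightarrow> x = y"
proof
  assume "scalar_block x = scalar_block y"
  hence "scalar_block x $$ (0, 0) = scalar_block y $$ (0, 0)" by simp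
  thus "x = y" by (simp add: scalar_block_def)
qed simp

lemma complex_block_inject: "complex_block z = complex_block w \<longleftrightarrow> z = w"
proof
  assume eq: "complex_block z = complex_block w"
  have "complex_block z $$ (r, 0) = complex_block w $$ (r, 0)" for r using eq by simp
  from this[of 0] this[of 1] show "z = w" by (simp add: complex_block_def complex_eq_iff)
qed simp

text \<open>The second conjunct is what makes multilinearity accessible: a product \<open>A\<^sub>i A\<^sub>j\<close> is treated as one more entry of
  the tuple, and the corresponding entry of each joint eigenvalue is the product. It holds for the
  one- and two-dimensional blocks because these represent numbers, and passes to extensions because
  diagonal blocks multiply.\<close>

theorem ex_joint_spectrum:
  assumes "As \<in> commuting_tuples l n" "n \<ge> 1"
  shows "\<exists>L. joint_spectrum n As L \<and>
    (\<forall>i<l. \<forall>j<l. \<forall>k<l. As ! k = As ! i * As ! j \<longrightarrow> (\<forall>\<nu>\<in>set L. \<nu> ! k = \<nu> ! i * \<nu> ! j))"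
  using assms
proof (induction rule: commuting_tuple_induct)
  case (scalar xs)
  thus ?case using joint_spectrum_scalar[of xs]
    by (intro exI[of _ "[map of_real xs]"]) (simp add: scalar_block_mult scalar_block_inject)
next
  case (complex zs)
  thus ?case using joint_spectrum_complex[of zs]
    by (intro exI[of _ "[zs, map cnj zs]"]) (simp add: complex_block_mult complex_block_inject)
next
  case (similar n As S T)
  note ct = commuting_tuplesD[OF similar(2)]
  obtain L where L: "joint_spectrum n As L"
    "\<And>i j k. i < l \<Longrightarrow> j < l \<Longrightarrow> k < l \<Longrightarrow> As ! k = As ! i * As ! j \<Longrightarrow> \<forall>\<nu>\<in>set L. \<nu> ! k = \<nu> ! i * \<nu> ! j"
    using similar by blast
  have "As ! k = As ! i * As ! j"
    if "i < l" "j < l" "k < l" "S * As ! k * T = S * As ! i * T * (S * As ! j * T)" for i j k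
  proof -
    have car: "As ! i \<in> carrier_mat n n" "As ! j \<in> carrier_mat n n" "As ! k \<in> carrier_mat n n"
      using that commuting_tuples_nthD[OF similar(2)] by auto
    have "T * (S * As ! k * T) * S = T * (S * (As ! i * As ! j) * T) * S"
      using that(4) conjugate_mult[OF similar(3,4) car(1,2) similar(6)] by simp
    thus ?thesis using conjugate_cancel[OF similar(3,4) _ similar(6)] car by simp
  qed
  moreover have "joint_spectrum n (map (\<lambda>A. S * A * T) As) L"
    using joint_spectrum_conjugate[OF similar(3-5) _ L(1)] ct(3) by blast
  ultimately show ?case using L(2) ct(1) by (intro exI[of _ L]) auto
next
  case (extension m k Ms Rs Cs)
  note M = commuting_tuples_nthD[OF extension(3)] and C = commuting_tuples_nthD[OF extension(4)]
  note R = extension(6)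
  obtain L where L: "joint_spectrum m Ms L"
    "\<And>i j k. i < l \<Longrightarrow> j < l \<Longrightarrow> k < l \<Longrightarrow> Ms ! k = Ms ! i * Ms ! j \<Longrightarrow> \<forall>\<nu>\<in>set L. \<nu> ! k = \<nu> ! i * \<nu> ! j"
    using extension.IH(1) by blast
  obtain L' where L': "joint_spectrum k Cs L'"
    "\<And>i j k. i < l \<Longrightarrow> j < l \<Longrightarrow> k < l \<Longrightarrow> Cs ! k = Cs ! i * Cs ! j \<Longrightarrow> \<forall>\<nu>\<in>set L'. \<nu> ! k = \<nu> ! i * \<nu> ! j"
    using extension.IH(2) by blast
  have nth: "block_extension l Ms Rs Cs ! i = four_block_mat (Ms ! i) (Rs ! i) (0\<^sub>m k m) (Cs ! i)"
    if "i < l" for i using that M[OF that] C[OF that] by (simp add: nth_block_extension)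
  have "Ms ! p = Ms ! i * Ms ! j \<and> Cs ! p = Cs ! i * Cs ! j"
    if ijp: "i < l" "j < l" "p < l"
      and eq: "block_extension l Ms Rs Cs ! p = block_extension l Ms Rs Cs ! i * block_extension l Ms Rs Cs ! j"
    for i j p
  proof -
    have "four_block_mat (Ms ! p) (Rs ! p) (0\<^sub>m k m) (Cs ! p) =
      four_block_mat (Ms ! i * Ms ! j) (Ms ! i * Rs ! j + Rs ! i * Cs ! j) (0\<^sub>m k m) (Cs ! i * Cs ! j)"
      using eq ijp by (simp add: nth mult_block_upper_triangular[OF M R C M R C])
    from four_block_mat_inject[OF M mult_carrier_mat[OF M M] R
        add_carrier_mat[OF mult_carrier_mat[OF R C]] C mult_carrier_mat[OF C C] this]
    show ?thesis using ijp by simp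
  qed
  moreover have "joint_spectrum (m + k) (block_extension l Ms Rs Cs) (L @ L')"
    using extension(3,4) by (intro joint_spectrum_extension M R C L(1) L'(1) commuting_tuplesD(1))
  moreover have "\<nu> ! p = \<nu> ! i * \<nu> ! j"
    if "i < l" "j < l" "p < l" "Ms ! p = Ms ! i * Ms ! j \<and> Cs ! p = Cs ! i * Cs ! j" "\<nu> \<in> set (L @ L')"
    for i j p \<nu>
    using that L(2)[OF that(1-3)] L'(2)[OF that(1-3)] by auto
  ultimately show ?case by blast
qed

section \<open>Parity of the all-negative joint spectrum\<close>

text \<open>Points that are moved by the involution cancel in pairs, because \<open>g\<close> takes the same sign on both.\<close>

lemma prod_mset_involution:
  fixes g :: "'a \<Rightarrow> real"
  assumes "image_mset \<iota> M = M" "\<And>a. a \<in># M \<Longrightarrow> \<iota> (\<iota> a) = a" "\<And>a. a \<in># M \<Longrightarrow> g (\<iota> a) = g a"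
    "\<And>a. a \<in># M \<Longrightarrow> (g a)\<^sup>2 = 1" "\<And>a. a \<in># M \<Longrightarrow> \<iota> a = a \<Longrightarrow> g a = 1"
  shows "prod_mset (image_mset g M) = 1"
  using assms
proof (induction "size M" arbitrary: M rule: less_induct)
  case less
  show ?case
  proof (cases "M = {#}")
    case False
    then obtain a where a: "a \<in># M" by auto
    then obtain N where M: "M = add_mset a N" by (metis insert_DiffM)
    show ?thesis
    proof (cases "\<iota> a = a")
      case True
      have "image_mset \<iota> N = N" using less.prems(1) True by (simp add: M)
      with less.hyps[of N] less.prems have "prod_mset (image_mset g N) = 1" by (simp add: M)
      thus ?thesis using less.prems(5)[OF a True] by (simp add: M)
    next
      case False
      have "\<iota> a \<in># image_mset \<iota> M" using a by simp
      hence "\<iota> a \<in># M" by (simp only: less.prems(1))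
      hence "\<iota> a \<in># add_mset a N" by (simp only: M)
      hence "\<iota> a \<in># N" using False by simp
      then obtain K where N: "N = add_mset (\<iota> a) K" by (metis insert_DiffM)
      have "\<iota> (\<iota> a) = a" using less.prems(2)[OF a] .
      hence "image_mset \<iota> K = K" using less.prems(1) by (simp add: M N)
      with less.hyps[of K] less.prems have "prod_mset (image_mset g K) = 1" by (simp add: M N)
      moreover have "g a * g (\<iota> a) = 1" using less.prems(3,4)[OF a] by (simp add: power2_eq_square)
      ultimately show ?thesis by (simp add: M N mult.assoc[symmetric])
    qed
  qed simp
qed

definition all_negative :: "complex list \<Rightarrow> bool" where
  "all_negative \<nu> \<longleftrightarrow> (\<forall>z\<in>set \<nu>. Im z = 0 \<and> Re z < 0)"

definition neg_sign :: "complex list \<Rightarrow> real" where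
  "neg_sign \<nu> = (if all_negative \<nu> then -1 else 1)"

lemma map_cnj_fixed_iff: "map cnj \<nu> = \<nu> \<longleftrightarrow> (\<forall>z\<in>set \<nu>. Im z = 0)"
  by (induction \<nu>) (auto simp: complex_eq_iff)

lemma neg_sign_cnj: "neg_sign (map cnj \<nu>) = neg_sign \<nu>"
  by (auto simp: neg_sign_def all_negative_def)

text \<open>The principle behind all properties of the parity: nonreal joint eigenvalues occur in conjugate
  pairs, so a conjugation-invariant sign that is 1 on real tuples has product 1 over the joint spectrum.\<close>

lemma joint_spectrum_prod_eq_1:
  assumes "joint_spectrum n As L"
    and "\<And>\<nu>. \<nu> \<in> set L \<Longrightarrow> g (map cnj \<nu>) = g \<nu>"
    and "\<And>\<nu>. \<nu> \<in> set L \<Longrightarrow> (g \<nu>)\<^sup>2 = (1 :: real)"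
    and "\<And>\<nu>. \<nu> \<in> set L \<Longrightarrow> (\<forall>z\<in>set \<nu>. Im z = 0) \<Longrightarrow> g \<nu> = 1"
  shows "(\<Prod>\<nu>\<leftarrow>L. g \<nu>) = 1"
proof -
  have "prod_mset (image_mset g (mset L)) = 1"
  proof (rule prod_mset_involution[where \<iota> = "map cnj"])
    show "image_mset (map cnj) (mset L) = mset L" using joint_spectrum_cnj[OF assms(1)] by simp
  qed (use assms(2-4) in \<open>simp_all add: o_def map_cnj_fixed_iff\<close>)
  thus ?thesis by (metis mset_map prod_mset_prod_list)
qed

section \<open>Continuity of the parity\<close>

lemma prod_list_nth: "(\<Prod>x\<leftarrow>xs. f x) = (\<Prod>j<length xs. f (xs ! j) :: 'a::comm_monoid_mult)"
  by (subst prod.list_conv_set_nth) (simp add: atLeast0LessThan)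

text \<open>Compare the entry of largest modulus of an eigenvector in the eigenvalue equation.\<close>

lemma eigenvalue_norm_le:
  fixes A :: "complex mat"
  assumes A: "A \<in> carrier_mat n n" and ev: "eigenvalue A z"
    and bound: "\<And>r c. r < n \<Longrightarrow> c < n \<Longrightarrow> cmod (A $$ (r, c)) \<le> b"
  shows "cmod z \<le> real n * b"
proof -
  obtain v where v: "v \<in> carrier_vec n" "v \<noteq> 0\<^sub>v n" "A *\<^sub>v v = z \<cdot>\<^sub>v v"
    using ev A by (auto simp: eigenvalue_def eigenvector_def)
  from v(1,2) obtain p where p: "p < n" "v $ p \<noteq> 0" by (auto simp: vec_eq_iff)
  define V where "V = (\<lambda>c. cmod (v $ c)) ` {..<n}"
  have V: "finite V" "V \<noteq> {}" using p by (auto simp: V_def)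
  obtain r where r: "r < n" "Max V = cmod (v $ r)" using Max_in[OF V] by (auto simp: V_def)
  have max: "cmod (v $ c) \<le> cmod (v $ r)" if "c < n" for c
    using Max_ge[OF V(1), of "cmod (v $ c)"] that unfolding r(2) by (simp add: V_def)
  have pos: "cmod (v $ r) > 0" using max[OF p(1)] p(2) by (meson less_le_trans zero_less_norm_iff)
  have "z * v $ r = (A *\<^sub>v v) $ r" using v r by simp
  also have "\<dots> = (\<Sum>c<n. A $$ (r, c) * v $ c)"
    using A v(1) r(1) by (simp add: scalar_prod_def atLeast0LessThan)
  finally have eq: "z * v $ r = (\<Sum>c<n. A $$ (r, c) * v $ c)" .
  have "cmod z * cmod (v $ r) = cmod (\<Sum>c<n. A $$ (r, c) * v $ c)"
    unfolding eq[symmetric] by (rule norm_mult[symmetric])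
  also have "\<dots> \<le> (\<Sum>c<n. cmod (A $$ (r, c) * v $ c))" by (rule norm_sum)
  also have "\<dots> = (\<Sum>c<n. cmod (A $$ (r, c)) * cmod (v $ c))" by (simp add: norm_mult)
  also have "\<dots> \<le> (\<Sum>c<n. b * cmod (v $ r))"
    using bound max r(1) by (intro sum_mono mult_mono) (auto intro: order_trans[OF norm_ge_zero])
  finally have "cmod z * cmod (v $ r) \<le> (real n * b) * cmod (v $ r)" by simp
  thus ?thesis using pos by simp
qed

text \<open>The entries in position \<open>i\<close> of the joint eigenvalues are the roots of the characteristic
  polynomial of \<open>A\<^sub>i\<close>. The pencil identity gives this for real arguments, hence identically.\<close>

lemma joint_spectrum_norm_le:
  assumes L: "joint_spectrum n As L" and \<nu>: "\<nu> \<in> set L" and i: "i < length As"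
    and A: "As ! i \<in> carrier_mat n n" and bound: "\<And>r c. r < n \<Longrightarrow> c < n \<Longrightarrow> \<bar>(As ! i) $$ (r, c)\<bar> \<le> b"
  shows "cmod (\<nu> ! i) \<le> real n * b"
proof -
  define B where "B = map_mat complex_of_real (As ! i)"
  have B: "B \<in> carrier_mat n n" using A by (simp add: B_def)
  define x where "x = (\<lambda>k. if k = i then 1 else 0 :: real)"
  have xsum: "(\<Sum>k<length As. of_real (x k) * g k) = g i" for g :: "nat \<Rightarrow> 'b::{real_algebra_1, comm_ring_1}"
  proof -
    have "(\<Sum>k<length As. of_real (x k) * g k) = (\<Sum>k<length As. if k = i then g k else 0)"
      by (intro sum.cong) (auto simp: x_def)
    thus ?thesis using i by simp
  qed
  define q where "q = (\<Prod>\<nu>\<leftarrow>L. [:- (\<nu> ! i), 1:])"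
  have "poly (char_poly B) (of_real y) = poly q (of_real y)" for y
  proof -
    have "- char_matrix (As ! i) y = pencil n x y As"
      using A xsum[of "\<lambda>k. (As ! k) $$ (_, _)"]
      by (intro eq_matI) (auto simp: pencil_def char_matrix_def)
    hence "poly (char_poly B) (of_real y) = of_real (det (pencil n x y As))"
      using char_poly_matrix[OF A, of y]
      by (simp add: B_def of_real_hom.char_poly_hom[OF A] of_real_hom.poly_map_poly)
    also have "\<dots> = (\<Prod>\<nu>\<leftarrow>L. of_real y - \<nu> ! i)"
      using joint_spectrumD(3)[OF L, of x y] by (simp add: xsum)
    also have "\<dots> = poly q (of_real y)"
      unfolding q_def by (induction L) (simp_all add: algebra_simps)
    finally show ?thesis .
  qed
  hence sub: "range complex_of_real \<subseteq> {z. poly (char_poly B - q) z = 0}" by auto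
  have "char_poly B - q = 0"
  proof (rule ccontr)
    assume "char_poly B - q \<noteq> 0"
    hence "finite (range complex_of_real)" using sub poly_roots_finite rev_finite_subset by blast
    thus False using finite_imageD[of complex_of_real UNIV] by (simp add: inj_def infinite_UNIV_char_0)
  qed
  hence "poly (char_poly B) (\<nu> ! i) = poly q (\<nu> ! i)" by simp
  also have "poly q (\<nu> ! i) = 0"
    using \<nu> unfolding q_def by (induction L) auto
  finally have "eigenvalue B (\<nu> ! i)" using eigenvalue_root_char_poly[OF B] by simp
  thus ?thesis using bound A by (intro eigenvalue_norm_le[OF B]) (auto simp: B_def)
qed

lemma convergent_subsequence_finite_family:
  fixes f :: "nat \<Rightarrow> 'i \<Rightarrow> complex"
  assumes "finite I" "\<And>i. i \<in> I \<Longrightarrow> bounded (range (\<lambda>k. f k i))"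
  shows "\<exists>r z. strict_mono (r :: nat \<Rightarrow> nat) \<and> (\<forall>i\<in>I. (\<lambda>k. f (r k) i) \<longlonglongrightarrow> z i)"
  using assms
proof (induction I rule: finite_induct)
  case empty
  show ?case by (auto intro!: exI[of _ id] strict_mono_id)
next
  case (insert j I)
  then obtain r z where r: "strict_mono (r :: nat \<Rightarrow> nat)" and z: "\<And>i. i \<in> I \<Longrightarrow> (\<lambda>k. f (r k) i) \<longlonglongrightarrow> z i"
    by (metis insertI2)
  have "bounded (range (\<lambda>k. f (r k) j))"
    by (rule bounded_subset[OF insert.prems[of j]]) auto
  then obtain w s where s: "strict_mono (s :: nat \<Rightarrow> nat)" and w: "((\<lambda>k. f (r k) j) \<circ> s) \<longlonglongrightarrow> w"
    using bounded_imp_convergent_subsequence by blast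
  have "(\<lambda>k. f ((r \<circ> s) k) i) \<longlonglongrightarrow> (z(j := w)) i" if "i \<in> insert j I" for i
    using that w LIMSEQ_subseq_LIMSEQ[OF z s, of i] insert.hyps by (cases "i = j") (auto simp: o_def)
  moreover have "strict_mono (r \<circ> s)" using r s by (rule strict_mono_o)
  ultimately show ?case by blast
qed

lemma tendsto_det:
  fixes A :: "nat \<Rightarrow> real mat"
  assumes A: "\<And>k. A k \<in> carrier_mat n n" and B: "B \<in> carrier_mat n n"
    and lim: "\<And>r c. r < n \<Longrightarrow> c < n \<Longrightarrow> (\<lambda>k. A k $$ (r, c)) \<longlonglongrightarrow> B $$ (r, c)"
  shows "(\<lambda>k. det (A k)) \<longlonglongrightarrow> det B"
proof -
  have "(\<lambda>k. \<Sum>p | p permutes {0..<n}. signof p * (\<Prod>i = 0..<n. A k $$ (i, p i)))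
      \<longlonglongrightarrow> (\<Sum>p | p permutes {0..<n}. signof p * (\<Prod>i = 0..<n. B $$ (i, p i)))"
    by (intro tendsto_sum tendsto_mult tendsto_const tendsto_prod lim)
      (auto dest: permutes_in_image[of _ "{0..<n}"])
  moreover have "dim_row (A k) = n" "dim_col (A k) = n" for k using A[of k] by auto
  ultimately show ?thesis using B by (simp add: det_def)
qed

text \<open>Joint spectra are unique only as multisets, so the list is chosen; the product does not depend on
  its order. The head of the list serves only to read off the size of the matrices.\<close>

definition negative_parity :: "real mat list \<Rightarrow> real" where
  "negative_parity As =
     (\<Prod>\<nu>\<leftarrow>(SOME L. joint_spectrum (dim_row (hd As)) As L). neg_sign \<nu>)"

lemma negative_parity_eq:
  assumes As: "As \<in> commuting_tuples l n" and l: "l \<ge> 1" and L: "joint_spectrum n As L"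
  shows "negative_parity As = (\<Prod>\<nu>\<leftarrow>L. neg_sign \<nu>)"
proof -
  have "hd As \<in> set As" using commuting_tuplesD(1)[OF As] l by (intro hd_in_set) auto
  hence n: "dim_row (hd As) = n" using commuting_tuplesD(3)[OF As] by auto
  define M where "M = (SOME L. joint_spectrum n As L)"
  have "joint_spectrum n As M" unfolding M_def using L by (rule someI[where P = "joint_spectrum n As"])
  hence "mset M = mset L" using joint_spectrum_unique L by blast
  hence "mset (map neg_sign M) = mset (map neg_sign L)" by simp
  hence "prod_list (map neg_sign M) = prod_list (map neg_sign L)" by (metis prod_mset_prod_list)
  thus ?thesis by (simp add: negative_parity_def n M_def)
qed

lemma prod_list_neg_sign: "(\<Prod>\<nu>\<leftarrow>L. neg_sign \<nu>) \<in> {1, -1}"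
  by (induction L) (auto simp: neg_sign_def)

lemma negative_parity_values:
  assumes "As \<in> commuting_tuples l n" "l \<ge> 1" "n \<ge> 1"
  shows "negative_parity As \<in> {1, -1}"
  using ex_joint_spectrum[OF assms(1,3)] negative_parity_eq[OF assms(1,2)] prod_list_neg_sign by metis

text \<open>The joint spectra of a convergent sequence of tuples are bounded, so along a subsequence they
  converge entry by entry, and since the pencil identity passes to the limit, the limit list is the
  joint spectrum of the limit tuple. Only the nearby eigenvalues that collide in the negative orthant matter:
  a small conjugation-invariant neighbourhood of the orthant contains all of them and no others, and
  the real tuples in it are exactly the all-negative ones.\<close>

lemma negative_parity_limit:
  assumes Bs: "\<And>k. Bs k \<in> commuting_tuples l n" and As: "As \<in> commuting_tuples l n"
    and n: "n \<ge> 1" and l: "l \<ge> 1"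
    and lim: "\<And>i r c. i < l \<Longrightarrow> r < n \<Longrightarrow> c < n \<Longrightarrow> (\<lambda>k. (Bs k ! i) $$ (r, c)) \<longlonglongrightarrow> (As ! i) $$ (r, c)"
  shows "\<exists>k. negative_parity (Bs k) = negative_parity As"
proof -
  have "\<forall>k. \<exists>L. joint_spectrum n (Bs k) L" using ex_joint_spectrum[OF Bs n] by blast
  then obtain L where L: "\<And>k. joint_spectrum n (Bs k) (L k)" by metis
  have lenB: "length (Bs k) = l" for k using commuting_tuplesD(1)[OF Bs] .
  have lenA: "length As = l" using commuting_tuplesD(1)[OF As] .
  have lenL: "length (L k) = n" for k using joint_spectrumD(1)[OF L] .
  have len\<nu>: "length (L k ! j) = l" if "j < n" for k j
    using joint_spectrumD(2)[OF L, of "L k ! j" k] lenB lenL that by simp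
  have "bounded (range (\<lambda>k. L k ! fst p ! snd p))" if p: "p \<in> {..<n} \<times> {..<l}" for p
  proof -
    obtain j i where ji: "p = (j, i)" "j < n" "i < l" using p by auto
    have "\<exists>b. \<forall>k. \<bar>(Bs k ! i) $$ (r, c)\<bar> \<le> b" if "r < n" "c < n" for r c
      using convergent_imp_Bseq[OF convergentI[OF lim[OF ji(3) that]]] by (auto simp: Bseq_def)
    then obtain b where b: "\<And>r c k. r < n \<Longrightarrow> c < n \<Longrightarrow> \<bar>(Bs k ! i) $$ (r, c)\<bar> \<le> b r c" by metis
    define b' where "b' = (\<Sum>r<n. \<Sum>c<n. b r c)"
    have b0: "0 \<le> b r c" if "r < n" "c < n" for r c using b[OF that] by (meson abs_ge_zero order_trans)
    have "b r c \<le> b'" if "r < n" "c < n" for r c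
    proof -
      have "b r c \<le> (\<Sum>c<n. b r c)" using that b0 by (intro member_le_sum) auto
      also have "\<dots> \<le> b'" unfolding b'_def using that b0
        by (intro member_le_sum[of r "{..<n}" "\<lambda>r. \<Sum>c<n. b r c"]) (auto intro!: sum_nonneg)
      finally show ?thesis .
    qed
    hence "\<bar>(Bs k ! i) $$ (r, c)\<bar> \<le> b'" if "r < n" "c < n" for r c k
      using b[OF that, of k] that by fastforce
    hence "cmod (L k ! j ! i) \<le> real n * b'" for k
      using ji(2,3) lenB lenL commuting_tuples_nthD[OF Bs ji(3)]
      by (intro joint_spectrum_norm_le[OF L[of k]]) auto
    thus ?thesis by (auto simp: bounded_iff ji)
  qed
  hence "\<exists>s z. strict_mono (s :: nat \<Rightarrow> nat) \<and>
      (\<forall>p\<in>{..<n} \<times> {..<l}. (\<lambda>k. L (s k) ! fst p ! snd p) \<longlonglongrightarrow> z p)"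
    by (intro convergent_subsequence_finite_family) simp_all
  then obtain s :: "nat \<Rightarrow> nat" and z where s: "strict_mono s"
    and "\<And>p. p \<in> {..<n} \<times> {..<l} \<Longrightarrow> (\<lambda>k. L (s k) ! fst p ! snd p) \<longlonglongrightarrow> z p"
    by blast
  hence z: "(\<lambda>k. L (s k) ! j ! i) \<longlonglongrightarrow> z (j, i)" if "j < n" "i < l" for j i
    using that by force
  define L' where "L' = map (\<lambda>j. map (\<lambda>i. z (j, i)) [0..<l]) [0..<n]"
  have L'nth: "L' ! j ! i = z (j, i)" if "j < n" "i < l" for j i using that by (simp add: L'_def)
  have "complex_of_real (det (pencil n x y As)) = (\<Prod>\<nu>\<leftarrow>L'. of_real y - (\<Sum>i<l. of_real (x i) * \<nu> ! i))"
    for x y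
  proof (rule LIMSEQ_unique)
    have "(\<lambda>k. det (pencil n x y (Bs (s k)))) \<longlonglongrightarrow> det (pencil n x y As)"
    proof (rule tendsto_det)
      fix r c assume rc: "r < n" "c < n"
      have "(\<lambda>k. (Bs (s k) ! i) $$ (r, c)) \<longlonglongrightarrow> (As ! i) $$ (r, c)" if "i < l" for i
        using LIMSEQ_subseq_LIMSEQ[OF lim[OF that rc] s] by (simp add: o_def)
      hence "(\<lambda>k. (if r = c then y else 0) - (\<Sum>i<l. x i * (Bs (s k) ! i) $$ (r, c)))
        \<longlonglongrightarrow> (if r = c then y else 0) - (\<Sum>i<l. x i * (As ! i) $$ (r, c))"
        by (intro tendsto_intros) auto
      thus "(\<lambda>k. pencil n x y (Bs (s k)) $$ (r, c)) \<longlonglongrightarrow> pencil n x y As $$ (r, c)"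
        using rc by (simp add: pencil_def lenA lenB)
    qed auto
    thus "(\<lambda>k. complex_of_real (det (pencil n x y (Bs (s k))))) \<longlonglongrightarrow> of_real (det (pencil n x y As))"
      by (intro tendsto_intros)
    have "(\<lambda>k. \<Prod>j<n. of_real y - (\<Sum>i<l. of_real (x i) * L (s k) ! j ! i))
        \<longlonglongrightarrow> (\<Prod>j<n. of_real y - (\<Sum>i<l. of_real (x i) * L' ! j ! i))"
      using z by (intro tendsto_intros) (auto simp: L'nth)
    thus "(\<lambda>k. complex_of_real (det (pencil n x y (Bs (s k))))) \<longlonglongrightarrow>
        (\<Prod>\<nu>\<leftarrow>L'. of_real y - (\<Sum>i<l. of_real (x i) * \<nu> ! i))"
      using joint_spectrumD(3)[OF L] by (simp add: prod_list_nth lenL lenB L'_def)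
  qed
  hence L': "joint_spectrum n As L'" by (auto simp: joint_spectrum_def lenA L'_def)
  have nz: "z (j, i) \<noteq> 0" if "j < n" "i < l" for j i
proof -
    have "L' ! j \<in> set L'" using that by (intro nth_mem) (simp add: L'_def)
    from joint_spectrum_nonzero[OF L' As this that(2)] show ?thesis by (simp add: L'nth that)
  qed
  \<comment> \<open>The width \<open>\<epsilon>\<close> of the neighbourhood is half the least nonzero imaginary part in the limit; the
    element 1 keeps the set nonempty.\<close>
  define E where "E = insert 1 ((\<lambda>p. \<bar>Im (z p)\<bar>) ` {p \<in> {..<n} \<times> {..<l}. Im (z p) \<noteq> 0})"
  have E: "finite E" "E \<noteq> {}" "\<And>e. e \<in> E \<Longrightarrow> e > 0" by (auto simp: E_def)
  define \<epsilon> where "\<epsilon> = Min E / 2"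
  have \<epsilon>: "\<epsilon> > 0" using E Min_in[OF E(1,2)] by (simp add: \<epsilon>_def)
  have sep: "\<epsilon> < \<bar>Im (z (j, i))\<bar>" if "j < n" "i < l" "Im (z (j, i)) \<noteq> 0" for j i
  proof -
    have "\<bar>Im (z (j, i))\<bar> \<in> E" using that by (auto simp: E_def intro!: imageI)
    hence "Min E \<le> \<bar>Im (z (j, i))\<bar>" using E(1) by simp
    thus ?thesis using \<epsilon> by (simp add: \<epsilon>_def)
  qed
  define u :: "complex list \<Rightarrow> real" where
    "u \<nu> = (if \<forall>w\<in>set \<nu>. Re w < 0 \<and> \<bar>Im w\<bar> < \<epsilon> then -1 else 1)" for \<nu>
  have u: "u (map cnj \<nu>) = u \<nu>" "(u \<nu>)\<^sup>2 = 1" for \<nu> by (auto simp: u_def)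
  have u_real: "u \<nu> = neg_sign \<nu>" if "\<forall>w\<in>set \<nu>. Im w = 0" for \<nu>
    using that \<epsilon> by (auto simp: u_def neg_sign_def all_negative_def)
  have "\<forall>\<^sub>F k in sequentially. u (L (s k) ! j) = neg_sign (L' ! j)" if j: "j < n" for j
  proof (cases "all_negative (L' ! j)")
    case True
    have "\<forall>\<^sub>F k in sequentially. Re (L (s k) ! j ! i) < 0 \<and> \<bar>Im (L (s k) ! j ! i)\<bar> < \<epsilon>" if i: "i < l" for i
    proof (rule eventually_conj)
      have z': "Re (z (j, i)) < 0" "Im (z (j, i)) = 0"
        using True i j by (auto simp: all_negative_def L'_def)
      show "\<forall>\<^sub>F k in sequentially. Re (L (s k) ! j ! i) < 0"
        by (rule order_tendstoD(2)[OF tendsto_Re[OF z[OF j i]] z'(1)])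
      have "(\<lambda>k. \<bar>Im (L (s k) ! j ! i)\<bar>) \<longlonglongrightarrow> \<bar>Im (z (j, i))\<bar>"
        by (intro tendsto_intros z j i)
      thus "\<forall>\<^sub>F k in sequentially. \<bar>Im (L (s k) ! j ! i)\<bar> < \<epsilon>"
        by (rule order_tendstoD(2)) (use z'(2) \<epsilon> in simp)
    qed
    hence "\<forall>\<^sub>F k in sequentially. \<forall>i\<in>{..<l}. Re (L (s k) ! j ! i) < 0 \<and> \<bar>Im (L (s k) ! j ! i)\<bar> < \<epsilon>"
      by (intro eventually_ball_finite) auto
    thus ?thesis
      by eventually_elim (use True len\<nu>[OF j] in \<open>auto simp: u_def neg_sign_def in_set_conv_nth\<close>)
  next
    case False
    then obtain i where i: "i < l" "Im (z (j, i)) \<noteq> 0 \<or> Re (z (j, i)) \<ge> 0"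
      using j by (auto simp: all_negative_def L'_def not_less)
    have "\<forall>\<^sub>F k in sequentially. 0 < Re (L (s k) ! j ! i) \<or> \<epsilon> < \<bar>Im (L (s k) ! j ! i)\<bar>"
    proof (cases "Im (z (j, i)) = 0")
      case True
      hence "0 < Re (z (j, i))" using i nz[OF j i(1)] by (auto simp: complex_eq_iff)
      from order_tendstoD(1)[OF tendsto_Re[OF z[OF j i(1)]] this]
      show ?thesis by eventually_elim simp
    next
      case False
      have "(\<lambda>k. \<bar>Im (L (s k) ! j ! i)\<bar>) \<longlonglongrightarrow> \<bar>Im (z (j, i))\<bar>"
        by (intro tendsto_intros z j i)
      from order_tendstoD(1)[OF this sep[OF j i(1) False]]
      show ?thesis by eventually_elim simp
    qed
    thus ?thesis
    proof eventually_elim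
      case (elim k)
      have "L (s k) ! j ! i \<in> set (L (s k) ! j)" using len\<nu>[OF j] i(1) by simp
      hence "u (L (s k) ! j) = 1" using elim by (force simp: u_def)
      thus ?case using False by (simp add: neg_sign_def)
    qed
  qed
  hence "\<forall>\<^sub>F k in sequentially. \<forall>j\<in>{..<n}. u (L (s k) ! j) = neg_sign (L' ! j)"
    by (intro eventually_ball_finite) auto
  then obtain k where k: "\<And>j. j < n \<Longrightarrow> u (L (s k) ! j) = neg_sign (L' ! j)"
    by (auto simp: eventually_sequentially)
  \<comment> \<open>The signs \<open>u\<close> and \<open>neg_sign\<close> agree on real tuples.\<close>
  have "(\<Prod>\<nu>\<leftarrow>L (s k). u \<nu> * neg_sign \<nu>) = 1"
    using u u_real by (intro joint_spectrum_prod_eq_1[OF L])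
      (auto simp: neg_sign_cnj power_mult_distrib, auto simp: neg_sign_def)
  hence "(\<Prod>\<nu>\<leftarrow>L (s k). u \<nu>) * (\<Prod>\<nu>\<leftarrow>L (s k). neg_sign \<nu>) = 1"
    by (simp add: prod_list_nth prod.distrib)
  moreover have "(\<Prod>\<nu>\<leftarrow>L (s k). u \<nu>) = (\<Prod>\<nu>\<leftarrow>L'. neg_sign \<nu>)"
    using k by (simp add: prod_list_nth lenL L'_def)
  ultimately have "negative_parity As * negative_parity (Bs (s k)) = 1"
    using negative_parity_eq[OF As l L'] negative_parity_eq[OF Bs l L] by simp
  thus ?thesis
    using negative_parity_values[OF As l n] negative_parity_values[OF Bs l n, of "s k"]
    by (intro exI[of _ "s k"]) auto
qed

lemma openin_entrywise_ball:
  fixes As :: "real mat list" and e :: real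
  assumes As: "As \<in> commuting_tuples l n"
  shows "openin (commuting_tuples_topology l n)
    {Bs \<in> commuting_tuples l n. \<forall>i<l. \<forall>r<n. \<forall>c<n. \<bar>(Bs ! i) $$ (r, c) - (As ! i) $$ (r, c)\<bar> < e}"
proof -
  let ?I = "{..<l} \<times> {..<n} \<times> {..<n}"
  let ?f = "\<lambda>Bs. \<lambda>(i, r, c)\<in>?I. (Bs ! i) $$ (r, c) :: real"
  let ?S = "\<lambda>(i, r, c). {(As ! i) $$ (r, c) - e<..<(As ! i) $$ (r, c) + e}"
  have interval: "x \<in> {y - e<..<y + e} \<longleftrightarrow> \<bar>x - y\<bar> < e" for x y by auto
  have "openin euclideanreal (?S p)" for p by (cases p) simp
  hence "openin (product_topology (\<lambda>_. euclideanreal) ?I) (PiE ?I ?S)"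
    by (subst openin_PiE) auto
  moreover have "?f Bs \<in> PiE ?I ?S \<longleftrightarrow>
      (\<forall>i<l. \<forall>r<n. \<forall>c<n. \<bar>(Bs ! i) $$ (r, c) - (As ! i) $$ (r, c)\<bar> < e)" for Bs
  proof -
    have "?f Bs \<in> PiE ?I ?S \<longleftrightarrow> (\<forall>p\<in>?I. (case p of (i, r, c) \<Rightarrow> (Bs ! i) $$ (r, c)) \<in> ?S p)"
      by (rule restrict_PiE_iff)
    also have "\<dots> \<longleftrightarrow> (\<forall>i\<in>{..<l}. \<forall>r\<in>{..<n}. \<forall>c\<in>{..<n}.
        (Bs ! i) $$ (r, c) \<in> {(As ! i) $$ (r, c) - e<..<(As ! i) $$ (r, c) + e})"
      by (simp only: ball_simps split_paired_Ball_Sigma split_conv)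
    finally show ?thesis unfolding Ball_def lessThan_iff interval .
  qed
  hence "{Bs \<in> commuting_tuples l n. \<forall>i<l. \<forall>r<n. \<forall>c<n. \<bar>(Bs ! i) $$ (r, c) - (As ! i) $$ (r, c)\<bar> < e}
      = ?f -` PiE ?I ?S \<inter> commuting_tuples l n" by blast
  ultimately show ?thesis unfolding commuting_tuples_topology_def openin_pullback_topology by blast
qed

text \<open>Otherwise, tuples of the other parity in the balls of radius \<open>1/(k+1)\<close> would converge to \<open>As\<close>.\<close>

lemma negative_parity_locally_constant:
  assumes As: "As \<in> commuting_tuples l n" and n: "n \<ge> 1" and l: "l \<ge> 1"
  shows "\<exists>U. openin (commuting_tuples_topology l n) U \<and> As \<in> U \<and>
    (\<forall>Bs\<in>U. negative_parity Bs = negative_parity As)"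
proof -
  define U where "U e = {Bs \<in> commuting_tuples l n.
     \<forall>i<l. \<forall>r<n. \<forall>c<n. \<bar>(Bs ! i) $$ (r, c) - (As ! i) $$ (r, c)\<bar> < e}" for e
  have "\<exists>k. \<forall>Bs\<in>U (inverse (real (Suc k))). negative_parity Bs = negative_parity As"
  proof (rule ccontr)
    assume "\<not> ?thesis"
    then obtain Bs where Bs: "\<And>k. Bs k \<in> U (inverse (real (Suc k)))"
      and neq: "\<And>k. negative_parity (Bs k) \<noteq> negative_parity As" by metis
    have "(\<lambda>k. (Bs k ! i) $$ (r, c)) \<longlonglongrightarrow> (As ! i) $$ (r, c)" if "i < l" "r < n" "c < n" for i r c
    proof (rule LIM_zero_cancel, rule Lim_null_comparison[OF _ LIMSEQ_inverse_real_of_nat])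
      show "\<forall>\<^sub>F k in sequentially. norm ((Bs k ! i) $$ (r, c) - (As ! i) $$ (r, c)) \<le> inverse (real (Suc k))"
        using Bs that by (intro always_eventually) (force simp: U_def intro: less_imp_le)
    qed
    from negative_parity_limit[OF _ As n l this] Bs neq show False by (auto simp: U_def)
  qed
  then obtain k where k: "\<forall>Bs\<in>U (inverse (real (Suc k))). negative_parity Bs = negative_parity As" by blast
  have "openin (commuting_tuples_topology l n) (U (inverse (real (Suc k))))"
    unfolding U_def by (rule openin_entrywise_ball[OF As])
  moreover have "As \<in> U (inverse (real (Suc k)))" using As by (simp add: U_def)
  ultimately show ?thesis using k by blast
qed

lemma continuous_map_of_parity:
  assumes D: "\<And>As. As \<in> commuting_tuples l n \<Longrightarrow> D As = negative_parity As" and n: "n \<ge> 1" and l: "l \<ge> 1"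
  shows "continuous_map (commuting_tuples_topology l n) (top_of_set (- {0})) D"
proof -
  note parity = negative_parity_values[OF _ l n]
  have "openin (commuting_tuples_topology l n) {As \<in> commuting_tuples l n. D As \<in> V}" for V
  proof (subst openin_subopen, intro ballI)
    fix As assume "As \<in> {As \<in> commuting_tuples l n. D As \<in> V}"
    hence As: "As \<in> commuting_tuples l n" "D As \<in> V" by auto
    obtain U where U: "openin (commuting_tuples_topology l n) U" "As \<in> U"
      "\<forall>Bs\<in>U. negative_parity Bs = negative_parity As"
      using negative_parity_locally_constant[OF As(1) n l] by blast
    have "U \<subseteq> commuting_tuples l n"
      using openin_subset[OF U(1)] by (simp add: topspace_commuting_tuples_topology)
    hence "U \<subseteq> {As \<in> commuting_tuples l n. D As \<in> V}" using U(3) D As by auto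
    thus "\<exists>T. openin (commuting_tuples_topology l n) T \<and> As \<in> T \<and>
        T \<subseteq> {As \<in> commuting_tuples l n. D As \<in> V}" using U by blast
  qed
  moreover have "D As \<noteq> 0" if "As \<in> commuting_tuples l n" for As
    using parity[OF that] D[OF that] by auto
  ultimately show ?thesis
    by (auto simp: continuous_map_def topspace_commuting_tuples_topology)
qed

lemma continuous_map_path:
  assumes path: "\<And>t. \<gamma> t \<in> commuting_tuples l n"
    and cont: "\<And>i r c. i < l \<Longrightarrow> r < n \<Longrightarrow> c < n \<Longrightarrow> continuous_on UNIV (\<lambda>t::real. (\<gamma> t ! i) $$ (r, c))"
  shows "continuous_map euclideanreal (commuting_tuples_topology l n) \<gamma>"
  unfolding commuting_tuples_topology_def
proof (rule continuous_map_pullback')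
  show "continuous_map euclideanreal (product_topology (\<lambda>_. euclideanreal) ({..<l} \<times> {..<n} \<times> {..<n}))
      ((\<lambda>As. \<lambda>(i, r, c)\<in>{..<l} \<times> {..<n} \<times> {..<n}. (As ! i) $$ (r, c)) \<circ> \<gamma>)"
    using cont by (auto simp: continuous_map_componentwise o_def)
  show "topspace euclideanreal \<subseteq> \<gamma> -` commuting_tuples l n" using path by auto
qed

lemma continuous_on_along_path:
  assumes D: "continuous_on_tuples l D" and n: "n \<ge> 1" and path: "\<And>t. \<gamma> t \<in> commuting_tuples l n"
    and cont: "\<And>i r c. i < l \<Longrightarrow> r < n \<Longrightarrow> c < n \<Longrightarrow> continuous_on UNIV (\<lambda>t::real. (\<gamma> t ! i) $$ (r, c))"
  shows "continuous_on UNIV (\<lambda>t. D (\<gamma> t))"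
proof -
  have "continuous_map (commuting_tuples_topology l n) (top_of_set (- {0})) D"
    using D n by (simp add: continuous_on_tuples_def)
  from continuous_map_compose[OF continuous_map_path[OF path cont] this]
  have "continuous_map euclideanreal (top_of_set (- {0})) (D \<circ> \<gamma>)" by simp
  thus ?thesis by (simp add: continuous_map_in_subtopology o_def)
qed

section \<open>Existence\<close>

definition parity_determinant :: "nat \<Rightarrow> real mat list \<Rightarrow> real" where
  "parity_determinant l = restrict negative_parity (all_commuting_tuples l)"

lemma parity_determinant_eq:
  "As \<in> commuting_tuples l n \<Longrightarrow> n \<ge> 1 \<Longrightarrow> parity_determinant l As = negative_parity As"
  by (auto simp: parity_determinant_def all_commuting_tuples_def)

lemma continuous_on_parity_determinant: "l \<ge> 1 \<Longrightarrow> continuous_on_tuples l (parity_determinant l)"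
  unfolding continuous_on_tuples_def
  by (intro allI impI continuous_map_of_parity parity_determinant_eq)

lemma GL_mat_mult:
  fixes A :: "'a::semiring_1 mat"
  assumes "A \<in> GL_mat n" "B \<in> GL_mat n"
  shows "A * B \<in> GL_mat n"
proof -
  obtain A' B' where A: "A \<in> carrier_mat n n" "A' \<in> carrier_mat n n" "A * A' = 1\<^sub>m n" "A' * A = 1\<^sub>m n"
    and B: "B \<in> carrier_mat n n" "B' \<in> carrier_mat n n" "B * B' = 1\<^sub>m n" "B' * B = 1\<^sub>m n"
    using assms by (auto simp: GL_mat_iff)
  have "A * B * (B' * A') = A * ((B * B') * A')"
    using A(1,2) B(1,2) by (simp add: assoc_mult_mat[of _ n n _ n _ n])
  moreover have "B' * A' * (A * B) = B' * ((A' * A) * B)"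
    using A(1,2) B(1,2) by (simp add: assoc_mult_mat[of _ n n _ n _ n])
  ultimately have "A * B * (B' * A') = 1\<^sub>m n" "B' * A' * (A * B) = 1\<^sub>m n"
    using A B by simp_all
  thus ?thesis unfolding GL_mat_iff
    by (intro conjI bexI[of _ "B' * A'"] mult_carrier_mat[of _ n n _ n] A(1,2) B(1,2))
qed

lemma commuting_tuples_select:
  assumes "As \<in> commuting_tuples l n" "set ks \<subseteq> {..<l}"
  shows "map ((!) As) ks \<in> commuting_tuples (length ks) n"
  using assms by (auto simp: commuting_tuples_def subset_iff)

lemma commuting_tuples_append_product:
  fixes As :: "'a::comm_semiring_1 mat list"
  assumes BA: "B # As \<in> commuting_tuples (Suc l) n" and i: "i < l"
  shows "As @ [B, As ! i * B] \<in> commuting_tuples (l + 2) n"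
proof -
  note ct = commuting_tuplesD[OF BA]
  have len: "length As = l" using ct(1) by simp
  have Ai: "As ! i \<in> set (B # As)" and B: "B \<in> set (B # As)" using i len by auto
  have comm: "A * (As ! i * B) = As ! i * B * A" if A: "A \<in> set (B # As)" for A
  proof -
    note car = ct(3)[OF A] ct(3)[OF Ai] ct(3)[OF B]
    have "A * (As ! i * B) = (A * As ! i) * B" using car by (simp add: assoc_mult_mat[of _ n n _ n _ n])
    also have "\<dots> = As ! i * (A * B)"
      using car ct(4)[OF A Ai] by (simp add: assoc_mult_mat[of _ n n _ n _ n])
    also have "\<dots> = As ! i * B * A"
      using car ct(4)[OF A B] by (simp add: assoc_mult_mat[of _ n n _ n _ n])
    finally show ?thesis .
  qed
  have set: "set (As @ [B, As ! i * B]) = insert (As ! i * B) (set (B # As))" by auto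
  show ?thesis unfolding commuting_tuples_def mem_Collect_eq set
    using len GL_mat_mult[OF ct(2)[OF Ai] ct(2)[OF B]] ct(2,4) comm by (auto simp del: list.set)
qed

text \<open>All three tuples are selected from the single commuting tuple \<open>As @ [B, A\<^sub>i B]\<close>, so their parities
  are products over one joint spectrum, of signs \<open>p\<close> depending on the index put into slot \<open>i\<close>.
  On a real joint eigenvalue the three signs multiply to 1, since the sign of a product is the product of the signs.\<close>

lemma parity_multilinear:
  assumes BA: "B # As \<in> commuting_tuples (Suc l) n" and n: "n \<ge> 1" and i: "i < l"
  shows "negative_parity (As[i := As ! i * B]) = negative_parity As * negative_parity (As[i := B])"
    "As[i := As ! i * B] \<in> commuting_tuples l n" "As \<in> commuting_tuples l n" "As[i := B] \<in> commuting_tuples l n"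
proof -
  define Cs where "Cs = As @ [B, As ! i * B]"
  have len: "length As = l" using commuting_tuplesD(1)[OF BA] by simp
  have C: "Cs \<in> commuting_tuples (l + 2) n" unfolding Cs_def by (rule commuting_tuples_append_product[OF BA i])
  obtain L where L: "joint_spectrum n Cs L"
    and prod: "\<forall>i<l+2. \<forall>j<l+2. \<forall>k<l+2. Cs ! k = Cs ! i * Cs ! j \<longrightarrow> (\<forall>\<nu>\<in>set L. \<nu> ! k = \<nu> ! i * \<nu> ! j)"
    using ex_joint_spectrum[OF C n] by blast
  have "Cs ! (l + 1) = Cs ! i * Cs ! l" using i len by (simp add: Cs_def nth_append)
  hence mult: "\<nu> ! (l + 1) = \<nu> ! i * \<nu> ! l" if "\<nu> \<in> set L" for \<nu> using prod i that by simp
  define ks where "ks j = [0..<l][i := j]" for j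
  have set_ks: "set (ks j) = insert j ({..<l} - {i})" for j
    using i by (simp add: ks_def set_update_distinct atLeast0LessThan)
  have sel: "map ((!) Cs) (ks i) = As" "map ((!) Cs) (ks l) = As[i := B]"
    "map ((!) Cs) (ks (l + 1)) = As[i := As ! i * B]"
    using len i by (auto simp: ks_def Cs_def nth_append nth_list_update intro!: nth_equalityI)
  have ct: "map ((!) Cs) (ks j) \<in> commuting_tuples l n" if "j < l + 2" for j
  proof -
    have "set (ks j) \<subseteq> {..<l + 2}" using that set_ks by auto
    from commuting_tuples_select[OF C this] show ?thesis by (simp add: ks_def)
  qed
  from ct[of i] ct[of l] ct[of "l + 1", unfolded sel] i
  show cts: "As[i := As ! i * B] \<in> commuting_tuples l n" "As \<in> commuting_tuples l n"
    "As[i := B] \<in> commuting_tuples l n" by (simp_all add: sel)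
  define p where "p j \<nu> = neg_sign (map ((!) \<nu>) (ks j))" for j and \<nu> :: "complex list"
  have lenC: "length Cs = l + 2" using len by (simp add: Cs_def)
  have par: "negative_parity (map ((!) Cs) (ks j)) = (\<Prod>\<nu>\<leftarrow>L. p j \<nu>)" if j: "j < l + 2" for j
  proof -
    have "set (ks j) \<subseteq> {..<length Cs}" using set_ks j lenC by auto
    from negative_parity_eq[OF ct[OF j] _ joint_spectrum_select[OF L this]] i
    show ?thesis by (simp add: p_def o_def)
  qed
  have p_val: "p j \<nu> = 1 \<or> p j \<nu> = -1" for j \<nu> by (simp add: p_def neg_sign_def)
  have len\<nu>: "length \<nu> = l + 2" if "\<nu> \<in> set L" for \<nu> using joint_spectrumD(2)[OF L that] lenC by simp
  have "(\<Prod>\<nu>\<leftarrow>L. p (l + 1) \<nu> * (p i \<nu> * p l \<nu>)) = 1"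
  proof (rule joint_spectrum_prod_eq_1[OF L])
    fix \<nu> assume \<nu>: "\<nu> \<in> set L"
    have "p j (map cnj \<nu>) = p j \<nu>" if "j < l + 2" for j
    proof -
      have "map ((!) (map cnj \<nu>)) (ks j) = map cnj (map ((!) \<nu>) (ks j))"
        using set_ks that len\<nu>[OF \<nu>] by auto
      thus ?thesis by (simp only: p_def neg_sign_cnj)
    qed
    thus "p (l + 1) (map cnj \<nu>) * (p i (map cnj \<nu>) * p l (map cnj \<nu>)) = p (l + 1) \<nu> * (p i \<nu> * p l \<nu>)"
      using i by simp
    show "(p (l + 1) \<nu> * (p i \<nu> * p l \<nu>))\<^sup>2 = 1"
      using p_val[of "l + 1" \<nu>] p_val[of i \<nu>] p_val[of l \<nu>] by auto
    assume real: "\<forall>z\<in>set \<nu>. Im z = 0"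
    have im: "Im (\<nu> ! j) = 0" if "j < l + 2" for j using real len\<nu>[OF \<nu>] that by simp
    have nz: "Re (\<nu> ! j) \<noteq> 0" if "j < l + 2" for j
      using joint_spectrum_nonzero[OF L C \<nu> that] im[OF that] by (auto simp: complex_eq_iff)
    define Q where "Q \<longleftrightarrow> (\<forall>k\<in>{..<l} - {i}. Re (\<nu> ! k) < 0)"
    have p_eq: "p j \<nu> = (if Q \<and> Re (\<nu> ! j) < 0 then -1 else 1)" if "j < l + 2" for j
    proof -
      have "all_negative (map ((!) \<nu>) (ks j)) \<longleftrightarrow> Q \<and> Re (\<nu> ! j) < 0"
        using im that by (auto simp: all_negative_def set_ks Q_def)
      thus ?thesis by (simp add: p_def neg_sign_def)
    qed
    have "Re (\<nu> ! (l + 1)) = Re (\<nu> ! i) * Re (\<nu> ! l)" using mult[OF \<nu>] im[of i] i by simp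
    thus "p (l + 1) \<nu> * (p i \<nu> * p l \<nu>) = 1"
      using nz[of i] nz[of l] i p_eq[of i] p_eq[of l] p_eq[of "l + 1"]
      by (auto simp: mult_less_0_iff)
  qed
  hence "(\<Prod>\<nu>\<leftarrow>L. p (l + 1) \<nu>) * ((\<Prod>\<nu>\<leftarrow>L. p i \<nu>) * (\<Prod>\<nu>\<leftarrow>L. p l \<nu>)) = 1"
    by (simp add: prod_list_nth prod.distrib)
  hence "negative_parity (As[i := As ! i * B]) * (negative_parity As * negative_parity (As[i := B])) = 1"
    using par[of i] par[of l] par[of "l + 1", unfolded sel] i by (simp add: sel)
  moreover have "negative_parity As \<in> {1, -1}" "negative_parity (As[i := B]) \<in> {1, -1}"
    "negative_parity (As[i := As ! i * B]) \<in> {1, -1}"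
    using negative_parity_values[OF cts(2) _ n] negative_parity_values[OF cts(3) _ n]
      negative_parity_values[OF cts(1) _ n] i by auto
  ultimately show "negative_parity (As[i := As ! i * B]) = negative_parity As * negative_parity (As[i := B])"
    by auto
qed

lemma direct_sum_eq_extension:
  assumes "As \<in> commuting_tuples l m" "Bs \<in> commuting_tuples l n"
  shows "map2 direct_sum_mat As Bs = block_extension l As (replicate l (0\<^sub>m m n)) Bs"
proof (rule nth_equalityI)
  fix i assume "i < length (map2 direct_sum_mat As Bs)"
  hence i: "i < l" using commuting_tuplesD(1)[OF assms(1)] by simp
  have "dim_row (As ! i) = m" "dim_col (Bs ! i) = n"
    using commuting_tuples_nthD[OF assms(1) i] commuting_tuples_nthD[OF assms(2) i] by auto
  thus "map2 direct_sum_mat As Bs ! i = block_extension l As (replicate l (0\<^sub>m m n)) Bs ! i"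
    using i commuting_tuplesD(1)[OF assms(1)] commuting_tuplesD(1)[OF assms(2)]
    by (simp add: nth_block_extension direct_sum_mat_def)
qed (use commuting_tuplesD(1)[OF assms(1)] commuting_tuplesD(1)[OF assms(2)] in simp)

lemma direct_sum_commuting_tuples:
  fixes As Bs :: "'a::field mat list"
  assumes A: "As \<in> commuting_tuples l m" and B: "Bs \<in> commuting_tuples l n"
  shows "map2 direct_sum_mat As Bs \<in> commuting_tuples l (m + n)"
proof -
  note car = commuting_tuples_nthD[OF A] commuting_tuples_nthD[OF B]
  have len: "length As = l" "length Bs = l" using A B by (auto simp: commuting_tuples_def)
  have nth: "map2 direct_sum_mat As Bs ! i = four_block_mat (As ! i) (0\<^sub>m m n) (0\<^sub>m n m) (Bs ! i)"
    if "i < l" for i using that len car[OF that] by (simp add: direct_sum_mat_def)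
  have "map2 direct_sum_mat As Bs ! i \<in> GL_mat (m + n)" if i: "i < l" for i
  proof -
    have "det (As ! i) \<noteq> 0" "det (Bs ! i) \<noteq> 0"
      using A B i by (auto simp: commuting_tuples_iff_nth GL_mat_iff_det)
    thus ?thesis unfolding nth[OF i] GL_mat_iff_det
      using car[OF i] det_four_block_mat_lower_left_zero[OF car(1)[OF i] zero_carrier_mat refl car(2)[OF i]]
      by simp
  qed
  moreover have "map2 direct_sum_mat As Bs ! i * map2 direct_sum_mat As Bs ! j =
      map2 direct_sum_mat As Bs ! j * map2 direct_sum_mat As Bs ! i" if ij: "i < l" "j < l" for i j
  proof -
    have "As ! i * As ! j = As ! j * As ! i" "Bs ! i * Bs ! j = Bs ! j * Bs ! i"
      using A B ij by (auto simp: commuting_tuples_iff_nth)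
    thus ?thesis
      unfolding nth[OF ij(1)] nth[OF ij(2)]
        mult_block_upper_triangular[OF car(1)[OF ij(1)] zero_carrier_mat car(2)[OF ij(1)] car(1)[OF ij(2)] zero_carrier_mat car(2)[OF ij(2)]]
        mult_block_upper_triangular[OF car(1)[OF ij(2)] zero_carrier_mat car(2)[OF ij(2)] car(1)[OF ij(1)] zero_carrier_mat car(2)[OF ij(1)]]
      using car[OF ij(1)] car[OF ij(2)] by simp
  qed
  ultimately show ?thesis using len by (simp add: commuting_tuples_iff_nth)
qed

lemma commuting_tuples_poly_eval:
  fixes As :: "'a::comm_ring_1 poly mat list"
  assumes As: "As \<in> commuting_tuples l n"
  shows "map (map_mat (\<lambda>p. poly p t)) As \<in> commuting_tuples l n"
proof -
  have hom: "semiring_hom (\<lambda>p :: 'a poly. poly p t)" by unfold_locales simp_all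
  note ct = commuting_tuplesD[OF As]
  have "map_mat (\<lambda>p. poly p t) A \<in> GL_mat n" if A: "A \<in> set As" for A
  proof -
    obtain B where B: "A \<in> carrier_mat n n" "B \<in> carrier_mat n n" "A * B = 1\<^sub>m n" "B * A = 1\<^sub>m n"
      using ct(2)[OF A] by (auto simp: GL_mat_iff)
    thus ?thesis unfolding GL_mat_iff
      using semiring_hom.mat_hom_mult[OF hom B(1,2)] semiring_hom.mat_hom_mult[OF hom B(2,1)] semiring_hom.mat_hom_one[OF hom, of n]
      by (intro conjI bexI[of _ "map_mat (\<lambda>p. poly p t) B"]) auto
  qed
  moreover have "map_mat (\<lambda>p. poly p t) A * map_mat (\<lambda>p. poly p t) B =
      map_mat (\<lambda>p. poly p t) B * map_mat (\<lambda>p. poly p t) A" if "A \<in> set As" "B \<in> set As" for A B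
    using semiring_hom.mat_hom_mult[OF hom ct(3)[OF that(1)] ct(3)[OF that(2)]]
      semiring_hom.mat_hom_mult[OF hom ct(3)[OF that(2)] ct(3)[OF that(1)]] ct(4)[OF that] by simp
  ultimately show ?thesis using ct(1) by (auto simp: commuting_tuples_def)
qed

text \<open>Evaluation at real \<open>t\<close> is a continuous path in the space of commuting tuples, along which the
  parity is continuous with finitely many values.\<close>

lemma parity_homotopy:
  assumes As: "As \<in> commuting_tuples l n" and n: "n \<ge> 1" and l: "l \<ge> 1"
  shows "negative_parity (map (map_mat (\<lambda>p. poly p 0)) As) = negative_parity (map (map_mat (\<lambda>p. poly p 1)) As)"
proof -
  define \<gamma> where "\<gamma> t = map (map_mat (\<lambda>p. poly p t)) As" for t :: real
  have path: "\<gamma> t \<in> commuting_tuples l n" for t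
    unfolding \<gamma>_def by (rule commuting_tuples_poly_eval[OF As])
  have "continuous_on UNIV (\<lambda>t. parity_determinant l (\<gamma> t))"
  proof (rule continuous_on_along_path[OF continuous_on_parity_determinant[OF l] n path])
    fix i r c assume irc: "i < l" "r < n" "c < n"
    have "(\<gamma> t ! i) $$ (r, c) = poly ((As ! i) $$ (r, c)) t" for t
      using irc commuting_tuples_nthD[OF As irc(1)] commuting_tuplesD(1)[OF As] by (simp add: \<gamma>_def)
    thus "continuous_on UNIV (\<lambda>t. (\<gamma> t ! i) $$ (r, c))" by (simp add: continuous_on_poly)
  qed
  hence cont: "continuous_on UNIV (\<lambda>t. negative_parity (\<gamma> t))"
    using parity_determinant_eq[OF path n] by simp
  have "range (\<lambda>t. negative_parity (\<gamma> t)) \<subseteq> {1, -1}"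
    using negative_parity_values[OF path l n] by auto
  hence "finite (range (\<lambda>t. negative_parity (\<gamma> t)))" by (rule finite_subset) simp
  with cont have "(\<lambda>t. negative_parity (\<gamma> t)) constant_on UNIV"
    by (intro continuous_finite_range_constant) auto
  thus ?thesis by (auto simp: constant_on_def \<gamma>_def)
qed

theorem joint_determinant_parity:
  assumes l: "l \<ge> 1"
  shows "joint_determinant l (parity_determinant l)"
  unfolding joint_determinant_def
proof (intro conjI allI impI ballI)
  show "parity_determinant l \<in> all_commuting_tuples l \<rightarrow>\<^sub>E - {0}"
    using negative_parity_values[OF _ l]
    by (fastforce simp: parity_determinant_def all_commuting_tuples_def)
next
  fix n i and As :: "real mat list" and B assume "n \<ge> 1" "i < l" "B # As \<in> commuting_tuples (Suc l) n"
  thus "parity_determinant l (As[i := As ! i * B]) = parity_determinant l As * parity_determinant l (As[i := B])"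
    using parity_multilinear[of B As l n i] by (simp add: parity_determinant_eq)
next
  fix m n and As Bs :: "real mat list"
  assume mn: "m \<ge> 1" "n \<ge> 1" and A: "As \<in> commuting_tuples l m" and B: "Bs \<in> commuting_tuples l n"
  obtain L where L: "joint_spectrum m As L" using ex_joint_spectrum[OF A mn(1)] by blast
  obtain M where M: "joint_spectrum n Bs M" using ex_joint_spectrum[OF B mn(2)] by blast
  have "joint_spectrum (m + n) (map2 direct_sum_mat As Bs) (L @ M)"
    unfolding direct_sum_eq_extension[OF A B]
    using commuting_tuples_nthD[OF A] commuting_tuples_nthD[OF B] L M
      commuting_tuplesD(1)[OF A] commuting_tuplesD(1)[OF B]
    by (intro joint_spectrum_extension) auto
  from negative_parity_eq[OF direct_sum_commuting_tuples[OF A B] l this]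
  show "parity_determinant l (map2 direct_sum_mat As Bs) = parity_determinant l As * parity_determinant l Bs"
    using mn direct_sum_commuting_tuples[OF A B] A B
    by (simp add: parity_determinant_eq negative_parity_eq[OF A l L] negative_parity_eq[OF B l M])
next
  fix n and As :: "real mat list" and S T :: "real mat"
  assume n: "n \<ge> 1" and A: "As \<in> commuting_tuples l n" and S: "S \<in> carrier_mat n n" "T \<in> carrier_mat n n"
    and ST: "S * T = 1\<^sub>m n \<and> T * S = 1\<^sub>m n"
  obtain L where L: "joint_spectrum n As L" using ex_joint_spectrum[OF A n] by blast
  have ct: "map (\<lambda>A. S * A * T) As \<in> commuting_tuples l n"
    using ST by (intro commuting_tuples_conjugate S A) auto
  have "joint_spectrum n (map (\<lambda>A. S * A * T) As) L"
    using ST commuting_tuplesD(3)[OF A] by (intro joint_spectrum_conjugate S L) auto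
  thus "parity_determinant l (map (\<lambda>A. S * A * T) As) = parity_determinant l As"
    using n ct A negative_parity_eq[OF A l L] negative_parity_eq[OF ct l] by (simp add: parity_determinant_eq)
next
  fix n and As :: "real poly mat list" assume n: "n \<ge> 1" and A: "As \<in> commuting_tuples l n"
  show "parity_determinant l (map (map_mat (\<lambda>p. poly p 0)) As) =
      parity_determinant l (map (map_mat (\<lambda>p. poly p 1)) As)"
    unfolding parity_determinant_eq[OF commuting_tuples_poly_eval[OF A] n] by (rule parity_homotopy[OF A n l])
qed

lemma parity_determinant_minus_one:
  assumes l: "l \<ge> 1"
  shows "parity_determinant l (map scalar_block (replicate l (-1))) = -1"
proof -
  have ct: "map scalar_block (replicate l (-1 :: real)) \<in> commuting_tuples l 1"
    unfolding scalar_tuple_iff by simp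
  have "all_negative (map of_real (replicate l (-1)))" by (auto simp: all_negative_def)
  thus ?thesis
    using parity_determinant_eq[OF ct] negative_parity_eq[OF ct l joint_spectrum_scalar]
    by (simp add: neg_sign_def)
qed

section \<open>Symbols\<close>

text \<open>On rationals \<open>h\<close> is a positive root of unity, and rationals are dense. It serves both for powers of a
  positive number and for the unit circle.\<close>

lemma continuous_character_trivial:
  fixes h :: "real \<Rightarrow> real"
  assumes cont: "continuous_on UNIV h" and add: "\<And>r s. h (r + s) = h r * h s"
    and nz: "\<And>r. h r \<noteq> 0" and one: "h 1 = 1"
  shows "h r = 1"
proof -
  have pos: "h r > 0" for r
  proof -
    have "h r = h (r / 2) * h (r / 2)" by (subst add[symmetric]) simp
    thus ?thesis using nz[of "r / 2"] by (simp add: zero_less_mult_iff) linarith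
  qed
  have h0: "h 0 = 1" using add[of 0 1] one nz by simp
  have mult: "h (real k * r) = h r ^ k" for k r
    by (induction k) (simp_all add: h0 add algebra_simps)
  have rat: "h q = 1" if q: "q \<in> \<rat>" for q
  proof -
    obtain m k :: nat where mk: "k \<noteq> 0" "\<bar>q\<bar> = real m / real k"
      using Rats_abs_nat_div_natE[OF q] by metis
    have "real k * \<bar>q\<bar> = real m * 1" using mk by simp
    hence "h \<bar>q\<bar> ^ k = 1" using mult[of k "\<bar>q\<bar>"] mult[of m 1] one by simp
    hence "h \<bar>q\<bar> = 1"
      using pos[of "\<bar>q\<bar>"] mk(1) power_eq_imp_eq_base[of "h \<bar>q\<bar>" k 1] by simp
    moreover have "h (-\<bar>q\<bar>) * h \<bar>q\<bar> = 1" using add[of "-\<bar>q\<bar>" "\<bar>q\<bar>"] h0 by simp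
    ultimately show ?thesis by (cases "q \<ge> 0") auto
  qed
  have "closed {r. h r = 1}"
    using continuous_closed_preimage_constant[OF cont closed_UNIV, of 1] by simp
  hence "open (- {r. h r = 1})" by (simp add: open_Compl)
  show ?thesis
  proof (rule ccontr)
    assume "h r \<noteq> 1"
    then obtain e where e: "e > 0" "ball r e \<subseteq> - {r. h r = 1}"
      using \<open>open (- {r. h r = 1})\<close> open_contains_ball[of "- {r. h r = 1}"] by auto
    obtain q where "q \<in> \<rat>" "r < q" "q < r + e" using Rats_dense_in_real[of r "r + e"] e(1) by auto
    thus False using e(2) rat[of q] by (auto simp: dist_real_def subset_iff)
  qed
qed

text \<open>The part of a joint determinant that lives on tuples of field elements, abstracted from the
  matrices representing them.\<close>

locale symbol =
  fixes l :: nat and f :: "'a::field list \<Rightarrow> real"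
  assumes nonzero: "length xs = l \<Longrightarrow> 0 \<notin> set xs \<Longrightarrow> f xs \<noteq> 0"
    and mult: "length xs = l \<Longrightarrow> 0 \<notin> set xs \<Longrightarrow> i < l \<Longrightarrow> a \<noteq> 0 \<Longrightarrow> b \<noteq> 0 \<Longrightarrow>
      f (xs[i := a * b]) = f (xs[i := a]) * f (xs[i := b])"
begin

lemma update_nonzero: "0 \<notin> set xs \<Longrightarrow> a \<noteq> 0 \<Longrightarrow> 0 \<notin> set (xs[i := a])"
  using set_update_subset_insert[of xs i a] by auto

lemma one: "length xs = l \<Longrightarrow> 0 \<notin> set xs \<Longrightarrow> i < l \<Longrightarrow> f (xs[i := 1]) = 1"
  using mult[of xs i 1 1] nonzero[of "xs[i := 1]"] update_nonzero[of xs 1 i] by simp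

lemma inverse: "length xs = l \<Longrightarrow> 0 \<notin> set xs \<Longrightarrow> i < l \<Longrightarrow> a \<noteq> 0 \<Longrightarrow>
    f (xs[i := a]) * f (xs[i := inverse a]) = 1"
  using mult[of xs i a "inverse a"] one[of xs i] by simp

lemma square: "length xs = l \<Longrightarrow> 0 \<notin> set xs \<Longrightarrow> i < l \<Longrightarrow> a \<noteq> 0 \<Longrightarrow>
    f (xs[i := a\<^sup>2]) = (f (xs[i := a]))\<^sup>2"
  using mult[of xs i a a] by (simp add: power2_eq_square)

lemma square_slot_positive:
  assumes "length xs = l" "0 \<notin> set xs" "i < l" "a \<noteq> 0"
  shows "f (xs[i := a\<^sup>2]) > 0"
  unfolding square[OF assms] using assms nonzero[of "xs[i := a]"] update_nonzero[of xs a i] by simp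

text \<open>Both squares are pulled out as the square of one and the same value, so the square may change
  slots, where it turns \<open>-1\<close> into 1.\<close>

lemma minus_one_square:
  assumes xs: "length xs = l" "0 \<notin> set xs" and ij: "i < l" "j < l" "i \<noteq> j" and a: "a \<noteq> 0"
  shows "f (xs[i := -1, j := a\<^sup>2]) = 1"
proof -
  have v: "0 \<notin> set (xs[i := -1])" "0 \<notin> set (xs[j := a])"
    using update_nonzero xs(2) a by (metis neg_equal_0_iff_equal zero_neq_one)+
  have "f (xs[i := -1, j := a\<^sup>2]) = (f (xs[i := -1, j := a]))\<^sup>2"
    using xs v(1) ij a by (intro square) auto
  also have "xs[i := -1, j := a] = xs[j := a, i := -1]" using ij by (simp add: list_update_swap)
  also have "(f (xs[j := a, i := -1]))\<^sup>2 = f (xs[j := a, i := (-1)\<^sup>2])"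
    using xs v(2) ij by (intro square[symmetric]) auto
  also have "\<dots> = 1" using one[of "xs[j := a]" i] xs v(2) ij by simp
  finally show ?thesis .
qed

end

text \<open>Triviality on positive arguments leaves only the signs of the entries, which form a group of
  exponent two.\<close>

locale real_symbol = symbol l f for l and f :: "real list \<Rightarrow> real" +
  assumes positive: "length xs = l \<Longrightarrow> (\<forall>x\<in>set xs. x > 0) \<Longrightarrow> f xs = 1"
begin

text \<open>Negative entries are flipped one at a time; the \<open>-1\<close> split off is absorbed by the positive entry
  \<open>xs ! j\<close>, a square.\<close>

lemma some_positive:
  assumes "length xs = l" "0 \<notin> set xs" "j < l" "xs ! j > 0"
  shows "f xs = 1"
  using assms
proof (induction "card {i. i < l \<and> xs ! i < 0}" arbitrary: xs rule: less_induct)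
  case less
  show ?case
  proof (cases "\<exists>i<l. xs ! i < 0")
    case False
    hence "\<forall>x\<in>set xs. x > 0" using less.prems by (auto simp: in_set_conv_nth) (metis linorder_neqE nth_mem)
    thus ?thesis using positive less.prems by simp
  next
    case True
    then obtain i where i: "i < l" "xs ! i < 0" by blast
    hence ij: "i \<noteq> j" using less.prems by auto
    let ?ys = "xs[i := - xs ! i]"
    have "f (xs[i := -1]) = f (xs[i := -1, j := (sqrt (xs ! j))\<^sup>2])"
      using less.prems ij by (simp add: list_update_swap[of i j])
    also have "\<dots> = 1" using less.prems i ij by (intro minus_one_square) auto
    finally have minus: "f (xs[i := -1]) = 1" .
    have "{k. k < l \<and> ?ys ! k < 0} = {k. k < l \<and> xs ! k < 0} - {i}"
      using i less.prems(1) by (auto simp: nth_list_update)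
    hence "card {k. k < l \<and> ?ys ! k < 0} < card {k. k < l \<and> xs ! k < 0}"
      using i by (simp only:) (rule card_Diff1_less, auto)
    hence "f ?ys = 1"
      using less.hyps[of ?ys] less.prems i ij update_nonzero[of xs "- xs ! i" i] by simp
    moreover have "f xs = f (xs[i := -1]) * f ?ys"
      using mult[of xs i "-1" "- xs ! i"] less.prems i by simp
    ultimately show ?thesis using minus by simp
  qed
qed

text \<open>Replacing an entry by \<open>-1\<close> costs the value at a tuple with a positive entry, which is 1.\<close>

lemma all_negative_value:
  assumes "l \<ge> 2" "length xs = l" "\<forall>x\<in>set xs. x < 0"
  shows "f xs = f (replicate l (-1))"
  using assms(2,3)
proof (induction "card {i. i < l \<and> xs ! i \<noteq> -1}" arbitrary: xs rule: less_induct)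
  case less
  show ?case
  proof (cases "\<exists>i<l. xs ! i \<noteq> -1")
    case False
    hence "xs = replicate l (-1)" using less.prems by (intro nth_equalityI) auto
    thus ?thesis by simp
  next
    case True
    then obtain i where i: "i < l" "xs ! i \<noteq> -1" by blast
    have neg: "xs ! i < 0" using less.prems i by simp
    have nz: "0 \<notin> set xs" using less.prems by auto
    have nz': "0 \<notin> set (xs[i := - xs ! i])" using neg nz by (intro update_nonzero) auto
    let ?ys = "xs[i := -1]"
    have "{k. k < l \<and> ?ys ! k \<noteq> -1} = {k. k < l \<and> xs ! k \<noteq> -1} - {i}"
      using i less.prems(1) by (auto simp: nth_list_update)
    hence "card {k. k < l \<and> ?ys ! k \<noteq> -1} < card {k. k < l \<and> xs ! k \<noteq> -1}"
      using i by (simp only:) (rule card_Diff1_less, auto)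
    moreover have "\<forall>x\<in>set ?ys. x < 0" using less.prems set_update_subset_insert[of xs i "-1"] by auto
    ultimately have "f ?ys = f (replicate l (-1))" using less.hyps[of ?ys] less.prems by simp
    moreover have "f (xs[i := - xs ! i]) = 1"
      using less.prems i neg nz' by (intro some_positive[of _ i]) auto
    moreover have "f xs = f ?ys * f (xs[i := - xs ! i])"
      using mult[of xs i "-1" "- xs ! i"] less.prems(1) nz i neg by simp
    ultimately show ?thesis by simp
  qed
qed

lemma minus_one_value:
  assumes "l \<ge> 2"
  shows "f (replicate l (-1)) = 1 \<or> f (replicate l (-1)) = -1"
proof -
  have "(f ((replicate l (-1))[0 := -1]))\<^sup>2 = f ((replicate l (-1))[0 := (-1)\<^sup>2])"
    using assms by (intro square[symmetric]) auto
  also have "\<dots> = 1" using one[of "replicate l (-1)" 0] assms by simp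
  also have "(replicate l (-1 :: real))[0 := -1] = replicate l (-1)"
    using assms by (intro nth_equalityI) (auto simp: nth_list_update)
  finally show ?thesis by (simp add: power2_eq_1_iff)
qed

lemma trivial_unless_all_negative:
  assumes "length xs = l" "0 \<notin> set xs" "\<not> (\<forall>x\<in>set xs. x < 0)"
  shows "f xs = 1"
proof -
  obtain x where x: "x \<in> set xs" "\<not> x < 0" using assms by blast
  moreover have "x \<noteq> 0" using x assms by auto
  ultimately obtain j where "j < l" "xs ! j > 0" using assms(1) by (auto simp: in_set_conv_nth)
  thus ?thesis using some_positive assms by blast
qed

end

section \<open>Uniqueness\<close>

definition mat2 :: "'a \<Rightarrow> 'a \<Rightarrow> 'a \<Rightarrow> 'a \<Rightarrow> 'a mat" where
  "mat2 a b c d = mat 2 2 (\<lambda>(i, j). if i = 0 then (if j = 0 then a else b) else (if j = 0 then c else d))"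

lemma mat2_carrier [simp]: "mat2 a b c d \<in> carrier_mat 2 2"
  by (simp add: mat2_def)

lemma mat2_mult:
  "mat2 a b c d * mat2 a' b' c' d' =
    mat2 (a * a' + b * c') (a * b' + b * d') (c * a' + d * c') (c * b' + d * d' :: 'a::comm_semiring_1)"
proof -
  have two: "{0..<2::nat} = {0, 1}" by auto
  show ?thesis by (intro eq_matI) (auto simp: mat2_def scalar_prod_def two)
qed

lemma mat2_one: "1\<^sub>m 2 = mat2 1 0 0 1"
  by (intro eq_matI) (auto simp: mat2_def less_2_cases_iff)

lemma map_mat_mat2: "map_mat h (mat2 a b c d) = mat2 (h a) (h b) (h c) (h d)"
  by (intro eq_matI) (auto simp: mat2_def)

lemma direct_sum_scalar_block: "direct_sum_mat (scalar_block a) (scalar_block b) = mat2 a 0 0 b"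
  by (intro eq_matI) (auto simp: mat2_def direct_sum_mat_def scalar_block_def less_2_cases_iff)

lemma complex_block_of_real: "complex_block (of_real r) = mat2 r 0 0 r"
  by (intro eq_matI) (auto simp: mat2_def complex_block_def less_2_cases_iff)

text \<open>Invertibility over a commutative ring, by the adjugate matrix; needed over polynomials.\<close>

lemma GL_mat_of_unit_det:
  fixes A :: "'a::comm_ring_1 mat"
  assumes A: "A \<in> carrier_mat n n" and u: "u * det A = 1"
  shows "A \<in> GL_mat n"
proof -
  note adj = adj_mat[OF A]
  have "A * (u \<cdot>\<^sub>m adj_mat A) = 1\<^sub>m n"
    using u by (intro eq_matI) (simp_all add: mult_smult_distrib[OF A adj(1)] adj(2))
  moreover have "(u \<cdot>\<^sub>m adj_mat A) * A = 1\<^sub>m n"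
    using u by (intro eq_matI) (simp_all add: mult_smult_assoc_mat[OF adj(1) A] adj(3))
  ultimately show ?thesis using A adj(1) by (auto simp: GL_mat_iff intro!: bexI[of _ "u \<cdot>\<^sub>m adj_mat A"])
qed

text \<open>The polynomial homotopy from \<open>M \<oplus> C\<close> at 0 to the block triangular matrix with off-diagonal block \<open>R\<close>
  at 1. It is conjugation by \<open>diag(t, 1)\<close> with its denominator removed, which is why it is
  multiplicative.\<close>

definition scaled_off_diagonal :: "'a::comm_ring_1 mat \<Rightarrow> 'a mat \<Rightarrow> 'a mat \<Rightarrow> 'a poly mat" where
  "scaled_off_diagonal M R C = four_block_mat (map_mat (\<lambda>a. [:a:]) M)
     ([:0, 1:] \<cdot>\<^sub>m map_mat (\<lambda>a. [:a:]) R) (0\<^sub>m (dim_row C) (dim_col M)) (map_mat (\<lambda>a. [:a:]) C)"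

lemma scaled_off_diagonal_eval:
  assumes "M \<in> carrier_mat m m" "R \<in> carrier_mat m k" "C \<in> carrier_mat k k"
  shows "map_mat (\<lambda>p. poly p t) (scaled_off_diagonal M R C) = four_block_mat M (t \<cdot>\<^sub>m R) (0\<^sub>m k m) C"
  using assms by (intro eq_matI) (auto simp: scaled_off_diagonal_def)

lemma scaled_off_diagonal_mult:
  fixes M :: "'a::comm_ring_1 mat"
  assumes c: "M \<in> carrier_mat m m" "R \<in> carrier_mat m k" "C \<in> carrier_mat k k"
    "M' \<in> carrier_mat m m" "R' \<in> carrier_mat m k" "C' \<in> carrier_mat k k"
  shows "scaled_off_diagonal M R C * scaled_off_diagonal M' R' C' =
    scaled_off_diagonal (M * M') (M * R' + R * C') (C * C')"
proof -
  let ?c = "map_mat (\<lambda>a :: 'a. [:a:])"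
  have hom: "semiring_hom (\<lambda>a :: 'a. [:a:])" by unfold_locales simp_all
  note hmult = semiring_hom.mat_hom_mult[OF hom]
  have "scaled_off_diagonal M R C * scaled_off_diagonal M' R' C' =
      four_block_mat (?c M * ?c M') (?c M * ([:0, 1:] \<cdot>\<^sub>m ?c R') + ([:0, 1:] \<cdot>\<^sub>m ?c R) * ?c C') (0\<^sub>m k m) (?c C * ?c C')"
    using c mult_block_upper_triangular[of "?c M" m "[:0, 1:] \<cdot>\<^sub>m ?c R" k "?c C" "?c M'" "[:0, 1:] \<cdot>\<^sub>m ?c R'" "?c C'"]
    by (simp add: scaled_off_diagonal_def)
  also have "?c M * ([:0, 1:] \<cdot>\<^sub>m ?c R') = [:0, 1:] \<cdot>\<^sub>m ?c (M * R')"
    using c by (subst mult_smult_distrib[of _ m m _ k]) (simp_all add: hmult[of _ m m _ k])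
  also have "([:0, 1:] \<cdot>\<^sub>m ?c R) * ?c C' = [:0, 1:] \<cdot>\<^sub>m ?c (R * C')"
    using c by (subst mult_smult_assoc_mat[of _ m k _ k]) (simp_all add: hmult[of _ m k _ k])
  also have "[:0, 1:] \<cdot>\<^sub>m ?c (M * R') + [:0, 1:] \<cdot>\<^sub>m ?c (R * C') = [:0, 1:] \<cdot>\<^sub>m ?c (M * R' + R * C')"
    using c by (intro eq_matI) auto
  also have "?c M * ?c M' = ?c (M * M')" using hmult[OF c(1,4)] by simp
  also have "?c C * ?c C' = ?c (C * C')" using hmult[OF c(3,6)] by simp
  finally show ?thesis using c by (simp add: scaled_off_diagonal_def)
qed

lemma scaled_off_diagonal_GL:
  fixes M :: "'a::field mat"
  assumes c: "M \<in> carrier_mat m m" "R \<in> carrier_mat m k" "C \<in> carrier_mat k k"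
    and d: "det M \<noteq> 0" "det C \<noteq> 0"
  shows "scaled_off_diagonal M R C \<in> GL_mat (m + k)"
proof (rule GL_mat_of_unit_det)
  show "scaled_off_diagonal M R C \<in> carrier_mat (m + k) (m + k)"
    using c by (auto simp: scaled_off_diagonal_def)
  have hom: "comm_ring_hom (\<lambda>a :: 'a. [:a:])" by unfold_locales simp_all
  have "det (scaled_off_diagonal M R C) = [:det M:] * [:det C:]"
    using c det_four_block_mat_lower_left_zero[of "map_mat (\<lambda>a. [:a:]) M" m
        "[:0, 1:] \<cdot>\<^sub>m map_mat (\<lambda>a. [:a:]) R" k "0\<^sub>m k m" "map_mat (\<lambda>a. [:a:]) C"]
    by (simp add: scaled_off_diagonal_def comm_ring_hom.hom_det[OF hom] del: mult_pCons_left mult_pCons_right)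
  thus "[:inverse (det M * det C):] * det (scaled_off_diagonal M R C) = 1"
    using d by (simp add: field_simps one_pCons)
qed

locale continuous_joint_determinant =
  fixes l :: nat and D :: "real mat list \<Rightarrow> real"
  assumes l2: "l \<ge> 2" and joint: "joint_determinant l D" and continuous: "continuous_on_tuples l D"
begin

lemma D_nonzero: "As \<in> commuting_tuples l n \<Longrightarrow> n \<ge> 1 \<Longrightarrow> D As \<noteq> 0"
  using joint by (fastforce simp: joint_determinant_def all_commuting_tuples_def)

lemma D_mult: "B # As \<in> commuting_tuples (Suc l) n \<Longrightarrow> n \<ge> 1 \<Longrightarrow> i < l \<Longrightarrow>
    D (As[i := As ! i * B]) = D As * D (As[i := B])"
  using joint by (simp add: joint_determinant_def)

lemma D_direct_sum: "As \<in> commuting_tuples l m \<Longrightarrow> Bs \<in> commuting_tuples l n \<Longrightarrow> m \<ge> 1 \<Longrightarrow> n \<ge> 1 \<Longrightarrow>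
    D (map2 direct_sum_mat As Bs) = D As * D Bs"
  using joint by (simp add: joint_determinant_def)

lemma D_similar: "As \<in> commuting_tuples l n \<Longrightarrow> n \<ge> 1 \<Longrightarrow> S \<in> carrier_mat n n \<Longrightarrow> T \<in> carrier_mat n n \<Longrightarrow>
    S * T = 1\<^sub>m n \<Longrightarrow> T * S = 1\<^sub>m n \<Longrightarrow> D (map (\<lambda>A. S * A * T) As) = D As"
  using joint by (simp add: joint_determinant_def)

lemma D_homotopy: "As \<in> commuting_tuples l n \<Longrightarrow> n \<ge> 1 \<Longrightarrow>
    D (map (map_mat (\<lambda>p. poly p 0)) As) = D (map (map_mat (\<lambda>p. poly p 1)) As)"
  using joint by (simp add: joint_determinant_def)

text \<open>The off-diagonal blocks are scaled to zero by a polynomial homotopy.\<close>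

lemma D_extension:
  assumes Ms: "Ms \<in> commuting_tuples l m" and Cs: "Cs \<in> commuting_tuples l k" and mk: "m \<ge> 1" "k \<ge> 1"
    and R: "\<And>i. i < l \<Longrightarrow> Rs ! i \<in> carrier_mat m k"
    and X: "block_extension l Ms Rs Cs \<in> commuting_tuples l (m + k)"
  shows "D (block_extension l Ms Rs Cs) = D Ms * D Cs"
proof -
  note M = commuting_tuples_nthD[OF Ms] and C = commuting_tuples_nthD[OF Cs]
  have len: "length Ms = l" "length Cs = l" using Ms Cs by (auto simp: commuting_tuples_def)
  have X_nth: "block_extension l Ms Rs Cs ! i = four_block_mat (Ms ! i) (Rs ! i) (0\<^sub>m k m) (Cs ! i)"
    if "i < l" for i using that M[OF that] C[OF that] by (simp add: nth_block_extension)
  define H where "H = map (\<lambda>i. scaled_off_diagonal (Ms ! i) (Rs ! i) (Cs ! i)) [0..<l]"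
  have "H ! i \<in> GL_mat (m + k)" if i: "i < l" for i
    using i Ms Cs scaled_off_diagonal_GL[OF M R C, of i i i]
    by (simp add: H_def commuting_tuples_iff_nth GL_mat_iff_det)
  moreover have "H ! i * H ! j = H ! j * H ! i" if i: "i < l" and j: "j < l" for i j
  proof -
    have "four_block_mat (Ms ! i * Ms ! j) (Ms ! i * Rs ! j + Rs ! i * Cs ! j) (0\<^sub>m k m) (Cs ! i * Cs ! j) =
      four_block_mat (Ms ! j * Ms ! i) (Ms ! j * Rs ! i + Rs ! j * Cs ! i) (0\<^sub>m k m) (Cs ! j * Cs ! i)"
      using X i j by (simp add: commuting_tuples_iff_nth X_nth
          mult_block_upper_triangular[OF M[OF i] R[OF i] C[OF i] M[OF j] R[OF j] C[OF j], symmetric]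
          mult_block_upper_triangular[OF M[OF j] R[OF j] C[OF j] M[OF i] R[OF i] C[OF i], symmetric])
    from four_block_mat_inject[OF mult_carrier_mat[OF M[OF i] M[OF j]] mult_carrier_mat[OF M[OF j] M[OF i]]
        add_carrier_mat[OF mult_carrier_mat[OF R[OF i] C[OF j]]]
        add_carrier_mat[OF mult_carrier_mat[OF R[OF j] C[OF i]]]
        mult_carrier_mat[OF C[OF i] C[OF j]] mult_carrier_mat[OF C[OF j] C[OF i]] this]
    show ?thesis using i j
      by (simp add: H_def scaled_off_diagonal_mult[OF M[OF i] R[OF i] C[OF i] M[OF j] R[OF j] C[OF j]]
          scaled_off_diagonal_mult[OF M[OF j] R[OF j] C[OF j] M[OF i] R[OF i] C[OF i]])
  qed
  ultimately have H: "H \<in> commuting_tuples l (m + k)" by (simp add: commuting_tuples_iff_nth H_def)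
  have eval: "map (map_mat (\<lambda>p. poly p t)) H =
      map (\<lambda>i. four_block_mat (Ms ! i) (t \<cdot>\<^sub>m (Rs ! i)) (0\<^sub>m k m) (Cs ! i)) [0..<l]" for t
    using scaled_off_diagonal_eval[OF M R C] by (simp add: H_def)
  have "map (map_mat (\<lambda>p. poly p 0)) H = map2 direct_sum_mat Ms Cs"
  proof (rule nth_equalityI)
    fix i assume "i < length (map (map_mat (\<lambda>p. poly p 0)) H)"
    hence i: "i < l" by (simp add: H_def)
    have "0 \<cdot>\<^sub>m (Rs ! i) = 0\<^sub>m m k" using R[OF i] by (intro eq_matI) auto
    thus "map (map_mat (\<lambda>p. poly p 0)) H ! i = map2 direct_sum_mat Ms Cs ! i"
      using i len M[OF i] C[OF i] by (simp add: eval direct_sum_mat_def)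
  qed (simp add: H_def len)
  moreover have "map (map_mat (\<lambda>p. poly p 1)) H = block_extension l Ms Rs Cs"
  proof (rule nth_equalityI)
    fix i assume "i < length (map (map_mat (\<lambda>p. poly p 1)) H)"
    hence i: "i < l" by (simp add: H_def)
    have "1 \<cdot>\<^sub>m (Rs ! i) = Rs ! i" using R[OF i] by (intro eq_matI) auto
    thus "map (map_mat (\<lambda>p. poly p 1)) H ! i = block_extension l Ms Rs Cs ! i"
      using i X_nth[OF i] by (simp add: eval)
  qed (simp add: H_def)
  ultimately show ?thesis using D_homotopy[OF H] D_direct_sum[OF Ms Cs mk] mk by simp
qed

definition scalar_symbol :: "real list \<Rightarrow> real" where
  "scalar_symbol xs = D (map scalar_block xs)"

definition complex_symbol :: "complex list \<Rightarrow> real" where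
  "complex_symbol zs = D (map complex_block zs)"

lemma symbol_of_blocks:
  fixes \<phi> :: "'a::field \<Rightarrow> real mat"
  assumes hom: "\<And>a b. \<phi> (a * b) = \<phi> a * \<phi> b" and n: "n \<ge> 1"
    and tuple: "\<And>l xs. map \<phi> xs \<in> commuting_tuples l n \<longleftrightarrow> length xs = l \<and> 0 \<notin> set xs"
  shows "symbol l (\<lambda>xs. D (map \<phi> xs))"
proof
  fix xs :: "'a list" assume "length xs = l" "0 \<notin> set xs"
  thus "D (map \<phi> xs) \<noteq> 0" by (intro D_nonzero[OF _ n]) (simp add: tuple)
next
  fix xs :: "'a list" and i and a b :: 'a
  assume xs: "length xs = l" "0 \<notin> set xs" "i < l" "a \<noteq> 0" "b \<noteq> 0"
  have "0 \<notin> set (b # xs[i := a])" using xs set_update_subset_insert[of xs i a] by auto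
  hence "map \<phi> (b # xs[i := a]) \<in> commuting_tuples (Suc l) n" unfolding tuple using xs by simp
  hence "\<phi> b # map \<phi> (xs[i := a]) \<in> commuting_tuples (Suc l) n" by simp
  from D_mult[OF this n xs(3)] show "D (map \<phi> (xs[i := a * b])) = D (map \<phi> (xs[i := a])) * D (map \<phi> (xs[i := b]))"
    using xs by (simp add: hom map_update)
qed

sublocale scalar: symbol l scalar_symbol
  unfolding scalar_symbol_def
  by (rule symbol_of_blocks[where n = 1]) (simp_all only: scalar_block_mult scalar_tuple_iff order_refl)

sublocale complex: symbol l complex_symbol
  unfolding complex_symbol_def
  by (rule symbol_of_blocks[where n = 2]) (simp_all add: complex_block_mult complex_tuple_iff)

lemma D_diagonal:
  assumes "length xs = l" "0 \<notin> set xs" "length ys = l" "0 \<notin> set ys"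
  shows "D (map2 (\<lambda>x y. mat2 x 0 0 y) xs ys) = scalar_symbol xs * scalar_symbol ys"
    "map2 (\<lambda>x y. mat2 x 0 0 y) xs ys \<in> commuting_tuples l 2"
proof -
  have eq: "map2 direct_sum_mat (map scalar_block xs) (map scalar_block ys) = map2 (\<lambda>x y. mat2 x 0 0 y) xs ys"
    using assms by (intro nth_equalityI) (simp_all add: direct_sum_scalar_block)
  have ct: "map scalar_block xs \<in> commuting_tuples l 1" "map scalar_block ys \<in> commuting_tuples l 1"
    unfolding scalar_tuple_iff using assms by auto
  show "D (map2 (\<lambda>x y. mat2 x 0 0 y) xs ys) = scalar_symbol xs * scalar_symbol ys"
    using D_direct_sum[OF ct] by (simp add: eq scalar_symbol_def)
  show "map2 (\<lambda>x y. mat2 x 0 0 y) xs ys \<in> commuting_tuples l 2"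
    using direct_sum_commuting_tuples[OF ct] by (simp add: eq numeral_2_eq_2)
qed

text \<open>The companion matrix of \<open>(X - x)(X - 1/x)\<close> is diagonalisable with eigenvalues \<open>x\<close> and \<open>1/x\<close>, and
  inverting both of the first two entries leaves the value of the symbol unchanged.\<close>

lemma D_companion:
  assumes ys: "length ys = l - 2" "0 \<notin> set ys" and x: "x \<noteq> 0" "x \<noteq> inverse x"
  shows "D (mat2 0 (-1) 1 (x + inverse x) # mat2 0 (-1) 1 (x + inverse x) # map (\<lambda>y. mat2 y 0 0 y) ys) =
    (scalar_symbol (x # x # ys))\<^sup>2"
proof -
  \<comment> \<open>The columns of \<open>S\<close> are the eigenvectors for \<open>x\<close> and \<open>1/x\<close>; \<open>T\<close> is the inverse of \<open>S\<close>.\<close>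
  define S where "S = mat2 1 1 (-x) (- inverse x)"
  define d where "d = inverse (x - inverse x)"
  define T where "T = mat2 (- inverse x * d) (- d) (x * d) d"
  have d: "x * d - inverse x * d = 1" using x by (simp add: d_def left_diff_distrib[symmetric])
  have "S * T = mat2 (x * d - inverse x * d) 0 0 (x * d - inverse x * d)"
    "T * S = mat2 (x * d - inverse x * d) 0 0 (x * d - inverse x * d)"
    unfolding S_def T_def mat2_mult by (simp_all add: algebra_simps)
  hence ST: "S * T = 1\<^sub>m 2" "T * S = 1\<^sub>m 2" unfolding d mat2_one .
  have S: "S \<in> carrier_mat 2 2" and T: "T \<in> carrier_mat 2 2" by (simp_all add: S_def T_def)
  define As where "As = map2 (\<lambda>x y. mat2 x 0 0 y) (x # x # ys) (inverse x # inverse x # ys)"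
  have len: "length (x # x # ys) = l" "length (inverse x # inverse x # ys) = l" using ys l2 by auto
  have nz: "0 \<notin> set (x # x # ys)" "0 \<notin> set (inverse x # inverse x # ys)" using x ys by auto
  note diag = D_diagonal[OF len(1) nz(1) len(2) nz(2), folded As_def]
  have 1: "S * mat2 x 0 0 (inverse x) * T = mat2 0 (-1) 1 (x + inverse x)"
  proof -
    have "S * mat2 x 0 0 (inverse x) = mat2 0 (-1) 1 (x + inverse x) * S"
      unfolding S_def mat2_mult using x by (simp add: algebra_simps)
    hence "S * mat2 x 0 0 (inverse x) * T = mat2 0 (-1) 1 (x + inverse x) * (S * T)"
      using S T by (simp add: assoc_mult_mat[of _ 2 2 _ 2 _ 2])
    thus ?thesis using ST by (simp add: right_mult_one_mat[of _ 2 2])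
  qed
  have 2: "S * mat2 y 0 0 y * T = mat2 y 0 0 y" for y
  proof -
    have "S * mat2 y 0 0 y = mat2 y 0 0 y * S"
      unfolding S_def mat2_mult by (simp add: algebra_simps)
    hence "S * mat2 y 0 0 y * T = mat2 y 0 0 y * (S * T)"
      using S T by (simp add: assoc_mult_mat[of _ 2 2 _ 2 _ 2])
    thus ?thesis using ST by (simp add: right_mult_one_mat[of _ 2 2])
  qed
  have "map2 (\<lambda>x y. mat2 x 0 0 y) ys ys = map (\<lambda>y. mat2 y 0 0 y) ys" by (simp add: zip_same_conv_map)
  hence "map (\<lambda>A. S * A * T) As =
      mat2 0 (-1) 1 (x + inverse x) # mat2 0 (-1) 1 (x + inverse x) # map (\<lambda>y. mat2 y 0 0 y) ys"
    by (simp add: As_def 1 2)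
  moreover have "scalar_symbol (inverse x # inverse x # ys) = scalar_symbol (x # x # ys)"
  proof -
    have inverse_unique': "c = a" if "a * b = 1" "b * c = 1" for a b c :: real
      using that by (metis mult.assoc mult_1 mult.right_neutral)
    have a: "scalar_symbol (x # x # ys) * scalar_symbol (inverse x # x # ys) = 1"
      using scalar.inverse[OF len(1) nz(1), of 0 x] l2 x by simp
    have "scalar_symbol (inverse x # x # ys) * scalar_symbol (inverse x # inverse x # ys) = 1"
      using scalar.inverse[of "inverse x # x # ys" 1 x] l2 x len nz by simp
    with a show ?thesis by (rule inverse_unique')
  qed
  ultimately show ?thesis
    using D_similar[OF diag(2) _ S T ST] diag(1) by (simp add: power2_eq_square)
qed

text \<open>The companion matrix of \<open>X\<^sup>2 - s X + 1\<close> has determinant 1 whatever \<open>s\<close> is, so \<open>s\<close> may move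
  linearly from \<open>a\<close> to \<open>b\<close>.\<close>

lemma companion_homotopy:
  assumes ys: "length ys = l - 2" "0 \<notin> set ys"
  shows "D (mat2 0 (-1) 1 a # mat2 0 (-1) 1 a # map (\<lambda>y. mat2 y 0 0 y) ys) =
    D (mat2 0 (-1) 1 b # mat2 0 (-1) 1 b # map (\<lambda>y. mat2 y 0 0 y) ys)"
proof -
  define P :: "real poly mat" where "P = mat2 0 (-1) 1 [:a, b - a:]"
  define H where "H = P # P # map (\<lambda>y. mat2 [:y:] 0 0 [:y:]) ys"
  have "P \<in> GL_mat 2"
    unfolding GL_mat_iff mat2_one
    by (intro conjI bexI[of _ "mat2 [:a, b - a:] 1 (-1) 0"]) (simp_all add: P_def mat2_mult one_pCons)
  moreover have "mat2 [:y:] 0 0 [:y:] \<in> GL_mat 2" if "y \<in> set ys" for y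
  proof -
    have "y \<noteq> 0" using that ys by auto
    thus ?thesis unfolding GL_mat_iff mat2_one
      by (intro conjI bexI[of _ "mat2 [:inverse y:] 0 0 [:inverse y:]"]) (simp_all add: mat2_mult one_pCons)
  qed
  ultimately have "H \<in> commuting_tuples l 2"
    using ys l2 by (auto simp: commuting_tuples_def H_def P_def mat2_mult mult.commute)
  from D_homotopy[OF this] show ?thesis
    by (simp add: H_def P_def map_mat_mat2 o_def)
qed

text \<open>Moving the trace from \<open>x + 1/x\<close> to \<open>x\<^sup>2 + 1/x\<^sup>2\<close> compares the value \<open>q\<close> at
  \<open>(x, x, \<dots>)\<close> with the value \<open>q\<^sup>4\<close> at \<open>(x\<^sup>2, x\<^sup>2, \<dots>)\<close>.\<close>

lemma scalar_symbol_diagonal: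
  assumes ys: "length ys = l - 2" "0 \<notin> set ys" and x: "x > 0"
  shows "scalar_symbol (x # x # ys) = 1"
proof (cases "x = 1")
  case True
  thus ?thesis using scalar.one[of "x # x # ys" 0] ys l2 by simp
next
  case False
  define q where "q = scalar_symbol (x # x # ys)"
  have len: "length (x # x # ys) = l" using ys l2 by auto
  have inv: "y \<noteq> inverse y" if "y > 0" "y \<noteq> 1" for y :: real
  proof
    assume "y = inverse y"
    hence "y * y = 1" using that(1) by (metis less_irrefl right_inverse)
    thus False using that by (auto simp: square_eq_1_iff)
  qed
  have "x\<^sup>2 \<noteq> 1" using x False by (auto simp: power2_eq_1_iff)
  hence ne: "x \<noteq> inverse x" "x\<^sup>2 \<noteq> inverse (x\<^sup>2)" using inv[of x] inv[of "x\<^sup>2"] x False by auto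
  have "q\<^sup>2 = (scalar_symbol (x\<^sup>2 # x\<^sup>2 # ys))\<^sup>2"
    using D_companion[OF ys, of x] D_companion[OF ys, of "x\<^sup>2"] x ne
      companion_homotopy[OF ys, of "x + inverse x" "x\<^sup>2 + inverse (x\<^sup>2)"] by (simp add: q_def)
  also have "scalar_symbol (x\<^sup>2 # x\<^sup>2 # ys) = (scalar_symbol (x # x\<^sup>2 # ys))\<^sup>2"
    using scalar.square[of "x # x\<^sup>2 # ys" 0 x] ys l2 x by simp
  also have "scalar_symbol (x # x\<^sup>2 # ys) = q\<^sup>2"
    using scalar.square[of "x # x # ys" 1 x] ys l2 x by (simp add: q_def)
  finally have q8: "q ^ 2 = ((q ^ 2) ^ 2) ^ 2" .
  have q: "q > 0"
    using scalar.square_slot_positive[of "x # x # ys" 0 "sqrt x"] ys l2 x by (simp add: q_def)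
  have "q ^ 2 * q ^ 6 = q ^ 2 * 1" using q8 unfolding power_mult[symmetric] power_add[symmetric] by simp
  hence "q ^ 6 = 1" using q by (subst (asm) mult_left_cancel) simp_all
  thus ?thesis using q power_eq_imp_eq_base[of q 6 1] by (simp add: q_def)
qed

text \<open>For fixed \<open>x \<noteq> 1\<close> the value at \<open>(x, x\<^sup>r, \<dots>)\<close> is a continuous character of \<open>r\<close> that is trivial
  at \<open>r = 1\<close>, hence trivial.\<close>

lemma scalar_symbol_positive:
  assumes xs: "length xs = l" "\<forall>x\<in>set xs. x > 0"
  shows "scalar_symbol xs = 1"
proof -
  obtain x y ys where xs_eq: "xs = x # y # ys"
    using xs(1) l2 by (metis Suc_le_length_iff numeral_2_eq_2)
  have ys: "length ys = l - 2" "0 \<notin> set ys" and x: "x > 0" and y: "y > 0" using xs by (auto simp: xs_eq)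
  show ?thesis
  proof (cases "x = 1")
    case True
    thus ?thesis using scalar.one[of xs 0] xs l2 by (auto simp: xs_eq)
  next
    case False
    define h where "h r = scalar_symbol (x # x powr r # ys)" for r
    have valid: "length (x # x powr r # ys) = l" "0 \<notin> set (x # x powr r # ys)" for r
      using x ys l2 by auto
    have "h (log x y) = 1"
    proof (rule continuous_character_trivial[where h = h])
      have "continuous_on UNIV (\<lambda>r. D (map scalar_block (x # x powr r # ys)))"
      proof (rule continuous_on_along_path[OF continuous, where n = 1])
        show "map scalar_block (x # x powr t # ys) \<in> commuting_tuples l 1" for t
          unfolding scalar_tuple_iff using valid by simp
        fix i r c :: nat assume irc: "i < l" "r < 1" "c < 1"
        have "(map scalar_block (x # x powr t # ys) ! i) $$ (r, c) = (x # x powr t # ys) ! i" for t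
          using irc valid(1)[of t] by (subst nth_map) (auto simp: scalar_block_def)
        moreover have "continuous_on UNIV (\<lambda>t. (x # x powr t # ys) ! i)"
          using x by (cases i; cases "i - 1") (auto intro!: continuous_intros simp: nth_Cons')
        ultimately show "continuous_on UNIV (\<lambda>t. (map scalar_block (x # x powr t # ys) ! i) $$ (r, c))"
          by simp
      qed simp
      thus "continuous_on UNIV h" by (simp add: h_def scalar_symbol_def)
      show "h (r + s) = h r * h s" for r s
        using scalar.mult[OF valid[of 0], of 1 "x powr r" "x powr s"] x l2 by (simp add: h_def powr_add)
      show "h r \<noteq> 0" for r using scalar.nonzero[OF valid] by (simp add: h_def)
      show "h 1 = 1" using scalar_symbol_diagonal[OF ys x] x by (simp add: h_def)
    qed
    thus ?thesis using x y False by (simp add: h_def xs_eq)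
  qed
qed

sublocale scalar: real_symbol l scalar_symbol
  by unfold_locales (rule scalar_symbol_positive)

text \<open>As a function of the angle, measured in full turns, this is a continuous character that is trivial at 1.\<close>

lemma complex_symbol_unit_circle:
  assumes zs: "length zs = l" "0 \<notin> set zs" and i: "i < l"
  shows "complex_symbol (zs[i := cis \<theta>]) = 1"
proof -
  define h where "h t = complex_symbol (zs[i := cis (2 * pi * t)])" for t
  have valid: "length (zs[i := cis t]) = l" "0 \<notin> set (zs[i := cis t])" for t
    using zs complex.update_nonzero[of zs "cis t" i] by auto
  have "h (\<theta> / (2 * pi)) = 1"
  proof (rule continuous_character_trivial[where h = h])
    have "continuous_on UNIV (\<lambda>t. D (map complex_block (zs[i := cis (2 * pi * t)])))"
    proof (rule continuous_on_along_path[OF continuous, where n = 2])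
      show "map complex_block (zs[i := cis (2 * pi * t)]) \<in> commuting_tuples l 2" for t
        unfolding complex_tuple_iff using valid by simp
      fix k r c :: nat assume k: "k < l" "r < 2" "c < 2"
      have "(map complex_block (zs[i := cis (2 * pi * t)]) ! k) $$ (r, c) =
          complex_block (if k = i then cis (2 * pi * t) else zs ! k) $$ (r, c)" for t
        using k i zs by (subst nth_map) (auto simp: nth_list_update)
      moreover have "continuous_on UNIV (\<lambda>t. complex_block (if k = i then cis (2 * pi * t) else zs ! k) $$ (r, c))"
        using k by (cases "k = i"; cases "r = c"; cases "r = 0")
          (auto simp: complex_block_def intro!: continuous_intros)
      ultimately show "continuous_on UNIV (\<lambda>t. (map complex_block (zs[i := cis (2 * pi * t)]) ! k) $$ (r, c))"
        by simp
    qed simp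
    thus "continuous_on UNIV h" by (simp add: h_def complex_symbol_def)
    show "h (r + s) = h r * h s" for r s
      using complex.mult[OF zs i, of "cis (2 * pi * r)" "cis (2 * pi * s)"]
      by (simp add: h_def cis_mult distrib_left)
    show "h r \<noteq> 0" for r using complex.nonzero[OF valid] by (simp add: h_def)
    show "h 1 = 1" using complex.one[OF zs i] by (simp add: h_def)
  qed
  thus ?thesis by (simp add: h_def)
qed

text \<open>Dividing each entry by its phase, which has no effect, leaves positive reals, and a tuple of
  positive real scalar \<open>2 \<times> 2\<close> matrices is a direct sum of two positive real tuples.\<close>

lemma complex_symbol_trivial:
  assumes zs: "length zs = l" "0 \<notin> set zs"
  shows "complex_symbol zs = 1"
proof -
  define ws where "ws k = map (\<lambda>i. if i < k then complex_of_real (cmod (zs ! i)) else zs ! i) [0..<l]" for k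
  have nz: "zs ! i \<noteq> 0" if "i < l" for i using zs that by (metis nth_mem)
  have valid: "length (ws k) = l" "0 \<notin> set (ws k)" for k
    using nz by (auto simp: ws_def)
  have "complex_symbol (ws k) = complex_symbol zs" if "k \<le> l" for k
    using that
  proof (induction k)
    case 0
    have "ws 0 = zs" using zs by (intro nth_equalityI) (auto simp: ws_def)
    thus ?case by simp
  next
    case (Suc k)
    have upd: "ws k = (ws k)[k := complex_of_real (cmod (zs ! k)) * cis (Arg (zs ! k))]"
      using Suc.prems by (intro nth_equalityI)
        (auto simp: ws_def nth_list_update rcis_cmod_Arg[unfolded rcis_def])
    have "complex_symbol (ws k) = complex_symbol ((ws k)[k := complex_of_real (cmod (zs ! k))]) *
        complex_symbol ((ws k)[k := cis (Arg (zs ! k))])"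
      by (subst upd, rule complex.mult[OF valid]) (use Suc.prems nz[of k] in auto)
    also have "complex_symbol ((ws k)[k := cis (Arg (zs ! k))]) = 1"
      using Suc.prems by (intro complex_symbol_unit_circle valid) simp
    also have "(ws k)[k := complex_of_real (cmod (zs ! k))] = ws (Suc k)"
      using Suc.prems by (intro nth_equalityI) (auto simp: ws_def nth_list_update)
    finally show ?case using Suc by simp
  qed
  hence "complex_symbol zs = complex_symbol (ws l)" by simp
  also have "\<dots> = scalar_symbol (map cmod zs) * scalar_symbol (map cmod zs)"
  proof -
    have "map complex_block (ws l) = map2 (\<lambda>x y. mat2 x 0 0 y) (map cmod zs) (map cmod zs)"
      using zs by (intro nth_equalityI) (auto simp: ws_def complex_block_of_real)
    moreover have "0 \<notin> set (map cmod zs)" using zs by auto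
    ultimately show ?thesis
      using zs D_diagonal(1)[of "map cmod zs" "map cmod zs"] unfolding complex_symbol_def by simp
  qed
  also have "scalar_symbol (map cmod zs) = 1"
  proof (rule scalar_symbol_positive)
    show "\<forall>x\<in>set (map cmod zs). x > 0" using zs(2) by (metis imageE list.set_map zero_less_norm_iff)
  qed (simp add: zs)
  finally show ?thesis by simp
qed

theorem D_trivial:
  assumes neg: "scalar_symbol (replicate l (-1)) = 1" and As: "As \<in> commuting_tuples l n" "n \<ge> 1"
  shows "D As = 1"
  using As
proof (induction rule: commuting_tuple_induct)
  case (scalar xs)
  thus ?case
    using scalar.trivial_unless_all_negative[of xs] scalar.all_negative_value[OF l2, of xs] neg
    by (auto simp: scalar_symbol_def)
next
  case (complex zs)
  thus ?case using complex_symbol_trivial by (simp add: complex_symbol_def)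
next
  case (similar n As S T)
  thus ?case using D_similar by simp
next
  case (extension m k Ms Rs Cs)
  thus ?case using D_extension[of Ms m Cs k Rs] by simp
qed

end

theorem continuous_joint_determinants_agree:
  assumes "continuous_joint_determinant l D" "continuous_joint_determinant l D'"
    and neg: "D (map scalar_block (replicate l (-1))) = D' (map scalar_block (replicate l (-1)))"
    and As: "As \<in> commuting_tuples l n" "n \<ge> 1"
  shows "D As = D' As"
proof -
  interpret D: continuous_joint_determinant l D by fact
  interpret D': continuous_joint_determinant l D' by fact
  show ?thesis using As
  proof (induction rule: commuting_tuple_induct)
    case (scalar xs)
    have "D.scalar_symbol xs = D'.scalar_symbol xs"
    proof (cases "\<forall>x\<in>set xs. x < 0")
      case True
      thus ?thesis using D.scalar.all_negative_value[OF D.l2 scalar(1)] D'.scalar.all_negative_value[OF D.l2 scalar(1)] neg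
        by (simp add: D.scalar_symbol_def D'.scalar_symbol_def)
    next
      case False
      thus ?thesis using D.scalar.trivial_unless_all_negative[OF scalar] D'.scalar.trivial_unless_all_negative[OF scalar] by simp
    qed
    thus ?case by (simp add: D.scalar_symbol_def D'.scalar_symbol_def)
  next
    case (complex zs)
    thus ?case using D.complex_symbol_trivial[OF complex] D'.complex_symbol_trivial[OF complex]
      by (simp add: D.complex_symbol_def D'.complex_symbol_def)
  next
    case (similar n As S T)
    thus ?case using D.D_similar D'.D_similar by simp
  next
    case (extension m k Ms Rs Cs)
    thus ?case using D.D_extension[of Ms m Cs k Rs] D'.D_extension[of Ms m Cs k Rs] by simp
  qed
qed

lemma parity_determinant_one:
  assumes l: "l \<ge> 1"
  shows "parity_determinant l (map scalar_block (replicate l 1)) = 1"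
proof -
  have ct: "map scalar_block (replicate l (1 :: real)) \<in> commuting_tuples l 1"
    unfolding scalar_tuple_iff by simp
  have "\<not> all_negative (map of_real (replicate l 1))" using l by (auto simp: all_negative_def)
  thus ?thesis
    using parity_determinant_eq[OF ct] negative_parity_eq[OF ct l joint_spectrum_scalar]
    by (simp add: neg_sign_def)
qed

lemma minus_one_block: "scalar_block (-1) = (- 1\<^sub>m 1 :: real mat)"
  by (intro eq_matI) (auto simp: scalar_block_def)

theorem corollary7p3:
  fixes l :: nat
  assumes "l \<ge> 2"
  shows "(\<exists>!D. joint_determinant l D \<and> nontrivial_on_tuples l D \<and> continuous_on_tuples l D) \<and>
    (\<forall>D. joint_determinant l D \<and> nontrivial_on_tuples l D \<and> continuous_on_tuples l D \<longrightarrow>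
       D (replicate l (- 1\<^sub>m 1)) = -1 \<and> D ` all_commuting_tuples l = {1, -1})"
proof -
  have l1: "l \<ge> 1" using assms by simp
  let ?e = "map scalar_block (replicate l (-1 :: real))"
  have e: "?e = replicate l (- 1\<^sub>m 1)" by (simp add: minus_one_block)
  have e_ct: "?e \<in> commuting_tuples l 1" unfolding scalar_tuple_iff by simp
  hence e_all: "?e \<in> all_commuting_tuples l" by (auto simp: all_commuting_tuples_def)
  have p: "joint_determinant l (parity_determinant l)" "nontrivial_on_tuples l (parity_determinant l)"
      "continuous_on_tuples l (parity_determinant l)"
    using joint_determinant_parity[OF l1] continuous_on_parity_determinant[OF l1]
      parity_determinant_minus_one[OF l1] e_all
    by (auto simp: nontrivial_on_tuples_def intro!: bexI[of _ ?e])
  have unique: "D = parity_determinant l"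
    if D: "joint_determinant l D" "nontrivial_on_tuples l D" "continuous_on_tuples l D" for D
  proof -
    interpret D: continuous_joint_determinant l D by unfold_locales (use assms D in auto)
    have "D.scalar_symbol (replicate l (-1)) \<noteq> 1"
      using D.D_trivial D(2) by (auto simp: nontrivial_on_tuples_def all_commuting_tuples_def)
    hence De: "D ?e = parity_determinant l ?e"
      using D.scalar.minus_one_value[OF assms] parity_determinant_minus_one[OF l1]
      by (simp add: D.scalar_symbol_def)
    have pc: "continuous_joint_determinant l (parity_determinant l)"
      using p assms by unfold_locales
    have "D As = parity_determinant l As" if "As \<in> commuting_tuples l n" "n \<ge> 1" for As n
      by (rule continuous_joint_determinants_agree[OF D.continuous_joint_determinant_axioms pc De that])
    hence agree: "D As = parity_determinant l As" if "As \<in> all_commuting_tuples l" for As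
      using that by (force simp: all_commuting_tuples_def)
    have "D \<in> extensional (all_commuting_tuples l)"
      using D(1) by (auto simp: joint_determinant_def PiE_def)
    thus ?thesis using agree by (intro extensionalityI[of _ "all_commuting_tuples l"])
      (auto simp: parity_determinant_def)
  qed
  have img: "parity_determinant l ` all_commuting_tuples l = {1, -1}"
  proof
    show "parity_determinant l ` all_commuting_tuples l \<subseteq> {1, -1}"
      using negative_parity_values[OF _ l1] parity_determinant_eq by (fastforce simp: all_commuting_tuples_def)
    have "map scalar_block (replicate l (1 :: real)) \<in> commuting_tuples l 1"
      unfolding scalar_tuple_iff by simp
    hence one_all: "map scalar_block (replicate l (1 :: real)) \<in> all_commuting_tuples l"
      by (auto simp: all_commuting_tuples_def)
    show "{1, -1} \<subseteq> parity_determinant l ` all_commuting_tuples l"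
      using imageI[OF one_all, of "parity_determinant l"] imageI[OF e_all, of "parity_determinant l"]
      unfolding parity_determinant_minus_one[OF l1] parity_determinant_one[OF l1] by blast
  qed
  have minus: "parity_determinant l (replicate l (- 1\<^sub>m 1)) = -1"
    using parity_determinant_minus_one[OF l1] unfolding e .
  have "\<exists>!D. joint_determinant l D \<and> nontrivial_on_tuples l D \<and> continuous_on_tuples l D"
    using p unique by (intro ex1I[of _ "parity_determinant l"] conjI) (assumption | elim conjE)+
  moreover have "D (replicate l (- 1\<^sub>m 1)) = -1 \<and> D ` all_commuting_tuples l = {1, -1}"
    if "joint_determinant l D \<and> nontrivial_on_tuples l D \<and> continuous_on_tuples l D" for D
  proof -
    have "D = parity_determinant l" using that by (elim conjE) (rule unique)
    thus ?thesis using minus img by (simp only: simp_thms)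
  qed
  ultimately show ?thesis by (intro conjI allI impI; simp only: simp_thms)
qed

end
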